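(* Let $K=K_t\times K_x$ where $K_t\subset\mathbb R$ is a bounded interval of length $h_t=|K_t|>0$ and $K_x\subset\mathbb R^d$ is a $d$-simplex of diameter $h_x$. Then every $v\in L^2(K_t;H^1(K_x))\cap H^1(K_t;H^{-1}(K_x))$ satisfies $$\|v-\langle v\rangle_K\|_{L^2(K)}\lesssim h_x\|\nabla_x v\|_{L^2(K)}+\frac{h_t}{h_x}\|\partial_t v\|_{L^2(K_t;H^{-1}(K_x))}.$$ More generally, for all $k,\ell\in\mathbb N_0$ and all such $v$, $$\inf_{v_h\in \mathbb P_k(K_t)\otimes\mathbb P_\ell(K_x)}\|v-v_h\|_{L^2(K)}\lesssim h_x\inf_{v_x\in L^2(K_t;\mathbb P_\ell(K_x))}\|\nabla_x(v-v_x)\|_{L^2(K)}+\frac{h_t}{h_x}\inf_{v_t\in\mathbb P_k(K_t;H^{-1}(K_x))}\|\partial_t(v-v_t)\|_{L^2(K_t;H^{-1}(K_x))}.$$ The hidden constants depend only on $d$, $k$, $\ell$ and the shape regularity of $K_x$.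
   Context: $H^{-1}(K_x)$ is the dual of $H^1_0(K_x)$ with norm $\|\xi\|_{H^{-1}(K_x)}=\sup_{w\in H^1_0(K_x)}\langle\xi,w\rangle_{K_x}/\|\nabla_x w\|_{L^2(K_x)}$; $L^2(K_x)$ is regarded as a subspace of $H^{-1}(K_x)$ via the $L^2$ pairing. $\langle v\rangle_K=|K|^{-1}\int_K v$ denotes the integral mean. $\mathbb P_k(L)$ is the space of polynomials of degree at most $k$ on $L$; $\mathbb P_k(K_t;V)=\mathbb P_k(K_t)\otimes V$ denotes $V$-valued polynomials in time of degree at most $k$. $A\lesssim B$ means $A\le CB$ with a constant $C$ as specified. *)

theory Defs
  imports "HOL-Analysis.Analysis"
begin

definition test_fun :: "'a::euclidean_space set \<Rightarrow> ('a \<Rightarrow> real) \<Rightarrow> bool" where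
  "test_fun U w \<longleftrightarrow> (\<forall>x. w differentiable (at x))
     \<and> (\<forall>i\<in>Basis. continuous_on UNIV (\<lambda>x. frechet_derivative w (at x) i))
     \<and> compact (closure {x. w x \<noteq> 0}) \<and> closure {x. w x \<noteq> 0} \<subseteq> U"

definition grad :: "('a::euclidean_space \<Rightarrow> real) \<Rightarrow> 'a \<Rightarrow> 'a" where
  "grad w x = (\<Sum>i\<in>Basis. frechet_derivative w (at x) i *\<^sub>R i)"

definition L2on :: "'a::euclidean_space set \<Rightarrow> ('a \<Rightarrow> 'b::euclidean_space) \<Rightarrow> bool" where
  "L2on S f \<longleftrightarrow> set_borel_measurable lborel S f
     \<and> set_integrable lborel S (\<lambda>x. (norm (f x))\<^sup>2)"

definition L2norm :: "'a::euclidean_space set \<Rightarrow> ('a \<Rightarrow> 'b::euclidean_space) \<Rightarrow> real" where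
  "L2norm S f = sqrt (LINT x:S|lborel. (norm (f x))\<^sup>2)"

definition mean :: "'a::euclidean_space set \<Rightarrow> ('a \<Rightarrow> real) \<Rightarrow> real" where
  "mean S f = (LINT x:S|lborel. f x) / measure lborel S"

definition xgrad :: "(real \<times> 'a::euclidean_space) set \<Rightarrow> (real \<times> 'a \<Rightarrow> real)
                      \<Rightarrow> (real \<times> 'a \<Rightarrow> 'a) \<Rightarrow> bool" where
  "xgrad K v H \<longleftrightarrow> (\<forall>\<phi> i. test_fun (interior K) \<phi> \<and> i \<in> Basis \<longrightarrow>
     (LINT z:K|lborel. v z * frechet_derivative \<phi> (at z) (0, i))
       = - (LINT z:K|lborel. (H z \<bullet> i) * \<phi> z))"

text \<open>Elements of H^{-1}(Kx) = dual of H^1_0(Kx): linear functionals on test functions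
  bounded w.r.t. the H^1_0-norm ||grad w||, extended by density.\<close>
definition Hm1 :: "'a::euclidean_space set \<Rightarrow> (('a \<Rightarrow> real) \<Rightarrow> real) \<Rightarrow> bool" where
  "Hm1 Kx \<xi> \<longleftrightarrow>
     (\<forall>w1 w2 a b. test_fun (interior Kx) w1 \<and> test_fun (interior Kx) w2 \<longrightarrow>
        \<xi> (\<lambda>x. a * w1 x + b * w2 x) = a * \<xi> w1 + b * \<xi> w2)
   \<and> (\<exists>M. \<forall>w. test_fun (interior Kx) w \<longrightarrow> \<bar>\<xi> w\<bar> \<le> M * L2norm Kx (grad w))"

definition Hm1norm :: "'a::euclidean_space set \<Rightarrow> (('a \<Rightarrow> real) \<Rightarrow> real) \<Rightarrow> real" where
  "Hm1norm Kx \<xi> = Sup {\<xi> w / L2norm Kx (grad w) | w.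
                         test_fun (interior Kx) w \<and> L2norm Kx (grad w) \<noteq> 0}"

definition L2Hm1 :: "real set \<Rightarrow> 'a::euclidean_space set
                      \<Rightarrow> (real \<Rightarrow> ('a \<Rightarrow> real) \<Rightarrow> real) \<Rightarrow> bool" where
  "L2Hm1 Kt Kx g \<longleftrightarrow> (\<forall>t\<in>Kt. Hm1 Kx (g t))
     \<and> (\<forall>w. test_fun (interior Kx) w \<longrightarrow> set_borel_measurable lborel Kt (\<lambda>t. g t w))
     \<and> (\<integral>\<^sup>+ t. indicator Kt t * ennreal ((Hm1norm Kx (g t))\<^sup>2) \<partial>lborel) < \<infinity>"

definition L2Hm1norm :: "real set \<Rightarrow> 'a::euclidean_space set
                      \<Rightarrow> (real \<Rightarrow> ('a \<Rightarrow> real) \<Rightarrow> real) \<Rightarrow> real" where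
  "L2Hm1norm Kt Kx g =
     sqrt (enn2real (\<integral>\<^sup>+ t. indicator Kt t * ennreal ((Hm1norm Kx (g t))\<^sup>2) \<partial>lborel))"

text \<open>L2(Kx)-function v(t,.) regarded as element of H^{-1}(Kx) via the L2 pairing.\<close>
definition pair :: "'a::euclidean_space set \<Rightarrow> (real \<times> 'a \<Rightarrow> real) \<Rightarrow> real
                     \<Rightarrow> ('a \<Rightarrow> real) \<Rightarrow> real" where
  "pair Kx v t w = (LINT x:Kx|lborel. v (t, x) * w x)"

definition has_tderiv :: "real set \<Rightarrow> 'a::euclidean_space set
      \<Rightarrow> (real \<Rightarrow> ('a \<Rightarrow> real) \<Rightarrow> real) \<Rightarrow> (real \<Rightarrow> ('a \<Rightarrow> real) \<Rightarrow> real) \<Rightarrow> bool" where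
  "has_tderiv Kt Kx u g \<longleftrightarrow> (\<forall>\<phi> w. test_fun (interior Kt) \<phi> \<and> test_fun (interior Kx) w \<longrightarrow>
     - (LINT t:Kt|lborel. u t w * deriv \<phi> t) = (LINT t:Kt|lborel. g t w * \<phi> t))"

definition mono :: "('n::finite \<Rightarrow> nat) \<Rightarrow> real^'n \<Rightarrow> real" where
  "mono \<alpha> x = (\<Prod>i\<in>UNIV. (x $ i) ^ \<alpha> i)"

definition multi :: "nat \<Rightarrow> ('n::finite \<Rightarrow> nat) set" where
  "multi l = {\<alpha>. (\<Sum>i\<in>UNIV. \<alpha> i) \<le> l}"

definition tpoly :: "nat \<Rightarrow> nat \<Rightarrow> (real \<times> (real^'n::finite) \<Rightarrow> real) \<Rightarrow> bool" where
  "tpoly k l f \<longleftrightarrow> (\<exists>c. f = (\<lambda>(t, x). \<Sum>j\<le>k. \<Sum>\<alpha>\<in>multi l. c j \<alpha> * t ^ j * mono \<alpha> x))"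

definition L2Pl :: "real set \<Rightarrow> nat \<Rightarrow> (real \<times> (real^'n::finite) \<Rightarrow> real) \<Rightarrow> bool" where
  "L2Pl Kt l f \<longleftrightarrow> (\<exists>c. (\<forall>\<alpha>. L2on Kt (c \<alpha>))
       \<and> f = (\<lambda>(t, x). \<Sum>\<alpha>\<in>multi l. c \<alpha> t * mono \<alpha> x))"

definition shape_bound :: "real \<Rightarrow> 'a::euclidean_space set \<Rightarrow> bool" where
  "shape_bound \<sigma> Kx \<longleftrightarrow> (\<exists>c r. r > 0 \<and> ball c r \<subseteq> Kx \<and> diameter Kx \<le> \<sigma> * r)"

end

theory Submission
  imports Defs
begin

text \<open>Fix test functions $w_i$ and polynomials $q_i$ of degree at most $\ell$ on the unit ball such that
  $\Pi u = \sum_i \langle u, w_i\rangle q_i$ reproduces all polynomials of degree at most $\ell$, and transport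
  them to a ball inscribed in $K_x$. Then $v - v_h$ splits into $v - \Pi v$ and a sum of terms
  $(\langle v, w_i\rangle - p_i) q_i$ with $p_i$ polynomial in time. As $\Pi$ reproduces $v_x$ and functions of
  time only, the first part is bounded by $v - v_x$ minus its $w$-weighted spatial mean, hence by
  $h_x \|\nabla_x (v - v_x)\|$ through a weighted Poincare inequality. For the second part, the time derivative of
  $\langle v, w_i\rangle$ minus the pairing of $v_t$ with $w_i$ is $\langle \partial_t (v - v_t), w_i\rangle$, so
  the one-dimensional Poincare inequality in time applies and $\|\nabla w_i\|$ contributes the factor $1/h_x$.
  Both Poincare inequalities are proved by duality against test functions.\<close>

section \<open>Test functions and cutoffs\<close>


text \<open>All data are weak: \<open>xgrad\<close> and \<open>has_tderiv\<close> yield information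
  only after a test function is inserted, and an element of H^{-1} is known only through its values
  on test functions. So the functionals w_i are compactly supported C1 functions and \<Pi> is not
  the L2 projection; v is never regularised together with its derivatives. In each Poincare
  inequality the derivative is moved onto a specially built test function.

  Shape regularity enters through a ball of radius r in K_x with h_x \<le> \<sigma> r. The w_i, the
  q_i and the averaging weight live on the unit ball and are transported by dilation, so the
  constants depend on d, l and \<sigma> alone. Powers of r cancel: pairing with w_i costs r^(-d/2),
  the norm of grad w_i one more 1/r, and q_i returns r^(d/2).

  In the spatial Poincare inequality, a dilation moving f(t,x) all the way to f(t,y) would have an
  unbounded Jacobian. Stopping halfway, at dilation factor 2, bounds it by 2^d, whence the midpoint.

  The approximants v_x and v_t are never compared: the first occurs only in v - \<Pi> v, the second
  only in the time coefficients. This allows two separate infima.\<close>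

definition C1 :: "('a::euclidean_space \<Rightarrow> real) \<Rightarrow> bool" where
  "C1 f \<longleftrightarrow> (\<exists>g. continuous_on UNIV g \<and> (\<forall>x. (f has_derivative (\<lambda>h. g x \<bullet> h)) (at x)))"

lemma frechet_derivative_eq_inner:
  assumes "(f has_derivative (\<lambda>h. g \<bullet> h)) (at x)"
  shows "frechet_derivative f (at x) = (\<lambda>h. g \<bullet> h)" "grad f x = g"
proof -
  show 1: "frechet_derivative f (at x) = (\<lambda>h. g \<bullet> h)"
    using frechet_derivative_at[OF assms] by simp
  show "grad f x = g" unfolding grad_def 1 by (simp add: euclidean_representation)
qed

lemma C1_grad:
  assumes "C1 f"
  shows "(f has_derivative (\<lambda>h. grad f x \<bullet> h)) (at x)" "continuous_on UNIV (grad f)"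
    "frechet_derivative f (at x) h = grad f x \<bullet> h"
proof -
  obtain g where g: "continuous_on UNIV g" "\<And>x. (f has_derivative (\<lambda>h. g x \<bullet> h)) (at x)"
    using assms unfolding C1_def by blast
  have eq: "grad f = g" using frechet_derivative_eq_inner(2)[OF g(2)] by auto
  show "(f has_derivative (\<lambda>h. grad f x \<bullet> h)) (at x)" "continuous_on UNIV (grad f)"
    using g eq by auto
  show "frechet_derivative f (at x) h = grad f x \<bullet> h"
    using frechet_derivative_eq_inner(1)[OF g(2)] eq by simp
qed

lemma C1_continuous: "C1 f \<Longrightarrow> continuous_on S f"
  using C1_grad(1) has_derivative_continuous by (meson continuous_at_imp_continuous_on)

text \<open>Linearity of the derivative assembles the continuous partial derivatives along
  \<open>Basis\<close> into one continuous gradient. In the form \<open>C1\<close>, sums, products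
  and compositions can be treated without coordinates.\<close>

lemma test_fun_iff:
  "test_fun U w \<longleftrightarrow> C1 w \<and> compact (closure {x. w x \<noteq> 0}) \<and> closure {x. w x \<noteq> 0} \<subseteq> U"
proof -
  have "C1 w" if d: "\<forall>x. w differentiable (at x)"
    and c: "\<forall>i\<in>Basis. continuous_on UNIV (\<lambda>x. frechet_derivative w (at x) i)"
  proof -
    have "(w has_derivative (\<lambda>h. grad w x \<bullet> h)) (at x)" for x
    proof -
      have D: "(w has_derivative frechet_derivative w (at x)) (at x)"
        using d frechet_derivative_works by blast
      then have lin: "linear (frechet_derivative w (at x))"
        using has_derivative_linear by blast
      have "frechet_derivative w (at x) h = grad w x \<bullet> h" for h
      proof -
        have "frechet_derivative w (at x) h
            = frechet_derivative w (at x) (\<Sum>i\<in>Basis. (h \<bullet> i) *\<^sub>R i)"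
          by (simp add: euclidean_representation)
        also have "\<dots> = (\<Sum>i\<in>Basis. (h \<bullet> i) * frechet_derivative w (at x) i)"
          using lin by (simp add: linear_sum linear_cmul)
        also have "\<dots> = grad w x \<bullet> h"
          unfolding grad_def inner_sum_left inner_scaleR_left by (simp add: inner_commute mult.commute)
        finally show ?thesis .
      qed
      then show ?thesis using D by (metis (no_types, lifting) ext)
    qed
    moreover have "continuous_on UNIV (grad w)"
      unfolding grad_def[abs_def] using c by (intro continuous_intros) auto
    ultimately show ?thesis unfolding C1_def by blast
  qed
  moreover have "(\<forall>x. w differentiable (at x)) \<and>
      (\<forall>i\<in>Basis. continuous_on UNIV (\<lambda>x. frechet_derivative w (at x) i))" if "C1 w"
    using C1_grad[OF that] unfolding differentiable_def
    by (auto intro!: continuous_intros)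
  ultimately show ?thesis unfolding test_fun_def by blast
qed

lemma C1_const: "C1 (\<lambda>x. c)"
  unfolding C1_def by (rule exI[of _ "\<lambda>x. 0"]) (auto simp: inner_zero_left[abs_def])

lemma C1_linear:
  fixes f :: "'a::euclidean_space \<Rightarrow> real"
  assumes "bounded_linear f" shows "C1 f"
proof -
  have "f h = adjoint f 1 \<bullet> h" for h
    using adjoint_works[OF bounded_linear.linear[OF assms], of h 1] by (simp add: inner_commute)
  then have "f = (\<lambda>h. adjoint f 1 \<bullet> h)" by auto
  then show ?thesis
    unfolding C1_def using bounded_linear_imp_has_derivative[OF assms]
    by (intro exI[of _ "\<lambda>x. adjoint f 1"]) auto
qed

lemma C1_add:
  assumes "C1 f" "C1 g" shows "C1 (\<lambda>x. f x + g x)"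
  unfolding C1_def
proof (intro exI[of _ "\<lambda>x. grad f x + grad g x"] conjI allI)
  show "continuous_on UNIV (\<lambda>x. grad f x + grad g x)"
    using C1_grad(2) assms by (intro continuous_intros) auto
  show "((\<lambda>x. f x + g x) has_derivative (\<bullet>) (grad f x + grad g x)) (at x)" for x
    by (rule has_derivative_eq_rhs[OF has_derivative_add[OF C1_grad(1)[OF assms(1)] C1_grad(1)[OF assms(2)]]])
      (simp add: inner_add_left fun_eq_iff)
qed

lemma C1_mult:
  assumes "C1 f" "C1 g" shows "C1 (\<lambda>x. f x * g x)"
  unfolding C1_def
proof (intro exI[of _ "\<lambda>x. g x *\<^sub>R grad f x + f x *\<^sub>R grad g x"] conjI allI)
  show "continuous_on UNIV (\<lambda>x. g x *\<^sub>R grad f x + f x *\<^sub>R grad g x)"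
    using C1_grad(2) C1_continuous assms by (intro continuous_intros) auto
  show "((\<lambda>x. f x * g x) has_derivative (\<bullet>) (g x *\<^sub>R grad f x + f x *\<^sub>R grad g x)) (at x)" for x
    by (rule has_derivative_eq_rhs[OF has_derivative_mult[OF C1_grad(1)[OF assms(1)] C1_grad(1)[OF assms(2)]]])
      (simp add: inner_add_left algebra_simps fun_eq_iff)
qed

lemma C1_cmult: "C1 f \<Longrightarrow> C1 (\<lambda>x. c * f x)"
  by (intro C1_mult C1_const)

text \<open>The chain rule puts the adjoint of \<open>A\<close> on the gradient. Since
  \<open>A\<close> may change the dimension, this covers dilations and reflections and also the
  freezing of a variable, as in (t, z) \<mapsto> \<phi> (t, x) with x fixed.\<close>

lemma C1_affine:
  assumes "C1 f" "linear A" shows "C1 (\<lambda>x. f (A x + b))"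
  unfolding C1_def
proof (intro exI[of _ "\<lambda>x. adjoint A (grad f (A x + b))"] conjI allI)
  have cA: "continuous_on UNIV A" "continuous_on UNIV (adjoint A)"
    using assms(2) adjoint_linear linear_continuous_on linear_conv_bounded_linear by blast+
  have "continuous_on UNIV (\<lambda>x. grad f (A x + b))"
    by (rule continuous_on_compose2[OF C1_grad(2)[OF assms(1)]]) (use cA in \<open>auto intro!: continuous_intros\<close>)
  then show "continuous_on UNIV (\<lambda>x. adjoint A (grad f (A x + b)))"
    by (rule continuous_on_compose2[OF cA(2)]) auto
  fix x
  have "((\<lambda>x. A x + b) has_derivative A) (at x)"
    using linear_imp_has_derivative[OF assms(2)] by (auto intro!: derivative_eq_intros)
  then have "((\<lambda>x. f (A x + b)) has_derivative (\<lambda>h. grad f (A x + b) \<bullet> A h)) (at x)"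
    using has_derivative_compose[OF _ C1_grad(1)[OF assms(1)]] by blast
  then show "((\<lambda>x. f (A x + b)) has_derivative (\<bullet>) (adjoint A (grad f (A x + b)))) (at x)"
    by (rule has_derivative_eq_rhs)
      (simp add: fun_eq_iff adjoint_works[OF assms(2), symmetric] inner_commute[of "adjoint A _"] inner_commute[of "grad f _"])
qed

text \<open>The outer derivative is demanded only at values of \<open>f\<close>. This admits
  \<open>u / (1 + u)\<close> along a nonnegative \<open>f\<close>, in spite of the pole at
  -1.\<close>

lemma C1_compose_real:
  fixes \<theta> \<theta>' :: "real \<Rightarrow> real"
  assumes "C1 f" "\<And>x. (\<theta> has_real_derivative \<theta>' (f x)) (at (f x))" "continuous_on (range f) \<theta>'"
  shows "C1 (\<lambda>x. \<theta> (f x))"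
  unfolding C1_def
proof (intro exI[of _ "\<lambda>x. \<theta>' (f x) *\<^sub>R grad f x"] conjI allI)
  show "continuous_on UNIV (\<lambda>x. \<theta>' (f x) *\<^sub>R grad f x)"
    using C1_grad(2) C1_continuous assms
    by (intro continuous_intros continuous_on_compose2[OF assms(3)]) auto
  show "((\<lambda>x. \<theta> (f x)) has_derivative (\<bullet>) (\<theta>' (f x) *\<^sub>R grad f x)) (at x)" for x
    by (rule has_derivative_eq_rhs[OF has_derivative_compose[OF C1_grad(1)[OF assms(1)]
          assms(2)[unfolded has_field_derivative_def]]]) (simp add: fun_eq_iff)
qed

lemma C1_real_polynomial_function: "real_polynomial_function f \<Longrightarrow> C1 f"
  by (induction rule: real_polynomial_function.induct)
    (auto intro: C1_linear C1_const C1_add C1_mult)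

lemma test_funI:
  assumes "C1 w" "compact C" "C \<subseteq> U" "\<And>x. x \<notin> C \<Longrightarrow> w x = 0"
  shows "test_fun U w"
proof -
  have "closure {x. w x \<noteq> 0} \<subseteq> C"
    using assms by (intro closure_minimal) (auto simp: compact_imp_closed)
  moreover from this have "compact (closure {x. w x \<noteq> 0})"
    using assms(2) by (metis closed_closure compact_Int_closed inf.absorb_iff2)
  ultimately show ?thesis unfolding test_fun_iff using assms(1,3) by blast
qed

lemma test_funE:
  assumes "test_fun U w"
  obtains C where "C1 w" "compact C" "C \<subseteq> U" "\<forall>x. x \<notin> C \<longrightarrow> w x = 0"
proof (rule that[of "closure {x. w x \<noteq> 0}"])
  show "C1 w" "compact (closure {x. w x \<noteq> 0})" "closure {x. w x \<noteq> 0} \<subseteq> U"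
    using assms by (simp_all only: test_fun_iff)
  show "\<forall>x. x \<notin> closure {x. w x \<noteq> 0} \<longrightarrow> w x = 0"
    using subsetD[OF closure_subset, of _ "{x. w x \<noteq> 0}"] by auto
qed

lemma test_fun_mult_left:
  assumes "C1 f" "test_fun U w" shows "test_fun U (\<lambda>x. f x * w x)"
proof -
  obtain C where C: "C1 w" "compact C" "C \<subseteq> U" "\<forall>x. x \<notin> C \<longrightarrow> w x = 0"
    by (rule test_funE[OF assms(2)])
  show ?thesis by (rule test_funI[OF C1_mult[OF assms(1) C(1)] C(2,3)]) (simp add: C(4))
qed

lemma test_fun_C1: "test_fun U w \<Longrightarrow> C1 w"
  by (simp add: test_fun_iff)

lemma test_fun_continuous: "test_fun U w \<Longrightarrow> continuous_on S w"
  by (intro C1_continuous test_fun_C1)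

lemma test_fun_lincomb:
  assumes "test_fun U f" "test_fun U g" shows "test_fun U (\<lambda>x. a * f x + b * g x)"
proof -
  obtain C where C: "C1 f" "compact C" "C \<subseteq> U" "\<forall>x. x \<notin> C \<longrightarrow> f x = 0"
    by (rule test_funE[OF assms(1)])
  obtain D where D: "C1 g" "compact D" "D \<subseteq> U" "\<forall>x. x \<notin> D \<longrightarrow> g x = 0"
    by (rule test_funE[OF assms(2)])
  show ?thesis
  proof (rule test_funI[where C="C \<union> D"])
    show "C1 (\<lambda>x. a * f x + b * g x)"
      by (rule C1_add[OF C1_cmult[OF test_fun_C1[OF assms(1)]] C1_cmult[OF test_fun_C1[OF assms(2)]]])
    show "compact (C \<union> D)" using C D by (simp add: compact_Un)
  qed (use C D in auto)
qed

lemma test_fun_eq_0: "test_fun U w \<Longrightarrow> x \<notin> U \<Longrightarrow> w x = 0"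
  using subsetD[OF closure_subset, of x "{x. w x \<noteq> 0}"] unfolding test_fun_def by auto

lemma test_fun_bounded:
  assumes "test_fun U w" obtains B where "B > 0" "\<And>x. \<bar>w x\<bar> \<le> B"
proof -
  obtain C where C: "C1 w" "compact C" "C \<subseteq> U" "\<forall>x. x \<notin> C \<longrightarrow> w x = 0"
    by (rule test_funE[OF assms])
  have "bounded (w ` C)"
    using C test_fun_continuous[OF assms] compact_continuous_image compact_imp_bounded by blast
  then obtain B where "B > 0" "\<And>x. x \<in> C \<Longrightarrow> \<bar>w x\<bar> \<le> B" unfolding bounded_pos by auto
  then show ?thesis using that C(4) by (metis abs_zero less_imp_le)
qed

lemma test_fun_mono: "test_fun U w \<Longrightarrow> U \<subseteq> V \<Longrightarrow> test_fun V w"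
  unfolding test_fun_def by blast

lemma test_fun_borel: "test_fun U w \<Longrightarrow> w \<in> borel_measurable borel"
  by (intro borel_measurable_continuous_onI test_fun_continuous)

section \<open>Bump functions and exhausting cutoffs\<close>

lemma C1_ball_bump:
  fixes c :: "'a::euclidean_space"
  shows "C1 (\<lambda>x. (max 0 (r\<^sup>2 - (x - c) \<bullet> (x - c)))\<^sup>2)"
proof -
  have 1: "C1 (\<lambda>x::'a. r\<^sup>2 - (x - c) \<bullet> (x - c))"
    unfolding C1_def
    by (rule exI[of _ "\<lambda>x. -2 *\<^sub>R (x - c)"])
      (auto intro!: continuous_intros derivative_eq_intros simp: inner_commute inner_diff_left inner_diff_right algebra_simps)
  \<comment> \<open>The squared positive part is C1 and no smoother, which matches the regularity
    asked of test functions. Only u = 0 is delicate: there the difference quotient is bounded by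
    |h|.\<close>
  have 2: "((\<lambda>u::real. (max 0 u)\<^sup>2) has_real_derivative 2 * max 0 u) (at u)" for u
  proof -
    consider "u > 0" | "u < 0" | "u = 0" by linarith
    then show ?thesis
    proof cases
      case 1
      have "((\<lambda>u::real. u\<^sup>2) has_real_derivative 2 * max 0 u) (at u)"
        using 1 by (auto intro!: derivative_eq_intros)
      then show ?thesis
        by (rule has_field_derivative_transform_within_open[of _ _ _ "{0<..}"]) (use 1 in auto)
    next
      case 2
      have "((\<lambda>u::real. 0) has_real_derivative 2 * max 0 u) (at u)"
        using 2 by (auto intro!: derivative_eq_intros)
      then show ?thesis
        by (rule has_field_derivative_transform_within_open[of _ _ _ "{..<0}"]) (use 2 in auto)
    next
      case 3
      have "((\<lambda>h::real. (max 0 h)\<^sup>2 / h) \<longlongrightarrow> 0) (at 0)"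
      proof (rule Lim_null_comparison)
        show "\<forall>\<^sub>F h::real in at 0. norm ((max 0 h)\<^sup>2 / h) \<le> \<bar>h\<bar>"
          by (auto simp: max_def power2_eq_square)
        show "(abs \<longlongrightarrow> (0::real)) (at 0)" by (auto intro!: tendsto_eq_intros)
      qed
      then show ?thesis using 3 by (simp add: DERIV_def)
    qed
  qed
  show ?thesis
    by (rule C1_compose_real[OF 1 2]) (auto intro!: continuous_intros)
qed

lemma bump_pos_iff:
  fixes c :: "'a::euclidean_space"
  assumes "r > 0"
  shows "(max 0 (r\<^sup>2 - (x - c) \<bullet> (x - c)))\<^sup>2 > 0 \<longleftrightarrow> x \<in> ball c r"
    "x \<notin> ball c r \<Longrightarrow> (max 0 (r\<^sup>2 - (x - c) \<bullet> (x - c)))\<^sup>2 = 0"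
proof -
  have "(max 0 (r\<^sup>2 - (x - c) \<bullet> (x - c)))\<^sup>2 > 0 \<longleftrightarrow> (norm (x - c))\<^sup>2 < r\<^sup>2"
    by (auto simp: power2_norm_eq_inner max_def)
  also have "\<dots> \<longleftrightarrow> x \<in> ball c r"
    using assms by (simp add: dist_norm norm_minus_commute power2_less_imp_less power_strict_mono
      abs_le_square_iff[symmetric] linorder_not_le[symmetric])
  finally show 1: "(max 0 (r\<^sup>2 - (x - c) \<bullet> (x - c)))\<^sup>2 > 0 \<longleftrightarrow> x \<in> ball c r" .
  show "x \<notin> ball c r \<Longrightarrow> (max 0 (r\<^sup>2 - (x - c) \<bullet> (x - c)))\<^sup>2 = 0"
    unfolding 1[symmetric] by simp
qed

lemma bump_exists:
  fixes c :: "'a::euclidean_space"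
  assumes "r > 0"
  shows "\<exists>b. test_fun (ball c r) b \<and> (\<forall>x. b x \<ge> 0) \<and> (\<forall>x\<in>ball c (r/2). b x > 0)"
proof -
  \<comment> \<open>The bump has radius \<open>r/2\<close>, so that its support, a closed ball, is a
    compact subset of the open ball of radius \<open>r\<close>.\<close>
  let ?b = "\<lambda>x. (max 0 ((r/2)\<^sup>2 - (x - c) \<bullet> (x - c)))\<^sup>2"
  have t: "test_fun (ball c r) ?b"
  proof (rule test_funI[OF C1_ball_bump])
    show "compact (cball c (r/2))" "cball c (r/2) \<subseteq> ball c r" using assms by auto
    show "?b x = 0" if "x \<notin> cball c (r/2)" for x
      by (rule bump_pos_iff(2)) (use that assms in auto)
  qed
  show ?thesis
  proof (intro exI[of _ ?b] conjI t allI ballI)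
    show "?b x > 0" if "x \<in> ball c (r/2)" for x
      by (subst bump_pos_iff(1)) (use that assms in auto)
  qed simp
qed

text \<open>With bumps $b_j$ on countably many balls exhausting $U$ and $S_m = \sum_{j \le m} b_j$,
  the functions $m S_m / (1 + m S_m)$ are admissible.\<close>

lemma cutoff_sequence:
  fixes U :: "'a::euclidean_space set"
  assumes "open U"
  shows "\<exists>cut. (\<forall>m::nat. test_fun U (cut m)) \<and> (\<forall>m x. 0 \<le> cut m x \<and> cut m x \<le> 1)
    \<and> (\<forall>x\<in>U. (\<lambda>m. cut m x) \<longlonglongrightarrow> 1)"
proof (cases "U = {}")
  case True
  show ?thesis by (rule exI[of _ "\<lambda>m x. 0"]) (simp_all add: True test_funI[OF C1_const, where C="{}"])
next
  case False
  \<comment> \<open>A ball of radius r inside U carries a bump that is positive on the concentric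
    ball of radius r/2. Hence it is the half balls that have to cover U, and Lindelof leaves
    countably many of them.\<close>
  define F where "F = {ball x (r/2) | x r. x \<in> U \<and> r > 0 \<and> ball x r \<subseteq> U}"
  have op: "\<And>S. S \<in> F \<Longrightarrow> open S" unfolding F_def by auto
  obtain F' where F': "F' \<subseteq> F" "countable F'" "\<Union>F' = \<Union>F" by (rule Lindelof[OF op])
  have U: "\<Union>F = U"
  proof
    show "U \<subseteq> \<Union>F"
    proof
      fix x assume x: "x \<in> U"
      then obtain r where "r > 0" "ball x r \<subseteq> U" using assms openE by blast
      then show "x \<in> \<Union>F" unfolding F_def using x by (intro UnionI[of "ball x (r/2)"]) auto
    qed
    show "\<Union>F \<subseteq> U"
    proof
      fix y assume "y \<in> \<Union>F"
      then obtain x r where "y \<in> ball x (r/2)" "r > 0" "ball x r \<subseteq> U" unfolding F_def by auto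
      moreover have "ball x (r/2) \<subseteq> ball x r" using \<open>r > 0\<close> by (simp add: subset_ball)
      ultimately show "y \<in> U" by auto
    qed
  qed
  have "F' \<noteq> {}" using False U F' by auto
  then have B: "range (from_nat_into F') = F'" using F'(2) by (rule range_from_nat_into)
  define B where "B = from_nat_into F'"
  note B = B[folded B_def]
  have "\<exists>b. test_fun U b \<and> (\<forall>x. b x \<ge> 0) \<and> (\<forall>x\<in>B j. b x > 0)" for j
  proof -
    have "B j \<in> F" using B F' by auto
    then obtain x r where xr: "B j = ball x (r/2)" "r > 0" "ball x r \<subseteq> U" unfolding F_def by auto
    show ?thesis using bump_exists[OF xr(2), of x] test_fun_mono[OF _ xr(3)] unfolding xr(1) by blast
  qed
  then have "\<exists>b. \<forall>j. test_fun U (b j) \<and> (\<forall>x. b j x \<ge> 0) \<and> (\<forall>x\<in>B j. b j x > 0)"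
    by (intro choice) blast
  then obtain b where "\<forall>j. test_fun U (b j) \<and> (\<forall>x. b j x \<ge> 0) \<and> (\<forall>x\<in>B j. b j x > 0)" ..
  then have b: "test_fun U (b j)" "b j x \<ge> 0" "x \<in> B j \<Longrightarrow> b j x > 0" for j x
    by blast+
  define S where "S m x = (\<Sum>j\<le>m. b j x)" for m :: nat and x
  have S0: "S m x \<ge> 0" for m x unfolding S_def using b by (simp add: sum_nonneg)
  have tS: "test_fun U (S m)" for m
  proof (induction m)
    case 0 then show ?case using b(1)[of 0] by (simp add: S_def[abs_def])
  next
    case (Suc m)
    have "S (Suc m) = (\<lambda>x. 1 * S m x + 1 * b (Suc m) x)" by (simp add: S_def[abs_def])
    then show ?case using test_fun_lincomb[OF Suc b(1)] by presburger
  qed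
  define cut where "cut m x = (real m * S m x) / (1 + real m * S m x)" for m x
  show ?thesis
  proof (intro exI[of _ cut] conjI allI ballI)
    show "test_fun U (cut m)" for m
    proof -
      obtain C where C: "C1 (S m)" "compact C" "C \<subseteq> U" "\<forall>x. x \<notin> C \<longrightarrow> S m x = 0"
        by (rule test_funE[OF tS[of m]])
      show ?thesis
      proof (rule test_funI[OF _ C(2,3)])
        show "C1 (cut m)" unfolding cut_def[abs_def]
        proof (rule C1_compose_real[of "\<lambda>x. real m * S m x" "\<lambda>u. u / (1 + u)" "\<lambda>u. 1 / (1 + u)\<^sup>2"])
          show "C1 (\<lambda>x. real m * S m x)" using tS test_fun_C1 C1_cmult by blast
          fix x have "1 + real m * S m x \<noteq> 0" using mult_nonneg_nonneg[OF of_nat_0_le_iff S0[of m x], of m] by linarith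
          then show "((\<lambda>u. u / (1 + u)) has_real_derivative 1 / (1 + real m * S m x)\<^sup>2) (at (real m * S m x))"
            by (auto intro!: derivative_eq_intros simp: power2_eq_square)
        next
          have "1 + u \<noteq> 0" if u: "u \<in> range (\<lambda>x. real m * S m x)" for u
          proof -
            obtain x where "u = real m * S m x" using u by blast
            then show ?thesis using mult_nonneg_nonneg[OF of_nat_0_le_iff S0[of m x], of m] by linarith
          qed
          then show "continuous_on (range (\<lambda>x. real m * S m x)) (\<lambda>u. 1 / (1 + u)\<^sup>2)"
            by (intro continuous_intros) auto
        qed
        show "cut m x = 0" if "x \<notin> C" for x using C(4) that by (simp add: cut_def)
      qed
    qed
    have mS: "0 \<le> real m * S m x" for m x using S0 by simp
    show "0 \<le> cut m x" for m x unfolding cut_def by (rule divide_nonneg_nonneg) (use mS[of m x] in linarith)+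
    show "cut m x \<le> 1" for m x unfolding cut_def
      by (subst divide_le_eq_1_pos) (use mS[of m x] in linarith)+
    fix x assume "x \<in> U"
    then have "x \<in> \<Union>(range B)" unfolding B F'(3) U .
    then obtain j where j: "x \<in> B j" by blast
    \<comment> \<open>Once m \<ge> j the bump \<open>b j\<close> is a summand of \<open>S m\<close>,
      so m S_m (x) grows at least linearly in m and the cutoff tends to 1 at x.\<close>
    have ev: "eventually (\<lambda>m. b j x * real m \<le> real m * S m x) sequentially"
      using eventually_ge_at_top[of j]
    proof eventually_elim
      case (elim m)
      have "b j x \<le> S m x" unfolding S_def by (rule member_le_sum) (use elim b in auto)
      then show ?case by (simp add: mult.commute mult_left_mono)
    qed
    have "filterlim (\<lambda>m. b j x * real m) at_top sequentially"
      using b(3)[OF j] filterlim_real_sequentially by (rule filterlim_tendsto_pos_mult_at_top[OF tendsto_const])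
    then have "filterlim (\<lambda>m. real m * S m x) at_top sequentially"
      using ev by (rule filterlim_at_top_mono)
    then have "filterlim (\<lambda>m. 1 + real m * S m x) at_top sequentially"
      by (rule filterlim_tendsto_add_at_top[OF tendsto_const])
    then have "(\<lambda>m. 1 - 1 / (1 + real m * S m x)) \<longlonglongrightarrow> 1 - 0"
      by (intro tendsto_intros tendsto_divide_0[OF tendsto_const] filterlim_at_top_imp_at_infinity)
    moreover have "1 - 1 / (1 + real m * S m x) = cut m x" for m
    proof -
      have "1 + real m * S m x \<noteq> 0" using mS[of m x] by linarith
      then show ?thesis unfolding cut_def by (simp add: field_simps)
    qed
    ultimately show "(\<lambda>m. cut m x) \<longlonglongrightarrow> 1" by simp
  qed
qed

section \<open>Duality for the L2 norm\<close>


lemma L2on_ext: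
  fixes F :: "'a::euclidean_space \<Rightarrow> real"
  assumes "L2on K F"
  shows "(\<lambda>x. indicator K x * F x) \<in> borel_measurable lborel"
    "integrable lborel (\<lambda>x. (indicator K x * F x)\<^sup>2)"
    "L2norm K F = sqrt (LBINT x. (indicator K x * F x)\<^sup>2)"
proof -
  have eq: "(\<lambda>x. indicator K x *\<^sub>R (norm (F x))\<^sup>2) = (\<lambda>x. (indicator K x * F x)\<^sup>2)"
    by (auto simp: fun_eq_iff indicator_def)
  show "(\<lambda>x. indicator K x * F x) \<in> borel_measurable lborel"
    using assms by (simp add: L2on_def set_borel_measurable_def)
  show "integrable lborel (\<lambda>x. (indicator K x * F x)\<^sup>2)"
    using assms unfolding L2on_def set_integrable_def eq by blast
  show "L2norm K F = sqrt (LBINT x. (indicator K x * F x)\<^sup>2)"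
    unfolding L2norm_def set_lebesgue_integral_def eq ..
qed

lemma L2on_integrable:
  fixes F :: "'a::euclidean_space \<Rightarrow> real"
  assumes "L2on K F" "K \<in> sets borel" "bounded K"
  shows "integrable lborel (\<lambda>x. indicator K x * F x)"
proof (rule Bochner_Integration.integrable_bound)
  have "integrable lborel (indicator K :: 'a \<Rightarrow> real)"
    using assms emeasure_bounded_finite[of K] by (intro integrable_real_indicator) auto
  then show "integrable lborel (\<lambda>x. indicator K x + (indicator K x * F x)\<^sup>2)"
    using L2on_ext(2)[OF assms(1)] by simp
  show "(\<lambda>x. indicator K x * F x) \<in> borel_measurable lborel" by (rule L2on_ext[OF assms(1)])
  have "\<bar>y\<bar> \<le> 1 + y\<^sup>2" for y :: real
    using zero_le_power2[of "\<bar>y\<bar> - 1"] zero_le_power2[of y] unfolding power2_diff by simp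
  then show "AE x in lborel. norm (indicator K x * F x) \<le> norm (indicator K x + (indicator K x * F x)\<^sup>2)"
    by (auto simp: indicator_def)
qed

lemma negligible_AE_lborel:
  assumes "negligible N" shows "AE x in lborel. x \<notin> N"
proof -
  have "AE x in lebesgue. x \<notin> N" using assms by (intro AE_not_in) (simp add: negligible_iff_null_sets)
  then show ?thesis by (simp add: AE_completion_iff)
qed

text \<open>Truncating $F$ makes it the bounded a.e. limit of continuous functions, which are replaced by
  polynomials (Stone--Weierstrass) times cutoffs.\<close>

lemma bounded_approx_test_fun:
  fixes F :: "'a::euclidean_space \<Rightarrow> real"
  assumes K: "K \<in> sets borel" "bounded K" "K - interior K \<in> null_sets lborel"
    and F: "F \<in> borel_measurable lborel" "\<And>x. \<bar>F x\<bar> \<le> N" "\<And>x. x \<notin> K \<Longrightarrow> F x = 0"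
  shows "\<exists>\<phi>. (\<forall>n::nat. test_fun (interior K) (\<phi> n)) \<and> (\<forall>n. \<forall>x\<in>K. \<bar>\<phi> n x\<bar> \<le> N + 1)
    \<and> (AE x in lborel. (\<lambda>n. indicator K x * \<phi> n x) \<longlonglongrightarrow> F x)"
proof -
  have N: "N \<ge> 0" using F(2)[of undefined] by linarith
  have "F \<in> borel_measurable lebesgue" using F(1) measurable_completion by blast
  \<comment> \<open>\<open>measurable_on\<close> unfolds to being the limit, off a negligible set,
    of functions continuous on the whole space.\<close>
  then have "F measurable_on UNIV"
    by (subst measurable_on_iff_borel_measurable) (auto simp: lebesgue_on_UNIV_eq)
  then obtain Z g where g: "negligible Z" "\<And>n. continuous_on UNIV (g n)"
    "\<And>x. x \<notin> Z \<Longrightarrow> (\<lambda>n. g n x) \<longlonglongrightarrow> F x"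
    unfolding measurable_on_def by auto
  \<comment> \<open>Clamping to [-N, N] keeps the limit, because |F| \<le> N, and makes the sequence
    uniformly bounded. The polynomial error below 1/(n+1) \<le> 1 then accounts for the bound N +
    1.\<close>
  define h where "h n x = max (-N) (min N (g n x))" for n x
  have hc: "continuous_on S (h n)" for n S
    unfolding h_def using continuous_on_subset[OF g(2)] by (intro continuous_intros) auto
  have hlim: "(\<lambda>n. h n x) \<longlonglongrightarrow> F x" if "x \<notin> Z" for x
  proof -
    have "(\<lambda>n. h n x) \<longlonglongrightarrow> max (-N) (min N (F x))"
      unfolding h_def by (intro tendsto_intros g that)
    moreover have "max (-N) (min N (F x)) = F x" using F(2)[of x] by auto
    ultimately show ?thesis by simp
  qed
  have hN: "\<bar>h n x\<bar> \<le> N" for n x unfolding h_def using N by auto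
  have "\<exists>p. real_polynomial_function p \<and> (\<forall>x\<in>closure K. \<bar>h n x - p x\<bar> < 1 / (real n + 1))" for n
  proof -
    obtain p where "real_polynomial_function p" "\<And>x. x \<in> closure K \<Longrightarrow> \<bar>h n x - p x\<bar> < 1 / (real n + 1)"
      by (rule Stone_Weierstrass_real_polynomial_function[of "closure K" "h n" "1 / (real n + 1)"])
        (use K hc in \<open>auto simp: compact_closure\<close>)
    then show ?thesis by blast
  qed
  then have "\<exists>p. \<forall>n. real_polynomial_function (p n) \<and> (\<forall>x\<in>closure K. \<bar>h n x - p n x\<bar> < 1 / (real n + 1))"
    by (intro choice) blast
  then obtain p where p: "\<forall>n. real_polynomial_function (p n) \<and> (\<forall>x\<in>closure K. \<bar>h n x - p n x\<bar> < 1 / (real n + 1))" ..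
  obtain cut where cut: "\<And>m::nat. test_fun (interior K) (cut m)" "\<And>m x. 0 \<le> cut m x" "\<And>m x. cut m x \<le> 1"
    "\<And>x. x \<in> interior K \<Longrightarrow> (\<lambda>m. cut m x) \<longlonglongrightarrow> (1::real)"
    using cutoff_sequence[OF open_interior[of K]] by blast
  define \<phi> where "\<phi> n x = p n x * cut n x" for n x
  have pK: "\<bar>h n x - p n x\<bar> < 1 / (real n + 1)" if "x \<in> K" for n x
    using p that closure_subset by blast
  have 1: "test_fun (interior K) (\<phi> n)" for n
    unfolding \<phi>_def[abs_def] using p by (intro test_fun_mult_left cut C1_real_polynomial_function) auto
  have 2: "\<bar>\<phi> n x\<bar> \<le> N + 1" if "x \<in> K" for n x
  proof -
    have "1 / (real n + 1) \<le> 1" by (simp add: divide_simps)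
    then have "\<bar>p n x\<bar> \<le> N + 1" using pK[OF that, of n] hN[of n x] by linarith
    moreover have "\<bar>\<phi> n x\<bar> \<le> \<bar>p n x\<bar> * 1" unfolding \<phi>_def abs_mult
      using cut(2,3)[of n x] by (intro mult_left_mono) auto
    ultimately show ?thesis by simp
  qed
  have "AE x in lborel. x \<notin> K - interior K" using K(3) by (rule AE_not_in)
  then have 3: "AE x in lborel. (\<lambda>n. indicator K x * \<phi> n x) \<longlonglongrightarrow> F x"
    using negligible_AE_lborel[OF g(1)]
  proof eventually_elim
    case (elim x)
    show ?case
    proof (cases "x \<in> K")
      case False then show ?thesis using F(3)[of x] by simp
    next
      case True
      then have i: "x \<in> interior K" using elim by auto
      have "(\<lambda>n. h n x - p n x) \<longlonglongrightarrow> 0"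
      proof (rule Lim_null_comparison)
        show "\<forall>\<^sub>F n in sequentially. norm (h n x - p n x) \<le> 1 / (real n + 1)"
          using pK[OF True] by (auto intro!: always_eventually less_imp_le)
        show "(\<lambda>n. 1 / (real n + 1)) \<longlonglongrightarrow> 0"
          using LIMSEQ_inverse_real_of_nat by (simp add: inverse_eq_divide add.commute)
      qed
      then have "(\<lambda>n. h n x - (h n x - p n x)) \<longlonglongrightarrow> F x - 0"
        using hlim elim by (intro tendsto_diff) auto
      then have "(\<lambda>n. p n x * cut n x) \<longlonglongrightarrow> F x * 1"
        using cut(4)[OF i] by (intro tendsto_mult) auto
      then show ?thesis using True by (simp add: \<phi>_def)
    qed
  qed
  show ?thesis using 1 2 3 by blast
qed

text \<open>The truncation \<open>FN N\<close> is bounded, hence approximable by uniformly bounded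
  test functions, and dominated convergence carries the dual bound over to it. For a, the integral
  of its square, this reads a \<le> M sqrt a, so sqrt a \<le> M; finally N tends to infinity. Both
  Poincare inequalities end with this lemma.\<close>

lemma L2_duality:
  fixes F :: "'a::euclidean_space \<Rightarrow> real"
  assumes K: "K \<in> sets borel" "bounded K" "K - interior K \<in> null_sets lborel"
    and F: "L2on K F" and M: "M \<ge> 0"
    and dual: "\<And>\<phi>. test_fun (interior K) \<phi> \<Longrightarrow> \<bar>LINT x:K|lborel. F x * \<phi> x\<bar> \<le> M * L2norm K \<phi>"
  shows "L2norm K F \<le> M"
proof -
  define F0 where "F0 x = indicator K x * F x" for x
  have F0: "F0 \<in> borel_measurable lborel" "integrable lborel (\<lambda>x. (F0 x)\<^sup>2)" "integrable lborel F0"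
    "L2norm K F = sqrt (LBINT x. (F0 x)\<^sup>2)"
    using L2on_ext[OF F] L2on_integrable[OF F K(1,2)] unfolding F0_def[abs_def] by auto
  have indK: "integrable lborel (indicator K :: 'a \<Rightarrow> real)"
    using K emeasure_bounded_finite[of K] by (intro integrable_real_indicator) auto
  \<comment> \<open>Values larger than N are replaced by 0 instead of being clamped, so that
    \<open>F0 x * FN N x = (FN N x)\<^sup>2\<close>.\<close>
  define FN where "FN N x = (if \<bar>F0 x\<bar> \<le> real N then F0 x else 0)" for N x
  have FNm: "FN N \<in> borel_measurable lborel" for N
    unfolding FN_def[abs_def] using F0(1) by measurable
  have step: "(LBINT x. (FN N x)\<^sup>2) \<le> M\<^sup>2" for N
  proof -
    have "\<bar>FN N x\<bar> \<le> real N" "x \<notin> K \<Longrightarrow> FN N x = 0" for x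
      by (auto simp: FN_def F0_def)
    then obtain \<phi> where \<phi>: "\<And>n. test_fun (interior K) (\<phi> n)" "\<And>n x. x \<in> K \<Longrightarrow> \<bar>\<phi> n x\<bar> \<le> real N + 1"
      "AE x in lborel. (\<lambda>n. indicator K x * \<phi> n x) \<longlonglongrightarrow> FN N x"
      using bounded_approx_test_fun[OF K FNm, of N "real N"] by blast
    have \<phi>m: "\<phi> n \<in> borel_measurable borel" for n using test_fun_borel[OF \<phi>(1)] .
    have Km [measurable]: "K \<in> sets borel" by fact
    note [measurable] = \<phi>m F0(1) FNm
    define a where "a = (LBINT x. (FN N x)\<^sup>2)"
    have l1: "(\<lambda>n. LBINT x. F0 x * (indicator K x * \<phi> n x)) \<longlonglongrightarrow> (LBINT x. F0 x * FN N x)"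
    proof (rule integral_dominated_convergence)
      show "integrable lborel (\<lambda>x. \<bar>F0 x\<bar> * (real N + 1))" using F0(3) by (intro integrable_mult_left integrable_abs)
      show "AE x in lborel. (\<lambda>n. F0 x * (indicator K x * \<phi> n x)) \<longlonglongrightarrow> F0 x * FN N x"
        using \<phi>(3) by eventually_elim (intro tendsto_intros)
      show "AE x in lborel. norm (F0 x * (indicator K x * \<phi> n x)) \<le> \<bar>F0 x\<bar> * (real N + 1)" for n
        using \<phi>(2)[of _ n] by (intro AE_I2) (auto simp: abs_mult indicator_def intro!: mult_left_mono)
    qed measurable
    have l2: "(\<lambda>n. LBINT x. (indicator K x * \<phi> n x)\<^sup>2) \<longlonglongrightarrow> a"
      unfolding a_def
    proof (rule integral_dominated_convergence)
      show "integrable lborel (\<lambda>x. indicator K x * (real N + 1)\<^sup>2)" using indK by simp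
      show "AE x in lborel. (\<lambda>n. (indicator K x * \<phi> n x)\<^sup>2) \<longlonglongrightarrow> (FN N x)\<^sup>2"
        using \<phi>(3) by eventually_elim (intro tendsto_intros)
      show "AE x in lborel. norm ((indicator K x * \<phi> n x)\<^sup>2) \<le> indicator K x * (real N + 1)\<^sup>2" for n
      proof (rule AE_I2)
        fix x show "norm ((indicator K x * \<phi> n x)\<^sup>2) \<le> indicator K x * (real N + 1)\<^sup>2"
          using power_mono[OF \<phi>(2)[of x n], of 2] by (cases "x \<in> K") auto
      qed
    qed measurable
    have eq: "F0 x * FN N x = (FN N x)\<^sup>2" for x by (simp add: FN_def power2_eq_square)
    have "\<bar>LBINT x. F0 x * (indicator K x * \<phi> n x)\<bar> \<le> M * sqrt (LBINT x. (indicator K x * \<phi> n x)\<^sup>2)" for n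
    proof -
      have "(LINT x:K|lborel. F x * \<phi> n x) = (LBINT x. F0 x * (indicator K x * \<phi> n x))"
        unfolding set_lebesgue_integral_def F0_def by (intro Bochner_Integration.integral_cong) (auto simp: indicator_def)
      moreover have "L2norm K (\<phi> n) = sqrt (LBINT x. (indicator K x * \<phi> n x)\<^sup>2)"
        unfolding L2norm_def set_lebesgue_integral_def
        by (intro arg_cong[of _ _ sqrt] Bochner_Integration.integral_cong) (auto simp: indicator_def)
      ultimately show ?thesis using dual[OF \<phi>(1), of n] by simp
    qed
    then have "\<bar>LBINT x. F0 x * FN N x\<bar> \<le> M * sqrt a"
      by (intro LIMSEQ_le[OF tendsto_rabs[OF l1] tendsto_mult[OF tendsto_const tendsto_real_sqrt[OF l2]]]) auto
    then have "a \<le> M * sqrt a" unfolding eq a_def by simp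
    moreover have "a \<ge> 0" unfolding a_def by simp
    ultimately have "sqrt a * sqrt a \<le> M * sqrt a" by simp
    then have "sqrt a \<le> M"
      by (cases "a = 0") (use M \<open>a \<ge> 0\<close> in \<open>simp, intro mult_right_le_imp_le[of "sqrt a" "sqrt a" M], auto\<close>)
    then have "(sqrt a)\<^sup>2 \<le> M\<^sup>2" using \<open>a \<ge> 0\<close> by (intro power_mono) auto
    then show ?thesis using \<open>a \<ge> 0\<close> unfolding a_def by simp
  qed
  have "(\<lambda>N. LBINT x. (FN N x)\<^sup>2) \<longlonglongrightarrow> (LBINT x. (F0 x)\<^sup>2)"
  proof (rule integral_dominated_convergence[OF _ _ F0(2)])
    show "(\<lambda>x. (F0 x)\<^sup>2) \<in> borel_measurable lborel" using F0(1) by measurable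
    show "(\<lambda>x. (FN N x)\<^sup>2) \<in> borel_measurable lborel" for N using FNm by measurable
    show "AE x in lborel. (\<lambda>N. (FN N x)\<^sup>2) \<longlonglongrightarrow> (F0 x)\<^sup>2"
    proof (rule AE_I2)
      fix x
      obtain N0 where N0: "\<bar>F0 x\<bar> \<le> real N0" using real_arch_simple by blast
      have "\<forall>\<^sub>F N in sequentially. (FN N x)\<^sup>2 = (F0 x)\<^sup>2"
        using eventually_ge_at_top[of N0] by eventually_elim (use N0 in \<open>auto simp: FN_def\<close>)
      then show "(\<lambda>N. (FN N x)\<^sup>2) \<longlonglongrightarrow> (F0 x)\<^sup>2" by (rule tendsto_eventually)
    qed
    show "AE x in lborel. norm ((FN N x)\<^sup>2) \<le> (F0 x)\<^sup>2" for N by (auto simp: FN_def)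
  qed
  then have "(LBINT x. (F0 x)\<^sup>2) \<le> M\<^sup>2"
    by (rule LIMSEQ_le_const2) (use step in auto)
  then show ?thesis unfolding F0(4) using M by (metis real_sqrt_le_iff real_sqrt_unique)
qed

section \<open>Poincare inequality on an interval\<close>


lemma Cauchy_Schwarz_integral:
  fixes f g :: "'b \<Rightarrow> real"
  assumes [measurable]: "f \<in> borel_measurable M" "g \<in> borel_measurable M"
    and f: "integrable M (\<lambda>x. (f x)\<^sup>2)" and g: "integrable M (\<lambda>x. (g x)\<^sup>2)"
  shows "integrable M (\<lambda>x. f x * g x)"
    "\<bar>\<integral>x. f x * g x \<partial>M\<bar> \<le> sqrt (\<integral>x. (f x)\<^sup>2 \<partial>M) * sqrt (\<integral>x. (g x)\<^sup>2 \<partial>M)"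
proof -
  show fg: "integrable M (\<lambda>x. f x * g x)"
  proof (rule Bochner_Integration.integrable_bound)
    show "integrable M (\<lambda>x. (f x)\<^sup>2 + (g x)\<^sup>2)" using f g by simp
    have "\<bar>u * v\<bar> \<le> u\<^sup>2 + v\<^sup>2" for u v :: real
      using zero_le_power2[of "\<bar>u\<bar> - \<bar>v\<bar>"] zero_le_power2[of u] zero_le_power2[of v]
      mult_nonneg_nonneg[OF abs_ge_zero[of u] abs_ge_zero[of v]]
      unfolding power2_diff abs_mult power2_abs by linarith
    then show "AE x in M. norm (f x * g x) \<le> norm ((f x)\<^sup>2 + (g x)\<^sup>2)" by auto
  qed measurable
  define A where "A = (\<integral>x. (f x)\<^sup>2 \<partial>M)"
  define B where "B = (\<integral>x. (g x)\<^sup>2 \<partial>M)"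
  define C where "C = (\<integral>x. f x * g x \<partial>M)"
  have A: "A \<ge> 0" and B: "B \<ge> 0" unfolding A_def B_def by auto
  have q: "0 \<le> t\<^sup>2 * A + 2 * t * C + B" for t
  proof -
    have "0 \<le> (\<integral>x. (t * f x + g x)\<^sup>2 \<partial>M)" by simp
    also have "\<dots> = (\<integral>x. t\<^sup>2 * (f x)\<^sup>2 + 2 * t * (f x * g x) + (g x)\<^sup>2 \<partial>M)"
      by (intro Bochner_Integration.integral_cong) (auto simp: power2_eq_square algebra_simps)
    also have "\<dots> = t\<^sup>2 * A + 2 * t * C + B"
      unfolding A_def B_def C_def using f g fg by simp
    finally show ?thesis .
  qed
  have "C\<^sup>2 \<le> A * B"
  proof (cases "A = 0")
    case True
    have "C = 0"
    proof (rule ccontr)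
      assume "C \<noteq> 0"
      \<comment> \<open>With A = 0 the quadratic is affine in t, and at this point it takes the
        value -1.\<close>
      then show False using q[of "-(B + 1) / (2 * C)"] True by (simp add: field_simps)
    qed
    then show ?thesis using True by simp
  next
    case False
    then have "A > 0" using A by simp
    have "(-(C / A))\<^sup>2 * A + 2 * (-(C / A)) * C + B = B - C\<^sup>2 / A"
      using False by (simp add: power2_eq_square field_simps)
    then have "C\<^sup>2 / A \<le> B" using q[of "-(C / A)"] by simp
    then show ?thesis using \<open>A > 0\<close> by (simp add: field_simps)
  qed
  then have "sqrt (C\<^sup>2) \<le> sqrt (A * B)" by (rule real_sqrt_le_mono)
  then show "\<bar>\<integral>x. f x * g x \<partial>M\<bar> \<le> sqrt (\<integral>x. (f x)\<^sup>2 \<partial>M) * sqrt (\<integral>x. (g x)\<^sup>2 \<partial>M)"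
    unfolding A_def B_def C_def by (simp add: real_sqrt_mult)
qed

lemma Minkowski_L2:
  fixes f g :: "'b \<Rightarrow> real"
  assumes [measurable]: "f \<in> borel_measurable M" "g \<in> borel_measurable M"
    and f: "integrable M (\<lambda>x. (f x)\<^sup>2)" and g: "integrable M (\<lambda>x. (g x)\<^sup>2)"
  shows "integrable M (\<lambda>x. (f x + g x)\<^sup>2)"
    "sqrt (\<integral>x. (f x + g x)\<^sup>2 \<partial>M) \<le> sqrt (\<integral>x. (f x)\<^sup>2 \<partial>M) + sqrt (\<integral>x. (g x)\<^sup>2 \<partial>M)"
proof -
  note CS = Cauchy_Schwarz_integral[OF assms]
  have e: "(\<lambda>x. (f x + g x)\<^sup>2) = (\<lambda>x. (f x)\<^sup>2 + 2 * (f x * g x) + (g x)\<^sup>2)"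
    by (auto simp: power2_sum fun_eq_iff)
  show "integrable M (\<lambda>x. (f x + g x)\<^sup>2)" unfolding e using f g CS by simp
  define a where "a = sqrt (\<integral>x. (f x)\<^sup>2 \<partial>M)"
  define b where "b = sqrt (\<integral>x. (g x)\<^sup>2 \<partial>M)"
  have "(\<integral>x. (f x + g x)\<^sup>2 \<partial>M) = (\<integral>x. (f x)\<^sup>2 \<partial>M) + 2 * (\<integral>x. f x * g x \<partial>M) + (\<integral>x. (g x)\<^sup>2 \<partial>M)"
    unfolding e using f g CS by simp
  also have "\<dots> \<le> a\<^sup>2 + 2 * (a * b) + b\<^sup>2"
    using CS(2) by (auto simp: a_def b_def)
  also have "\<dots> = (a + b)\<^sup>2" by (simp add: power2_sum)
  finally have "sqrt (\<integral>x. (f x + g x)\<^sup>2 \<partial>M) \<le> sqrt ((a + b)\<^sup>2)" by (rule real_sqrt_le_mono)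
  moreover have "a + b \<ge> 0" by (simp add: a_def b_def)
  ultimately show "sqrt (\<integral>x. (f x + g x)\<^sup>2 \<partial>M) \<le> sqrt (\<integral>x. (f x)\<^sup>2 \<partial>M) + sqrt (\<integral>x. (g x)\<^sup>2 \<partial>M)"
    by (simp add: a_def b_def)
qed

section \<open>Intervals, normalised weights and primitives of test functions\<close>

lemma interval_endpoints:
  fixes Kt :: "real set"
  assumes "is_interval Kt" "bounded Kt" "measure lborel Kt > 0"
  shows "\<exists>a b. a < b \<and> {a<..<b} \<subseteq> Kt \<and> Kt \<subseteq> {a..b} \<and> interior Kt = {a<..<b} \<and> Kt \<in> sets borel
    \<and> measure lborel Kt = b - a \<and> Kt - interior Kt \<in> null_sets lborel"
proof -
  have ne: "Kt \<noteq> {}" using assms(3) by auto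
  have bd: "bdd_above Kt" "bdd_below Kt" using assms(2) bounded_imp_bdd_above bounded_imp_bdd_below by auto
  define a where "a = Inf Kt"
  define b where "b = Sup Kt"
  have sub: "Kt \<subseteq> {a..b}" unfolding a_def b_def using bd by (auto intro: cInf_lower cSup_upper)
  have sub2: "{a<..<b} \<subseteq> Kt"
  proof
    fix x assume "x \<in> {a<..<b}"
    then obtain y z where "y \<in> Kt" "y < x" "z \<in> Kt" "x < z"
      using cInf_less_iff[OF ne bd(2), of x] less_cSup_iff[OF ne bd(1), of x] unfolding a_def b_def by auto
    then show "x \<in> Kt" using assms(1) mem_is_interval_1_I[of Kt y z x] by auto
  qed
  \<comment> \<open>The interval may contain both, one or none of its endpoints: it is the open
    interval plus at most two points, hence Borel.\<close>
  have eq: "Kt = {a<..<b} \<union> (Kt \<inter> {a, b})" using sub sub2 by force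
  have bor: "Kt \<in> sets borel" by (subst eq) (intro sets.Un borel_open borel_closed finite_imp_closed open_greaterThanLessThan, simp)
  have "a \<noteq> b"
  proof
    assume "a = b"
    then have "Kt = {a}" using sub ne by auto
    then show False using assms(3) by simp
  qed
  then have ab: "a < b" using sub ne by fastforce
  have int: "interior Kt = {a<..<b}"
    using interior_mono[OF sub] interior_maximal[OF sub2] by auto
  have nul: "Kt - interior Kt \<in> null_sets lborel"
    by (rule null_sets_subset[of "{a,b}"]) (use sub bor int in \<open>auto intro!: finite_imp_null_set_lborel\<close>)
  have "measure lborel Kt \<le> measure lborel {a..b}"
    by (rule measure_mono_fmeasurable) (use sub bor in \<open>auto simp: fmeasurable_compact\<close>)
  moreover have "measure lborel {a<..<b} \<le> measure lborel Kt"
    by (rule measure_mono_fmeasurable)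
      (use sub2 bor emeasure_bounded_finite[OF assms(2)] in \<open>auto intro!: fmeasurableI\<close>)
  ultimately have "measure lborel Kt = b - a" using ab by simp
  then show ?thesis using ab sub sub2 int bor nul by blast
qed

lemma integrable_test_fun:
  assumes "test_fun U w" shows "integrable lborel w" "integrable lborel (\<lambda>x. (w x)\<^sup>2)"
proof -
  obtain C where C: "C1 w" "compact C" "C \<subseteq> U" "\<forall>x. x \<notin> C \<longrightarrow> w x = 0" by (rule test_funE[OF assms])
  have c: "continuous_on C w" "continuous_on C (\<lambda>x. (w x)\<^sup>2)"
    using test_fun_continuous[OF assms, of C] by (auto intro!: continuous_intros)
  have "(\<lambda>x. indicator C x *\<^sub>R w x) = w" "(\<lambda>x. indicator C x *\<^sub>R (w x)\<^sup>2) = (\<lambda>x. (w x)\<^sup>2)"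
    using C(4) by (auto simp: fun_eq_iff indicator_def)
  then show "integrable lborel w" "integrable lborel (\<lambda>x. (w x)\<^sup>2)"
    using borel_integrable_compact[OF C(2) c(1)] borel_integrable_compact[OF C(2) c(2)] by (auto simp only:)
qed

text \<open>Positivity on a small ball makes the integral of a bump nonzero, so it can be
  normalised. Such a weight replaces the mean value in both Poincare inequalities: unlike a constant
  it is a test function and may be inserted in the weak identities.\<close>

lemma weight_exists:
  fixes c :: "'a::euclidean_space"
  assumes "r > 0"
  shows "\<exists>w. test_fun (ball c r) w \<and> (\<forall>x. w x \<ge> 0) \<and> (\<forall>x\<in>ball c (r/2). w x > 0) \<and> (LBINT x. w x) = 1"
proof -
  obtain b where b: "test_fun (ball c r) b" "\<And>x. b x \<ge> 0" "\<And>x. x \<in> ball c (r/2) \<Longrightarrow> b x > 0"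
    using bump_exists[OF assms, of c] by blast
  define I where "I = (LBINT x. b x)"
  have "I \<noteq> 0"
  proof
    assume "I = 0"
    then have "AE x in lborel. b x = 0"
      using integral_nonneg_eq_0_iff_AE[OF integrable_test_fun(1)[OF b(1)]] b(2) unfolding I_def by simp
    then have "AE x in lborel. x \<notin> ball c (r/2)" by eventually_elim (use b(3) in force)
    then have "emeasure lborel (ball c (r/2)) = 0"
      by (subst (asm) AE_iff_measurable[of "ball c (r/2)"]) auto
    moreover have "measure lborel (ball c (r/2)) > 0" using assms by (simp add: content_ball_pos)
    ultimately show False by (simp add: measure_def)
  qed
  moreover have "I \<ge> 0" unfolding I_def using b(2) by simp
  ultimately have I: "I > 0" by simp
  have "test_fun (ball c r) (\<lambda>x. (1 / I) * b x)" by (rule test_fun_mult_left[OF C1_const b(1)])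
  moreover have "(LBINT x. (1 / I) * b x) = 1" using I by (simp add: I_def)
  ultimately show ?thesis using I b by (intro exI[of _ "\<lambda>x. (1 / I) * b x"]) auto
qed

lemma compact_subset_open_interval:
  fixes C :: "real set"
  assumes "compact C" "C \<subseteq> {a<..<b}" "a < b"
  shows "\<exists>a' b'. a < a' \<and> b' < b \<and> C \<subseteq> {a'..b'}"
proof (cases "C = {}")
  case True then show ?thesis using assms(3) by (intro exI[of _ "(a+b)/2"]) auto
next
  case False
  obtain x y where "x \<in> C" "\<And>t. t \<in> C \<Longrightarrow> x \<le> t" "y \<in> C" "\<And>t. t \<in> C \<Longrightarrow> t \<le> y"
    using compact_attains_inf[OF assms(1) False] compact_attains_sup[OF assms(1) False] by blast
  then show ?thesis using assms(2) by (intro exI[of _ x] exI[of _ y]) auto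
qed

text \<open>The point is the compact support of P: a primitive that vanishes left of the support of
  \<psi> vanishes again to the right of it exactly because \<psi> has integral zero.\<close>

lemma test_fun_antiderivative:
  fixes \<psi> :: "real \<Rightarrow> real"
  assumes \<psi>: "test_fun {a<..<b} \<psi>" and "a < b" and I0: "(LBINT t. \<psi> t) = 0"
  shows "\<exists>P. test_fun {a<..<b} P \<and> (\<forall>t. deriv P t = \<psi> t) \<and> (\<forall>t. \<bar>P t\<bar> \<le> (LBINT t. \<bar>\<psi> t\<bar>))"
proof -
  obtain C where C: "C1 \<psi>" "compact C" "C \<subseteq> {a<..<b}" "\<forall>x. x \<notin> C \<longrightarrow> \<psi> x = 0"
    by (rule test_funE[OF \<psi>])
  obtain a' b' where ab: "a < a'" "b' < b" "C \<subseteq> {a'..b'}"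
    using compact_subset_open_interval[OF C(2,3) \<open>a < b\<close>] by blast
  have cont: "continuous_on S \<psi>" for S using test_fun_continuous[OF \<psi>] .
  have "isCont \<psi> x" for x using cont[of UNIV] continuous_on_eq_continuous_at by blast
  then obtain Q where Q: "\<And>x. (Q has_vector_derivative \<psi> x) (at x)"
    using einterval_antiderivative[of "-\<infinity>" "\<infinity>" \<psi>] by auto
  define P where "P t = Q t - Q a" for t
  have P: "(P has_real_derivative \<psi> x) (at x within S)" for x S
    unfolding P_def using Q[of x] by (auto intro!: derivative_eq_intros
      simp: has_real_derivative_iff_has_vector_derivative[symmetric] intro: has_field_derivative_at_within)
  have fin: "integrable lborel \<psi>" using integrable_test_fun[OF \<psi>] by blast
  have FTC: "P t - P s = (LBINT x. indicator {s..t} x * \<psi> x)" if "s \<le> t" for s t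
    using integral_FTC_Icc[OF that, of P \<psi>] P cont that
    by (simp add: has_real_derivative_iff_has_vector_derivative mult.commute)
  have Pa: "P a = 0" by (simp add: P_def)
  have Pb: "P b = 0"
  proof -
    have "P b - P a = (LBINT x. indicator {a..b} x * \<psi> x)" using FTC \<open>a < b\<close> by simp
    also have "\<dots> = (LBINT x. \<psi> x)"
      using C by (intro Bochner_Integration.integral_cong) (auto simp: indicator_def)
    finally show ?thesis using I0 Pa by simp
  qed
  have L: "P t = 0" if "t < a'" for t
  proof -
    have "\<psi> x = 0" if "x < a'" for x using that ab C(4) by force
    then have "\<exists>c. \<forall>x\<in>{..<a'}. P x = c"
      using P by (intro has_field_derivative_zero_constant) (auto, metis)
    then show ?thesis using that Pa ab(1) by force
  qed
  have R: "P t = 0" if "t > b'" for t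
  proof -
    have "\<psi> x = 0" if "x > b'" for x using that ab C(4) by force
    then have "\<exists>c. \<forall>x\<in>{b'<..}. P x = c"
      using P by (intro has_field_derivative_zero_constant) (auto, metis)
    then show ?thesis using that Pb ab(2) by force
  qed
  have "C1 P" unfolding C1_def
    using P[where S=UNIV] cont by (intro exI[of _ \<psi>]) (auto simp: has_field_derivative_def)
  then have 1: "test_fun {a<..<b} P"
    by (rule test_funI[where C="{a'..b'}"]) (use ab L R in \<open>auto simp: not_le\<close>)
  have 2: "deriv P t = \<psi> t" for t using P[where S=UNIV] by (simp add: DERIV_imp_deriv)
  have 3: "\<bar>P t\<bar> \<le> (LBINT t. \<bar>\<psi> t\<bar>)" for t
  proof (cases "a \<le> t")
    case True
    have "P t = (LBINT x. indicator {a..t} x * \<psi> x)" using FTC[OF True] Pa by simp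
    also have "\<bar>\<dots>\<bar> \<le> (LBINT x. \<bar>indicator {a..t} x * \<psi> x\<bar>)" by (rule integral_abs_bound)
    also have "\<dots> \<le> (LBINT x. \<bar>\<psi> x\<bar>)"
      using fin integrable_mult_indicator[of "{a..t}" lborel \<psi>]
      by (intro integral_mono integrable_abs) (auto simp: indicator_def)
    finally show ?thesis .
  next
    case False then show ?thesis using L ab by simp
  qed
  show ?thesis using 1 2 3 by blast
qed


text \<open>Let w be a weight of integral 1, c = \<integral> y w and S = \<integral> \<phi>. Then
  \<phi> - S w has integral zero and a primitive P which is a test function, and \<integral> (y - c)
  \<phi> = \<integral> y P' = - \<integral> G P. On an interval of length h the sup of |P| is at
  most the L1 norm of \<phi> - S w, hence at most twice that of \<phi>, hence at most 2 sqrt h times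
  the L2 norm of \<phi>. Integrating P^2 over the interval gives another sqrt h, which explains the
  constant 2 h.\<close>

lemma poincare_interval:
  fixes y G :: "real \<Rightarrow> real"
  assumes Kt: "is_interval Kt" "bounded Kt" "measure lborel Kt > 0"
    and y: "L2on Kt y" and G: "L2on Kt G"
    and eq: "\<And>\<phi>. test_fun (interior Kt) \<phi> \<Longrightarrow>
      - (LINT t:Kt|lborel. y t * deriv \<phi> t) = (LINT t:Kt|lborel. G t * \<phi> t)"
  shows "\<exists>c. L2norm Kt (\<lambda>t. y t - c) \<le> 2 * measure lborel Kt * L2norm Kt G"
proof -
  obtain a b where ab: "a < b" "{a<..<b} \<subseteq> Kt" "Kt \<subseteq> {a..b}" "interior Kt = {a<..<b}" "Kt \<in> sets borel"
    "measure lborel Kt = b - a" "Kt - interior Kt \<in> null_sets lborel"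
    using interval_endpoints[OF Kt] by blast
  define h where "h = b - a"
  have h: "h > 0" using ab by (simp add: h_def)
  have "ball ((a+b)/2) ((b-a)/2) = {a<..<b}" by (simp add: ball_eq_greaterThanLessThan field_simps)
  then obtain w where w: "test_fun {a<..<b} w" "\<And>x. w x \<ge> 0" "(LBINT x. w x) = 1"
    using weight_exists[of "(b-a)/2" "(a+b)/2"] ab(1) by auto
  define y0 where "y0 t = indicator Kt t * y t" for t
  define G0 where "G0 t = indicator Kt t * G t" for t
  have y0: "y0 \<in> borel_measurable lborel" "integrable lborel y0"
    using L2on_ext(1)[OF y] L2on_integrable[OF y ab(5) Kt(2)] by (auto simp: y0_def[abs_def])
  have G0: "G0 \<in> borel_measurable lborel" "integrable lborel (\<lambda>t. (G0 t)\<^sup>2)" "L2norm Kt G = sqrt (LBINT t. (G0 t)\<^sup>2)"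
    using L2on_ext[OF G] by (auto simp: G0_def[abs_def])
  have [measurable]: "Kt \<in> sets borel" by fact
  have indK: "integrable lborel (indicator Kt :: real \<Rightarrow> real)" "(LBINT t. indicator Kt t) = h"
    using ab emeasure_bounded_finite[OF Kt(2)] by (auto intro!: integrable_real_indicator simp: h_def)
  have y0test: "integrable lborel (\<lambda>t. y0 t * f t)" if f: "test_fun U f" for f :: "real \<Rightarrow> real" and U
  proof -
    obtain B where B: "B > 0" "\<And>x. \<bar>f x\<bar> \<le> B" using test_fun_bounded[OF f] by metis
    show ?thesis
      by (rule Bochner_Integration.integrable_bound[OF integrable_mult_left[OF y0(2), of B]])
        (use y0 test_fun_borel[OF f] B in \<open>auto simp: abs_mult intro!: mult_left_mono\<close>)
  qed
  define c where "c = (LBINT t. y0 t * w t)"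
  have cK: "L2on Kt (\<lambda>t. y t - c)"
  proof -
    have m: "y0 \<in> borel_measurable lborel" "(\<lambda>t. - c * indicator Kt t) \<in> borel_measurable lborel" using y0 by auto
    have "(\<lambda>t. (- c * indicator Kt t)\<^sup>2) = (\<lambda>t. c\<^sup>2 * indicator Kt t)" by (auto simp: indicator_def)
    then have i: "integrable lborel (\<lambda>t. (- c * indicator Kt t)\<^sup>2)" using indK by simp
    have "(\<lambda>t. indicator Kt t *\<^sub>R (y t - c)) = (\<lambda>t. y0 t + (- c * indicator Kt t))"
      "(\<lambda>t. indicator Kt t *\<^sub>R (norm (y t - c))\<^sup>2) = (\<lambda>t. (y0 t + (- c * indicator Kt t))\<^sup>2)"
      by (auto simp: y0_def indicator_def fun_eq_iff)
    then show ?thesis unfolding L2on_def set_borel_measurable_def set_integrable_def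
      using Minkowski_L2(1)[OF m L2on_ext(2)[OF y, folded y0_def] i] m by auto
  qed
  have "L2norm Kt (\<lambda>t. y t - c) \<le> 2 * h * L2norm Kt G"
  proof (rule L2_duality[OF ab(5) Kt(2) ab(7) cK])
    show "2 * h * L2norm Kt G \<ge> 0" using h G0(3) by simp
    fix \<phi> :: "real \<Rightarrow> real" assume "test_fun (interior Kt) \<phi>"
    then have \<phi>: "test_fun {a<..<b} \<phi>" using ab by simp
    define S where "S = (LBINT t. \<phi> t)"
    define \<psi> where "\<psi> t = 1 * \<phi> t + (- S) * w t" for t
    have \<psi>: "test_fun {a<..<b} \<psi>" unfolding \<psi>_def[abs_def] by (rule test_fun_lincomb[OF \<phi> w(1)])
    have \<psi>I: "(LBINT t. \<psi> t) = 0"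
      unfolding \<psi>_def using w(3) integrable_test_fun[OF \<phi>] integrable_test_fun[OF w(1)] by (simp add: S_def)
    obtain P where P: "test_fun {a<..<b} P" "\<And>t. deriv P t = \<psi> t" "\<And>t. \<bar>P t\<bar> \<le> (LBINT t. \<bar>\<psi> t\<bar>)"
      using test_fun_antiderivative[OF \<psi> ab(1) \<psi>I] by blast
    have \<phi>K: "indicator Kt t * \<phi> t = \<phi> t" for t
      using test_fun_eq_0[OF \<phi>, of t] subsetD[OF ab(2), of t] by (cases "t \<in> Kt") auto
    have n\<phi>: "L2norm Kt \<phi> = sqrt (LBINT t. (\<phi> t)\<^sup>2)"
      unfolding L2norm_def set_lebesgue_integral_def
      by (intro arg_cong[of _ _ sqrt] Bochner_Integration.integral_cong)
        (use \<phi>K in \<open>auto simp: indicator_def split: if_splits\<close>)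
    define I where "I = (LBINT t. \<bar>\<phi> t\<bar>)"
    have isq: "(\<lambda>t. (indicator Kt t)\<^sup>2) = (indicator Kt :: real \<Rightarrow> real)" by (auto simp: indicator_def)
    have "I = (LBINT t. indicator Kt t * \<bar>\<phi> t\<bar>)"
      unfolding I_def by (intro Bochner_Integration.integral_cong) (use \<phi>K in \<open>auto simp: indicator_def split: if_splits\<close>)
    also have "\<dots> \<le> sqrt (LBINT t. (indicator Kt t)\<^sup>2) * sqrt (LBINT t. \<bar>\<phi> t\<bar>\<^sup>2)"
      by (rule order_trans[OF abs_ge_self Cauchy_Schwarz_integral(2)])
        (use indK test_fun_borel[OF \<phi>] integrable_test_fun[OF \<phi>] in \<open>auto simp: isq\<close>)
    also note isq
    finally have I: "I \<le> sqrt h * L2norm Kt \<phi>" using indK(2) n\<phi> by simp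
    have "\<bar>S\<bar> \<le> I" unfolding S_def I_def by (rule integral_abs_bound)
    have "(LBINT t. \<bar>\<psi> t\<bar>) \<le> (LBINT t. \<bar>\<phi> t\<bar> + \<bar>S\<bar> * w t)"
    proof (rule integral_mono)
      show "integrable lborel (\<lambda>t. \<bar>\<psi> t\<bar>)" using integrable_test_fun[OF \<psi>] by simp
      show "integrable lborel (\<lambda>t. \<bar>\<phi> t\<bar> + \<bar>S\<bar> * w t)"
        using integrable_test_fun[OF \<phi>] integrable_test_fun[OF w(1)] by simp
      show "\<bar>\<psi> t\<bar> \<le> \<bar>\<phi> t\<bar> + \<bar>S\<bar> * w t" for t
        using abs_triangle_ineq[of "\<phi> t" "- S * w t"] w(2)[of t] by (simp add: \<psi>_def abs_mult)
    qed
    also have "\<dots> = I + \<bar>S\<bar>"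
      using integrable_test_fun[OF \<phi>] integrable_test_fun[OF w(1)] w(3) by (simp add: I_def)
    also have "\<dots> \<le> 2 * (sqrt h * L2norm Kt \<phi>)" using \<open>\<bar>S\<bar> \<le> I\<close> I by simp
    finally have Pb: "\<bar>P t\<bar> \<le> 2 * (sqrt h * L2norm Kt \<phi>)" for t using P(3)[of t] by linarith
    have "(LBINT t. (P t)\<^sup>2) \<le> (LBINT t. indicator Kt t * (2 * (sqrt h * L2norm Kt \<phi>))\<^sup>2)"
    proof (rule integral_mono)
      show "integrable lborel (\<lambda>t. (P t)\<^sup>2)" using integrable_test_fun[OF P(1)] by simp
      show "integrable lborel (\<lambda>t. indicator Kt t * (2 * (sqrt h * L2norm Kt \<phi>))\<^sup>2)" using indK by simp
      show "(P t)\<^sup>2 \<le> indicator Kt t * (2 * (sqrt h * L2norm Kt \<phi>))\<^sup>2" for t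
        using power_mono[OF Pb[of t], of 2] test_fun_eq_0[OF P(1), of t] subsetD[OF ab(2), of t]
        by (cases "t \<in> Kt") auto
    qed
    also have "\<dots> = (2 * h * L2norm Kt \<phi>)\<^sup>2"
      using indK(2) h by (simp add: power_mult_distrib power2_eq_square[of h])
    finally have "sqrt (LBINT t. (P t)\<^sup>2) \<le> sqrt ((2 * h * L2norm Kt \<phi>)\<^sup>2)" by (rule real_sqrt_le_mono)
    also have "\<dots> = 2 * h * L2norm Kt \<phi>" using h n\<phi> by simp
    finally have nP: "sqrt (LBINT t. (P t)\<^sup>2) \<le> 2 * h * L2norm Kt \<phi>" .
    have "(LINT t:Kt|lborel. (y t - c) * \<phi> t) = (LBINT t. y0 t * \<phi> t - c * \<phi> t)"
      unfolding set_lebesgue_integral_def y0_def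
      by (intro Bochner_Integration.integral_cong) (use \<phi>K in \<open>auto simp: indicator_def left_diff_distrib split: if_splits\<close>)
    also have "\<dots> = (LBINT t. y0 t * \<phi> t) - c * S"
      using y0test[OF \<phi>] integrable_test_fun[OF \<phi>] by (simp add: S_def)
    also have "\<dots> = (LBINT t. y0 t * \<phi> t - S * (y0 t * w t))"
      using y0test[OF \<phi>] y0test[OF w(1)] by (simp add: c_def)
    also have "\<dots> = (LINT t:Kt|lborel. y t * deriv P t)"
      unfolding set_lebesgue_integral_def P(2) y0_def
      by (intro Bochner_Integration.integral_cong) (auto simp: \<psi>_def algebra_simps)
    also have "\<dots> = - (LINT t:Kt|lborel. G t * P t)" using eq[of P] P(1) ab(4) by simp
    also have "(LINT t:Kt|lborel. G t * P t) = (LBINT t. G0 t * P t)"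
      unfolding set_lebesgue_integral_def G0_def by (intro Bochner_Integration.integral_cong) auto
    finally have "\<bar>LINT t:Kt|lborel. (y t - c) * \<phi> t\<bar> = \<bar>LBINT t. G0 t * P t\<bar>" by simp
    also have "\<dots> \<le> sqrt (LBINT t. (G0 t)\<^sup>2) * sqrt (LBINT t. (P t)\<^sup>2)"
      by (rule Cauchy_Schwarz_integral(2)) (use G0 test_fun_borel[OF P(1)] integrable_test_fun[OF P(1)] in auto)
    also have "\<dots> \<le> L2norm Kt G * (2 * h * L2norm Kt \<phi>)"
      unfolding G0(3) by (intro mult_left_mono nP) auto
    finally show "\<bar>LINT t:Kt|lborel. (y t - c) * \<phi> t\<bar> \<le> 2 * h * L2norm Kt G * L2norm Kt \<phi>"
      by (simp add: mult_ac)
  qed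
  then show ?thesis using ab(6) by (auto simp: h_def)
qed

section \<open>Dilations and weak gradients\<close>


text \<open>By the mean value theorem the difference quotients of \<open>k\<close> are bounded by
  \<open>B\<close>, so \<open>B\<close> times |f| dominates along any sequence. The derivative and
  its bound are asked only on \<open>S\<close>, where \<open>f\<close> lives; compactness of the
  closure of a bounded \<open>S\<close> can then supply \<open>B\<close>.\<close>

lemma has_real_derivative_integral:
  fixes f :: "'b \<Rightarrow> real" and k k' :: "real \<Rightarrow> 'b \<Rightarrow> real"
  assumes f: "integrable M f" and s: "s \<in> {a<..<b}"
    and D: "\<And>s z. s \<in> {a<..<b} \<Longrightarrow> z \<in> S \<Longrightarrow> ((\<lambda>s. k s z) has_real_derivative k' s z) (at s)"
    and B: "\<And>s z. s \<in> {a<..<b} \<Longrightarrow> z \<in> S \<Longrightarrow> \<bar>k' s z\<bar> \<le> B"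
    and fS: "\<And>z. z \<notin> S \<Longrightarrow> f z = 0"
    and [measurable]: "\<And>s. k s \<in> borel_measurable M" "k' s \<in> borel_measurable M"
    and i: "\<And>s. s \<in> {a<..<b} \<Longrightarrow> integrable M (\<lambda>z. f z * k s z)"
  shows "((\<lambda>s. \<integral>z. f z * k s z \<partial>M) has_real_derivative (\<integral>z. f z * k' s z \<partial>M)) (at s)"
proof -
  have [measurable]: "f \<in> borel_measurable M" using f by auto
  have "((\<lambda>s. \<integral>z. f z * k s z \<partial>M) has_real_derivative (\<integral>z. f z * k' s z \<partial>M)) (at s within {a<..<b})"
    unfolding has_field_derivative_iff tendsto_at_iff_sequentially
  proof (intro allI impI)
    fix X assume X: "\<forall>i. X i \<in> {a<..<b} - {s}" "X \<longlonglongrightarrow> s"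
    have "(\<lambda>j. \<integral>z. f z * ((k (X j) z - k s z) / (X j - s)) \<partial>M) \<longlonglongrightarrow> (\<integral>z. f z * k' s z \<partial>M)"
    proof (rule integral_dominated_convergence)
      show "integrable M (\<lambda>z. \<bar>f z\<bar> * B)" using f by simp
      show "AE z in M. (\<lambda>j. f z * ((k (X j) z - k s z) / (X j - s))) \<longlonglongrightarrow> f z * k' s z"
      proof (rule AE_I2)
        fix z
        show "(\<lambda>j. f z * ((k (X j) z - k s z) / (X j - s))) \<longlonglongrightarrow> f z * k' s z"
        proof (cases "z \<in> S")
          case False then show ?thesis using fS by simp
        next
          case True
          have "((\<lambda>s. k s z) has_real_derivative k' s z) (at s within {a<..<b})"
            using D[OF s True] by (rule has_field_derivative_at_within)
          then have "(\<lambda>j. (k (X j) z - k s z) / (X j - s)) \<longlonglongrightarrow> k' s z"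
            using X unfolding has_field_derivative_iff tendsto_at_iff_sequentially by (auto simp: o_def)
          then show ?thesis by (intro tendsto_intros)
        qed
      qed
      show "AE z in M. norm (f z * ((k (X j) z - k s z) / (X j - s))) \<le> \<bar>f z\<bar> * B" for j
      proof (rule AE_I2)
        fix z
        show "norm (f z * ((k (X j) z - k s z) / (X j - s))) \<le> \<bar>f z\<bar> * B"
        proof (cases "z \<in> S")
          case False then show ?thesis using fS by simp
        next
          case True
          have "norm (k (X j) z - k s z) \<le> B * norm (X j - s)"
            by (rule field_differentiable_bound[of "{a<..<b}" "\<lambda>s. k s z" "\<lambda>s. k' s z"])
              (use True s X D B in \<open>auto intro: has_field_derivative_at_within\<close>)
          moreover have "\<bar>X j - s\<bar> > 0" using X by auto
          ultimately have "\<bar>(k (X j) z - k s z) / (X j - s)\<bar> \<le> B" by (simp add: field_simps)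
          then show ?thesis unfolding real_norm_def abs_mult by (rule mult_left_mono) simp
        qed
      qed
    qed measurable
    moreover have "(\<integral>z. f z * ((k (X j) z - k s z) / (X j - s)) \<partial>M)
        = ((\<integral>z. f z * k (X j) z \<partial>M) - (\<integral>z. f z * k s z \<partial>M)) / (X j - s)" for j
    proof -
      have "(\<integral>z. f z * ((k (X j) z - k s z) / (X j - s)) \<partial>M)
          = (\<integral>z. (f z * k (X j) z - f z * k s z) / (X j - s) \<partial>M)"
        by (intro Bochner_Integration.integral_cong) (auto simp: algebra_simps diff_divide_distrib)
      also have "\<dots> = ((\<integral>z. f z * k (X j) z \<partial>M) - (\<integral>z. f z * k s z \<partial>M)) / (X j - s)"
        using i[OF s] i[of "X j"] X(1) by simp
      finally show ?thesis .
    qed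
    ultimately show "((\<lambda>u. ((\<integral>z. f z * k u z \<partial>M) - (\<integral>z. f z * k s z \<partial>M)) / (u - s)) \<circ> X)
        \<longlonglongrightarrow> (\<integral>z. f z * k' s z \<partial>M)" by (simp only: o_def)
  qed
  then show ?thesis using s by (simp add: at_within_open[of s "{a<..<b}"])
qed

lemma integrable_mult_continuous:
  fixes f q :: "'b::euclidean_space \<Rightarrow> real"
  assumes "integrable lborel f" "bounded K" "\<And>z. z \<notin> K \<Longrightarrow> f z = 0" "continuous_on UNIV q"
  shows "integrable lborel (\<lambda>z. f z * q z)"
proof -
  have "compact (q ` closure K)"
    using assms by (intro compact_continuous_image continuous_on_subset[OF assms(4)]) (auto simp: compact_closure)
  then obtain B where B: "\<And>z. z \<in> closure K \<Longrightarrow> \<bar>q z\<bar> \<le> B"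
    using compact_imp_bounded bounded_iff by (metis imageI real_norm_def)
  show ?thesis
  proof (rule Bochner_Integration.integrable_bound)
    show "integrable lborel (\<lambda>z. \<bar>f z\<bar> * B)" using assms by simp
    show "AE z in lborel. norm (f z * q z) \<le> norm (\<bar>f z\<bar> * B)"
    proof (rule AE_I2)
      fix z show "norm (f z * q z) \<le> norm (\<bar>f z\<bar> * B)"
      proof (cases "z \<in> K")
        case True
        then have "\<bar>q z\<bar> \<le> \<bar>B\<bar>" using B[of z] closure_subset by fastforce
        then show ?thesis by (simp add: abs_mult mult_left_mono)
      qed (use assms(3) in simp)
    qed
    show "(\<lambda>z. f z * q z) \<in> borel_measurable lborel"
      using assms borel_measurable_continuous_onI[OF assms(4)] by auto
  qed
qed

text \<open>For fixed $y$ and $k_u(t,z) = u^n \varphi(t, y + u(z-y))$ one has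
  $\partial_u k_u = \mathrm{div}_z (u^{n-1}(z-y)\,\varphi(t, y + u(z-y)))$, so the weak gradient controls the
  variation of $u \mapsto \int f k_u$ on $[1,2]$.\<close>

lemma dilation_bound:
  fixes f :: "real \<times> 'a::euclidean_space \<Rightarrow> real" and H :: "real \<times> 'a \<Rightarrow> 'a"
  assumes X: "convex X" "y \<in> X" and K: "bounded (T \<times> X)"
    and f: "integrable lborel f" "\<And>z. z \<notin> T \<times> X \<Longrightarrow> f z = 0"
    and H: "\<And>i. i \<in> Basis \<Longrightarrow> integrable lborel (\<lambda>z. H z \<bullet> i)" "\<And>z. z \<notin> T \<times> X \<Longrightarrow> H z = 0"
    and rel: "\<And>\<phi> i. test_fun (interior T \<times> interior X) \<phi> \<Longrightarrow> i \<in> Basis \<Longrightarrow>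
      (LBINT z. f z * frechet_derivative \<phi> (at z) (0, i)) = - (LBINT z. (H z \<bullet> i) * \<phi> z)"
    and \<phi>: "test_fun (interior T \<times> interior X) \<phi>"
    and B: "\<And>u. 1 \<le> u \<Longrightarrow> u \<le> 2 \<Longrightarrow>
      \<bar>LBINT z. (H z \<bullet> (snd z - y)) * (u ^ (DIM('a) - 1) * \<phi> (fst z, y + u *\<^sub>R (snd z - y)))\<bar> \<le> B"
  shows "\<bar>(LBINT z. f z * \<phi> z) - (LBINT z. f z * (2 ^ DIM('a) * \<phi> (fst z, 2 *\<^sub>R snd z - y)))\<bar> \<le> B"
proof -
  define n where "n = DIM('a)"
  have n: "n = Suc (n - 1)" by (simp add: n_def)
  define K where "K = T \<times> X"
  have bK: "bounded K" using K by (simp add: K_def)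
  define p where "p u z = (fst z, y + u *\<^sub>R (snd z - y))" for u and z :: "real \<times> 'a"
  define k where "k u z = u ^ n * \<phi> (p u z)" for u z
  define k' where "k' u z = real n * u ^ (n - 1) * \<phi> (p u z) + u ^ n * (grad \<phi> (p u z) \<bullet> (0, snd z - y))" for u z
  have C1\<phi>: "C1 \<phi>" using test_fun_C1[OF \<phi>] .
  have \<phi>d: "(\<phi> has_derivative (\<lambda>h. grad \<phi> x \<bullet> h)) (at x)" for x using C1_grad(1)[OF C1\<phi>] .
  have c\<phi>: "continuous_on S \<phi>" "continuous_on S (grad \<phi>)" for S
    using C1_continuous[OF C1\<phi>] continuous_on_subset[OF C1_grad(2)[OF C1\<phi>]] by auto
  have cp: "continuous_on S (\<lambda>v. p (fst v) (snd v))" for S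
    unfolding p_def by (intro continuous_intros)
  have cp1: "continuous_on S (p u)" for S u
    unfolding p_def by (intro continuous_intros)
  have ck: "continuous_on UNIV (k u)" for u
    unfolding k_def by (intro continuous_intros continuous_on_compose2[OF c\<phi>(1)[of UNIV] cp1]) auto
  have ck': "continuous_on UNIV (k' u)" for u
    unfolding k'_def
    by (intro continuous_intros continuous_on_compose2[OF c\<phi>(1)[of UNIV] cp1]
        continuous_on_compose2[OF c\<phi>(2)[of UNIV] cp1]) auto
  have ck2: "continuous_on S (\<lambda>v. k' (fst v) (snd v))" for S
    unfolding k'_def
    by (intro continuous_intros continuous_on_compose2[OF c\<phi>(1)[of UNIV] cp]
        continuous_on_compose2[OF c\<phi>(2)[of UNIV] cp]) auto
  \<comment> \<open>The parameter range is larger than [1,2], so that two-sided derivatives are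
    available at u = 1 and u = 2.\<close>
  have "bounded ((\<lambda>v. k' (fst v) (snd v)) ` ({0..3} \<times> closure K))"
    using bK by (intro compact_imp_bounded compact_continuous_image ck2 compact_Times) (auto simp: compact_closure)
  then obtain D where D0: "\<forall>x\<in>(\<lambda>v. k' (fst v) (snd v)) ` ({0..3} \<times> closure K). norm x \<le> D"
    unfolding bounded_iff by blast
  have D: "\<bar>k' u z\<bar> \<le> D" if "u \<in> {0<..<3}" "z \<in> K" for u z
  proof -
    have "(u, z) \<in> {0..3} \<times> closure K" using that subsetD[OF closure_subset, of z K] by auto
    then show ?thesis using D0[rule_format, OF imageI[of "(u, z)"]] by simp
  qed
  have fK: "f z = 0" if "z \<notin> K" for z using f(2) that by (simp add: K_def)
  have kd: "((\<lambda>u. k u z) has_real_derivative k' u z) (at u)" for u z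
  proof -
    have "((\<lambda>u. p u z) has_derivative (\<lambda>h. h *\<^sub>R (0, snd z - y))) (at u)"
      unfolding p_def by (auto intro!: derivative_eq_intros simp: fun_eq_iff)
    from has_derivative_compose[OF this \<phi>d]
    have "((\<lambda>u. \<phi> (p u z)) has_derivative (\<lambda>h. h * (grad \<phi> (p u z) \<bullet> (0, snd z - y)))) (at u)"
      by (simp only: inner_scaleR_right)
    then have "((\<lambda>u. \<phi> (p u z)) has_real_derivative (grad \<phi> (p u z) \<bullet> (0, snd z - y))) (at u)"
      by (simp add: has_field_derivative_def mult_commute_abs)
    from DERIV_mult[OF DERIV_pow[of n u UNIV] this] show ?thesis
      unfolding k_def k'_def by (simp add: algebra_simps)
  qed
  define g where "g u = (LBINT z. f z * k u z)" for u
  have ki: "integrable lborel (\<lambda>z. f z * k u z)" for u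
    by (rule integrable_mult_continuous[OF f(1) bK fK ck])
  have gd: "(g has_real_derivative (LBINT z. f z * k' u z)) (at u)" if "u \<in> {0<..<3}" for u
    unfolding g_def
  proof (rule has_real_derivative_integral[OF f(1) that, where S=K and B=D])
    show "k u \<in> borel_measurable lborel" "k' u \<in> borel_measurable lborel" for u
      using borel_measurable_continuous_onI[OF ck] borel_measurable_continuous_onI[OF ck'] by auto
  qed (use kd D fK ki in auto)
  have gB: "\<bar>LBINT z. f z * k' u z\<bar> \<le> B" if u: "1 \<le> u" "u \<le> 2" for u
  proof -
    define \<phi>i where "\<phi>i i z = (u ^ (n - 1) * ((snd z - y) \<bullet> i)) * \<phi> (p u z)" for i and z :: "real \<times> 'a"
    define A where "A z = (fst z, u *\<^sub>R snd z)" for z :: "real \<times> 'a"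
    have linA: "linear A" unfolding A_def by (auto intro!: linearI simp: scaleR_add_right)
    have pA: "p u z = A z + (0, y - u *\<^sub>R y)" for z
      by (auto simp: p_def A_def algebra_simps)
    have C1p: "C1 (\<lambda>z. \<phi> (p u z))" unfolding pA by (rule C1_affine[OF C1\<phi> linA])
    obtain C where C: "C1 \<phi>" "compact C" "C \<subseteq> interior T \<times> interior X" "\<forall>x. x \<notin> C \<longrightarrow> \<phi> x = 0"
      by (rule test_funE[OF \<phi>])
    have tp: "test_fun (interior T \<times> interior X) (\<lambda>z. \<phi> (p u z))"
    proof (rule test_funI[OF C1p])
      \<comment> \<open>\<open>?q\<close> inverts the dilation. For u \<ge> 1 it contracts the
        support of \<phi> towards y by the factor 1/u, and convexity keeps the result in the
        interior; this is why only factors u \<ge> 1 occur.\<close>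
      let ?q = "\<lambda>z::real \<times> 'a. (fst z, y + (1/u) *\<^sub>R (snd z - y))"
      show "compact (?q ` C)"
        by (intro compact_continuous_image C(2) continuous_intros)
      show "?q ` C \<subseteq> interior T \<times> interior X"
      proof (rule subsetI)
        fix z assume "z \<in> ?q ` C"
        then obtain t x where tC: "(t, x) \<in> C" and z: "z = (t, y + (1/u) *\<^sub>R (x - y))" by auto
        from tC have tx: "t \<in> interior T" "x \<in> interior X" using C(3) by auto
        have "y - (1/u) *\<^sub>R (y - x) \<in> interior X"
          by (rule mem_interior_convex_shrink[OF X(1) tx(2) X(2)]) (use u in auto)
        moreover have "y - (1/u) *\<^sub>R (y - x) = y + (1/u) *\<^sub>R (x - y)" by (simp add: algebra_simps)
        ultimately show "z \<in> interior T \<times> interior X" using tx(1) z by simp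
      qed
      show "\<phi> (p u z) = 0" if "z \<notin> ?q ` C" for z
      proof -
        have "?q (p u z) = z" using u by (simp add: p_def)
        then have "p u z \<notin> C" using that imageI[of "p u z" C ?q] by auto
        then show ?thesis using C(4) by blast
      qed
    qed
    have lin: "C1 (\<lambda>z::real \<times> 'a. u ^ (n - 1) * ((snd z - y) \<bullet> i))" for i
    proof -
      have "bounded_linear (\<lambda>z::real \<times> 'a. u ^ (n - 1) * (snd z \<bullet> i))"
        by (intro bounded_linear_const_mult bounded_linear_compose[OF bounded_linear_inner_left bounded_linear_snd])
      from C1_add[OF C1_linear[OF this] C1_const[of "- (u ^ (n - 1) * (y \<bullet> i))"]]
      show ?thesis by (simp add: inner_diff_left algebra_simps)
    qed
    have t\<phi>i: "test_fun (interior T \<times> interior X) (\<phi>i i)" for i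
      unfolding \<phi>i_def by (rule test_fun_mult_left[OF lin tp])
    have fd: "frechet_derivative (\<phi>i i) (at z) (0, i) =
        u ^ (n - 1) * \<phi> (p u z) + u ^ n * ((snd z - y) \<bullet> i) * (grad \<phi> (p u z) \<bullet> (0, i))" if i: "i \<in> Basis" for i z
    proof -
      have "(p u has_derivative A) (at z)" unfolding pA[abs_def]
        using linear_imp_has_derivative[OF linA] by (auto intro!: derivative_eq_intros)
      from has_derivative_compose[OF this \<phi>d]
      have d1: "((\<lambda>z. \<phi> (p u z)) has_derivative (\<lambda>h. grad \<phi> (p u z) \<bullet> A h)) (at z)" .
      have d2: "((\<lambda>z. u ^ (n - 1) * ((snd z - y) \<bullet> i)) has_derivative (\<lambda>h. u ^ (n - 1) * (snd h \<bullet> i))) (at z)"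
        by (auto intro!: derivative_eq_intros)
      have "frechet_derivative (\<phi>i i) (at z) = (\<lambda>h. u ^ (n - 1) * ((snd z - y) \<bullet> i) * (grad \<phi> (p u z) \<bullet> A h)
          + u ^ (n - 1) * (snd h \<bullet> i) * \<phi> (p u z))"
        using frechet_derivative_at[OF has_derivative_mult[OF d2 d1]] unfolding \<phi>i_def by simp
      moreover have "grad \<phi> (p u z) \<bullet> A (0, i) = u * (grad \<phi> (p u z) \<bullet> (0, i))"
      proof -
        have "A (0, i) = u *\<^sub>R (0, i)" by (simp add: A_def)
        then show ?thesis by (simp only: inner_scaleR_right)
      qed
      moreover have "u ^ n = u * u ^ (n - 1)" using n by (metis power_Suc)
      ultimately show ?thesis using i by simp
    qed
    \<comment> \<open>Summing the product rule over the n directions: the terms u^(n-1) \<phi> add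
      up to n u^(n-1) \<phi>, the others to u^n times the derivative of \<phi> along (0, z -
      y).\<close>
    have ki': "k' u z = (\<Sum>i\<in>Basis. frechet_derivative (\<phi>i i) (at z) (0, i))" for z
    proof -
      have e: "(0, snd z - y) = (\<Sum>i\<in>Basis. ((snd z - y) \<bullet> i) *\<^sub>R (0::real, i))"
      proof -
        have "(\<Sum>i\<in>Basis. ((snd z - y) \<bullet> i) *\<^sub>R (0::real, i)) = (0, \<Sum>i\<in>Basis. ((snd z - y) \<bullet> i) *\<^sub>R i)"
          by (simp add: sum_prod)
        then show ?thesis by (simp add: euclidean_representation)
      qed
      have "grad \<phi> (p u z) \<bullet> (0, snd z - y) = (\<Sum>i\<in>Basis. ((snd z - y) \<bullet> i) * (grad \<phi> (p u z) \<bullet> (0, i)))"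
        by (subst e) (simp add: inner_sum_right del: scaleR_Pair)
      then show ?thesis
        unfolding k'_def by (simp add: fd sum.distrib sum_distrib_left n_def mult_ac)
    qed
    have cfd: "continuous_on UNIV (\<lambda>z. frechet_derivative (\<phi>i i) (at z) (0, i))" for i
      unfolding C1_grad(3)[OF test_fun_C1[OF t\<phi>i]]
      by (intro continuous_intros C1_grad(2)[OF test_fun_C1[OF t\<phi>i]])
    have "(LBINT z. f z * k' u z) = (\<Sum>i\<in>Basis. LBINT z. f z * frechet_derivative (\<phi>i i) (at z) (0, i))"
      unfolding ki' sum_distrib_left
      by (rule Bochner_Integration.integral_sum) (rule integrable_mult_continuous[OF f(1) bK fK cfd])
    also have "\<dots> = (\<Sum>i\<in>Basis. - (LBINT z. (H z \<bullet> i) * \<phi>i i z))"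
      by (intro sum.cong refl rel t\<phi>i)
    also have "\<dots> = - (\<Sum>i\<in>Basis. LBINT z. (H z \<bullet> i) * \<phi>i i z)" by (simp add: sum_negf)
    also have "(\<Sum>i\<in>Basis. LBINT z. (H z \<bullet> i) * \<phi>i i z) = (LBINT z. (\<Sum>i\<in>Basis. (H z \<bullet> i) * \<phi>i i z))"
      by (rule Bochner_Integration.integral_sum[symmetric])
        (rule integrable_mult_continuous[OF H(1) bK _ test_fun_continuous[OF t\<phi>i]], use H(2) in \<open>auto simp: K_def\<close>)
    also have "\<dots> = (LBINT z. (H z \<bullet> (snd z - y)) * (u ^ (DIM('a) - 1) * \<phi> (fst z, y + u *\<^sub>R (snd z - y))))"
    proof (intro Bochner_Integration.integral_cong refl)
      fix z :: "real \<times> 'a"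
      have "H z \<bullet> (snd z - y) = (\<Sum>i\<in>Basis. (H z \<bullet> i) * ((snd z - y) \<bullet> i))"
        by (rule euclidean_inner)
      then show "(\<Sum>i\<in>Basis. (H z \<bullet> i) * \<phi>i i z)
          = (H z \<bullet> (snd z - y)) * (u ^ (DIM('a) - 1) * \<phi> (fst z, y + u *\<^sub>R (snd z - y)))"
        by (simp add: \<phi>i_def p_def n_def sum_distrib_left sum_distrib_right mult_ac)
    qed
    finally show ?thesis using B[OF u] by simp
  qed
  have "norm (g 1 - g 2) \<le> B * norm (1 - 2 :: real)"
  proof (rule field_differentiable_bound[of "{1..2}" g "\<lambda>u. LBINT z. f z * k' u z"])
    show "(g has_field_derivative (LBINT z. f z * k' u z)) (at u within {1..2})" if "u \<in> {1..2}" for u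
      by (rule has_field_derivative_at_within[OF gd]) (use that in simp)
    show "norm (LBINT z. f z * k' u z) \<le> B" if "u \<in> {1..2}" for u
      unfolding real_norm_def by (rule gB) (use that in simp_all)
  qed simp_all
  then show ?thesis unfolding g_def k_def p_def n_def by (simp add: scaleR_2 algebra_simps)
qed

section \<open>Fubini, affine substitution and L2 estimates\<close>


lemma lborel_Fubini:
  fixes g :: "'a::euclidean_space \<times> 'b::euclidean_space \<Rightarrow> real"
  assumes "integrable lborel g"
  shows "integrable lborel (\<lambda>x. LBINT y. g (x, y))" "(LBINT x. LBINT y. g (x, y)) = (LBINT z. g z)"
    "AE x in lborel. integrable lborel (\<lambda>y. g (x, y))"
    "integrable lborel (\<lambda>y. LBINT x. g (x, y))" "(LBINT y. LBINT x. g (x, y)) = (LBINT z. g z)"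
proof -
  have i: "integrable (lborel \<Otimes>\<^sub>M lborel) g" using assms by (simp add: lborel_prod)
  then have i': "integrable (lborel \<Otimes>\<^sub>M lborel) (case_prod (\<lambda>x y. g (x, y)))" by simp
  show "integrable lborel (\<lambda>x. LBINT y. g (x, y))" "(LBINT x. LBINT y. g (x, y)) = (LBINT z. g z)"
    "AE x in lborel. integrable lborel (\<lambda>y. g (x, y))"
    using lborel_pair.integrable_fst'[OF i] lborel_pair.integral_fst'[OF i] lborel_pair.AE_integrable_fst'[OF i]
    by (simp_all add: lborel_prod)
  show "integrable lborel (\<lambda>y. LBINT x. g (x, y))" "(LBINT y. LBINT x. g (x, y)) = (LBINT z. g z)"
    using lborel_pair.integrable_snd[OF i'] lborel_pair.integral_snd[OF i'] by (simp_all add: lborel_prod)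
qed

lemma lborel_Fubini_integrable:
  fixes g :: "'a::euclidean_space \<times> 'b::euclidean_space \<Rightarrow> real"
  assumes "g \<in> borel_measurable borel" "integrable lborel (\<lambda>x. LBINT y. \<bar>g (x, y)\<bar>)"
    "AE x in lborel. integrable lborel (\<lambda>y. g (x, y))"
  shows "integrable lborel g"
  using lborel_pair.Fubini_integrable[of g] assms by (simp add: lborel_prod)

lemma borel_measurable_slice_integral:
  fixes g :: "'a::euclidean_space \<times> 'b::euclidean_space \<Rightarrow> real"
  assumes "g \<in> borel_measurable borel"
  shows "(\<lambda>x. LBINT y. g (x, y)) \<in> borel_measurable lborel"
    "(\<lambda>y. g (x, y)) \<in> borel_measurable lborel"
proof -
  have "g \<in> borel_measurable (lborel \<Otimes>\<^sub>M lborel)" using assms by (simp add: lborel_prod)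
  then show "(\<lambda>x. LBINT y. g (x, y)) \<in> borel_measurable lborel"
    by (intro lborel.borel_measurable_lebesgue_integral) simp
  have "(\<lambda>y. (x, y)) \<in> borel \<rightarrow>\<^sub>M borel"
    by (intro borel_measurable_continuous_onI continuous_intros)
  from measurable_compose[OF this assms] show "(\<lambda>y. g (x, y)) \<in> borel_measurable lborel" by simp
qed

lemma lborel_integrable_tensor:
  fixes f :: "'a::euclidean_space \<Rightarrow> real" and g :: "'b::euclidean_space \<Rightarrow> real"
  assumes f: "integrable lborel f" and g: "integrable lborel g"
  shows "integrable lborel (\<lambda>z. f (fst z) * g (snd z))"
    "(LBINT z. f (fst z) * g (snd z)) = (LBINT x. f x) * (LBINT y. g y)"
proof -
  have m: "f \<in> borel_measurable borel" "g \<in> borel_measurable borel" using f g by auto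
  have "(fst :: 'a \<times> 'b \<Rightarrow> 'a) \<in> borel \<rightarrow>\<^sub>M borel" "(snd :: 'a \<times> 'b \<Rightarrow> 'b) \<in> borel \<rightarrow>\<^sub>M borel"
    by (intro borel_measurable_continuous_onI continuous_intros)+
  from measurable_compose[OF this(1) m(1)] measurable_compose[OF this(2) m(2)]
  have mm: "(\<lambda>z::'a \<times> 'b. f (fst z) * g (snd z)) \<in> borel_measurable borel" by simp
  show i: "integrable lborel (\<lambda>z::'a \<times> 'b. f (fst z) * g (snd z))"
    by (rule lborel_Fubini_integrable[OF mm]) (use f g in \<open>auto simp: abs_mult\<close>)
  show "(\<integral>z. f (fst z) * g (snd z) \<partial>(lborel :: ('a \<times> 'b) measure)) = (LBINT x. f x) * (LBINT y. g y)"
    using lborel_Fubini(2)[OF i] by simp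
qed

lemma lborel_affine_integral:
  fixes g :: "'a::euclidean_space \<Rightarrow> real"
  assumes g: "integrable lborel g" and c: "c \<noteq> 0"
  shows "integrable lborel (\<lambda>x. g (b + c *\<^sub>R x))"
    "(LBINT x. g x) = \<bar>c\<bar> ^ DIM('a) * (LBINT x. g (b + c *\<^sub>R x))"
proof -
  have [measurable]: "g \<in> borel_measurable borel" using g by auto
  have m: "(\<lambda>x. b + c *\<^sub>R x) \<in> borel \<rightarrow>\<^sub>M borel" by (intro borel_measurable_continuous_onI continuous_intros)
  have "integrable (density (distr lborel borel (\<lambda>x. b + c *\<^sub>R x)) (\<lambda>_. \<bar>c\<bar> ^ DIM('a))) g"
    using g lborel_affine[OF c, of b] by simp
  then have "integrable (distr lborel borel (\<lambda>x. b + c *\<^sub>R x)) (\<lambda>x. \<bar>c\<bar> ^ DIM('a) * g x)"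
    by (subst (asm) integrable_density) auto
  then have "integrable (distr lborel borel (\<lambda>x. b + c *\<^sub>R x)) g" using c by simp
  then show "integrable lborel (\<lambda>x. g (b + c *\<^sub>R x))"
    by (subst (asm) integrable_distr_eq) (use m in auto)
  have "(LBINT x. g x) = (\<integral>x. g x \<partial>density (distr lborel borel (\<lambda>x. b + c *\<^sub>R x)) (\<lambda>_. \<bar>c\<bar> ^ DIM('a)))"
    using lborel_affine[OF c, of b] by simp
  also have "\<dots> = (\<integral>x. \<bar>c\<bar> ^ DIM('a) * g x \<partial>distr lborel borel (\<lambda>x. b + c *\<^sub>R x))"
    by (subst integral_density) auto
  also have "\<dots> = \<bar>c\<bar> ^ DIM('a) * (LBINT x. g (b + c *\<^sub>R x))"
    by (subst integral_distr) (use m in auto)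
  finally show "(LBINT x. g x) = \<bar>c\<bar> ^ DIM('a) * (LBINT x. g (b + c *\<^sub>R x))" .
qed

text \<open>On each integrable slice the substitution contributes u to the power -n, with n the
  spatial dimension, which is at most 1. This compares the L2 norm of a contracted test function
  with the original one. Slices are integrable only for almost every t, hence the detour through an
  almost everywhere identity.\<close>

lemma lborel_dilate_snd_le:
  fixes q :: "real \<times> 'a::euclidean_space \<Rightarrow> real"
  assumes q: "integrable lborel q" "\<And>z. q z \<ge> 0" and u: "u \<ge> 1"
  shows "integrable lborel (\<lambda>z. q (fst z, b + u *\<^sub>R snd z))"
    "(LBINT z. q (fst z, b + u *\<^sub>R snd z)) \<le> (LBINT z. q z)"
proof -
  let ?n = "DIM('a)"
  have qm: "q \<in> borel_measurable borel" using q by auto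
  have "(\<lambda>z. (fst z, b + u *\<^sub>R snd z)) \<in> borel_measurable (borel :: (real \<times> 'a) measure)"
    by (intro borel_measurable_continuous_onI continuous_intros)
  from measurable_compose[OF this qm] have m: "(\<lambda>z. q (fst z, b + u *\<^sub>R snd z)) \<in> borel_measurable borel" .
  have ae: "AE t in lborel. integrable lborel (\<lambda>x. q (t, b + u *\<^sub>R x)) \<and>
      (LBINT x. q (t, b + u *\<^sub>R x)) = (LBINT x. q (t, x)) / u ^ ?n"
    using lborel_Fubini(3)[OF q(1)]
  proof eventually_elim
    case (elim t)
    show ?case using lborel_affine_integral[OF elim, of u b] u by (simp add: field_simps)
  qed
  have i2: "integrable lborel (\<lambda>t. (LBINT x. q (t, x)) / u ^ ?n)"
    using lborel_Fubini(1)[OF q(1)] by simp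
  have m2: "(\<lambda>t. LBINT x. q (t, b + u *\<^sub>R x)) \<in> borel_measurable lborel"
    using borel_measurable_slice_integral(1)[OF m] by simp
  have i3: "integrable lborel (\<lambda>t. LBINT x. q (t, b + u *\<^sub>R x))"
    by (rule integrable_cong_AE_imp[OF i2 m2]) (use ae in \<open>eventually_elim; simp\<close>)
  show i: "integrable lborel (\<lambda>z. q (fst z, b + u *\<^sub>R snd z))"
    by (rule lborel_Fubini_integrable[OF m]) (use i3 q(2) ae in \<open>auto elim: AE_mp\<close>)
  have "(LBINT z. q (fst z, b + u *\<^sub>R snd z)) = (LBINT t. LBINT x. q (t, b + u *\<^sub>R x))"
    using lborel_Fubini(2)[OF i] by simp
  also have "\<dots> = (LBINT t. (LBINT x. q (t, x)) / u ^ ?n)"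
    by (rule integral_cong_AE) (use ae m2 i2 in \<open>auto elim: AE_mp\<close>)
  also have "\<dots> = (LBINT z. q z) / u ^ ?n"
    using lborel_Fubini(2)[OF q(1)] by simp
  also have "\<dots> \<le> (LBINT z. q z)"
  proof -
    have "u ^ ?n \<ge> 1" using u by simp
    moreover have "(LBINT z. q z) \<ge> 0" using q(2) by simp
    ultimately show ?thesis using divide_left_mono[of 1 "u ^ ?n" "LBINT z. q z"] by simp
  qed
  finally show "(LBINT z. q (fst z, b + u *\<^sub>R snd z)) \<le> (LBINT z. q z)" .
qed

section \<open>Calculus of \<open>L2on\<close> and \<open>L2norm\<close>, tensor products and
  pairings\<close>

lemma L2onI:
  fixes F :: "'a::euclidean_space \<Rightarrow> real"
  assumes "(\<lambda>x. indicator K x * F x) \<in> borel_measurable lborel"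
    "integrable lborel (\<lambda>x. (indicator K x * F x)\<^sup>2)"
  shows "L2on K F"
proof -
  have eq: "(\<lambda>x. indicator K x *\<^sub>R (norm (F x))\<^sup>2) = (\<lambda>x. (indicator K x * F x)\<^sup>2)"
    by (auto simp: fun_eq_iff indicator_def)
  show ?thesis unfolding L2on_def set_borel_measurable_def set_integrable_def eq using assms by simp
qed

lemma L2norm_eq:
  fixes F :: "'a::euclidean_space \<Rightarrow> real"
  shows "L2norm K F = sqrt (LBINT x. (indicator K x * F x)\<^sup>2)"
  unfolding L2norm_def set_lebesgue_integral_def
  by (intro arg_cong[of _ _ sqrt] Bochner_Integration.integral_cong) (auto simp: indicator_def)

lemma L2norm_nonneg: "L2norm K F \<ge> 0"
  unfolding L2norm_def set_lebesgue_integral_def by (simp add: Bochner_Integration.integral_nonneg)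

lemma L2on_add:
  fixes F G :: "'a::euclidean_space \<Rightarrow> real"
  assumes "L2on K F" "L2on K G"
  shows "L2on K (\<lambda>x. F x + G x)" "L2norm K (\<lambda>x. F x + G x) \<le> L2norm K F + L2norm K G"
proof -
  have eq: "indicator K x * (F x + G x) = indicator K x * F x + indicator K x * G x" for x
    by (simp add: algebra_simps)
  note M = Minkowski_L2[OF L2on_ext(1)[OF assms(1)] L2on_ext(1)[OF assms(2)] L2on_ext(2)[OF assms(1)] L2on_ext(2)[OF assms(2)]]
  show "L2on K (\<lambda>x. F x + G x)"
    by (rule L2onI) (unfold eq, use L2on_ext(1)[OF assms(1)] L2on_ext(1)[OF assms(2)] M(1) in auto)
  show "L2norm K (\<lambda>x. F x + G x) \<le> L2norm K F + L2norm K G"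
    using M(2) unfolding L2norm_eq eq .
qed

lemma L2on_cmult:
  fixes F :: "'a::euclidean_space \<Rightarrow> real"
  assumes "L2on K F"
  shows "L2on K (\<lambda>x. c * F x)" "L2norm K (\<lambda>x. c * F x) = \<bar>c\<bar> * L2norm K F"
proof -
  have eq: "indicator K x * (c * F x) = c * (indicator K x * F x)" for x by auto
  have sq: "(c * (indicator K x * F x))\<^sup>2 = c\<^sup>2 * (indicator K x * F x)\<^sup>2" for x by (rule power_mult_distrib)
  show "L2on K (\<lambda>x. c * F x)"
    by (rule L2onI; unfold eq sq; intro borel_measurable_times borel_measurable_const integrable_mult_right L2on_ext[OF assms])
  show "L2norm K (\<lambda>x. c * F x) = \<bar>c\<bar> * L2norm K F"
    unfolding L2norm_eq eq sq by (simp add: real_sqrt_mult)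
qed

lemma L2on_zero: "L2on K (\<lambda>x. 0 :: real)" "L2norm K (\<lambda>x. 0 :: real) = 0"
  by (auto intro: L2onI simp: L2norm_eq)

lemma L2on_sum:
  fixes F :: "'i \<Rightarrow> 'a::euclidean_space \<Rightarrow> real"
  assumes "finite I" "\<And>i. i \<in> I \<Longrightarrow> L2on K (F i)"
  shows "L2on K (\<lambda>x. \<Sum>i\<in>I. F i x) \<and> L2norm K (\<lambda>x. \<Sum>i\<in>I. F i x) \<le> (\<Sum>i\<in>I. L2norm K (F i))"
  using assms
proof (induction I)
  case empty show ?case using L2on_zero[of K] by simp
next
  case (insert i I)
  then show ?case using L2on_add[of K "F i" "\<lambda>x. \<Sum>i\<in>I. F i x"] by fastforce
qed

lemma L2on_diff:
  fixes F G :: "'a::euclidean_space \<Rightarrow> real"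
  assumes "L2on K F" "L2on K G" shows "L2on K (\<lambda>x. F x - G x)"
  using L2on_add(1)[OF assms(1) L2on_cmult(1)[OF assms(2), of "-1"]] by simp

lemma L2norm_cong_AE:
  fixes F G :: "'a::euclidean_space \<Rightarrow> real"
  assumes "L2on K F" "L2on K G" "AE x in lborel. x \<in> K \<longrightarrow> F x = G x"
  shows "L2norm K F = L2norm K G"
  unfolding L2norm_eq
  by (intro arg_cong[of _ _ sqrt] integral_cong_AE)
    (use assms L2on_ext(2)[OF assms(1)] L2on_ext(2)[OF assms(2)] in \<open>auto elim!: AE_mp simp: indicator_def\<close>)

lemma L2on_continuous:
  fixes p :: "'a::euclidean_space \<Rightarrow> real"
  assumes "K \<in> sets borel" "bounded K" "continuous_on UNIV p" "\<And>x. x \<in> K \<Longrightarrow> \<bar>p x\<bar> \<le> B"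
  shows "L2on K p" "(L2norm K p)\<^sup>2 \<le> B\<^sup>2 * measure lborel K"
proof -
  have p: "p \<in> borel_measurable borel" using assms borel_measurable_continuous_onI by blast
  have indK: "integrable lborel (indicator K :: 'a \<Rightarrow> real)"
    using assms emeasure_bounded_finite[of K] by (intro integrable_real_indicator) auto
  have le: "(indicator K x * p x)\<^sup>2 \<le> B\<^sup>2 * indicator K x" for x
    using power_mono[OF assms(4)[of x], of 2] by (cases "x \<in> K") auto
  have m: "(\<lambda>x. indicator K x * p x) \<in> borel_measurable lborel" using p assms(1) by simp
  have i: "integrable lborel (\<lambda>x. (indicator K x * p x)\<^sup>2)"
    by (rule Bochner_Integration.integrable_bound[OF integrable_mult_right[OF indK, of "B\<^sup>2"]])
      (use m le in auto)
  show "L2on K p" by (rule L2onI[OF m i])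
  have "(L2norm K p)\<^sup>2 = (LBINT x. (indicator K x * p x)\<^sup>2)" unfolding L2norm_eq by simp
  also have "\<dots> \<le> (LBINT x. B\<^sup>2 * indicator K x)" using i indK le by (intro integral_mono) auto
  finally show "(L2norm K p)\<^sup>2 \<le> B\<^sup>2 * measure lborel K" using assms(1) by simp
qed

text \<open>By Fubini the norm factorises exactly. This separates a coefficient depending on time,
  controlled by an estimate on the interval, from a polynomial in space, controlled by its maximum
  and the volume of K_x.\<close>

lemma L2on_tensor:
  fixes c :: "real \<Rightarrow> real" and p :: "'a::euclidean_space \<Rightarrow> real"
  assumes c: "L2on T c" and p: "L2on X p"
  shows "L2on (T \<times> X) (\<lambda>z. c (fst z) * p (snd z))"
    "L2norm (T \<times> X) (\<lambda>z. c (fst z) * p (snd z)) = L2norm T c * L2norm X p"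
proof -
  have "(fst :: real \<times> 'a \<Rightarrow> real) \<in> borel \<rightarrow>\<^sub>M borel" "(snd :: real \<times> 'a \<Rightarrow> 'a) \<in> borel \<rightarrow>\<^sub>M borel"
    by (intro borel_measurable_continuous_onI continuous_intros)+
  note fs = this
  have mc: "(\<lambda>t. indicator T t * c t) \<in> borel_measurable borel" "(\<lambda>x. indicator X x * p x) \<in> borel_measurable borel"
    using L2on_ext(1)[OF c] L2on_ext(1)[OF p] by simp_all
  have m: "(\<lambda>z. (indicator T (fst z) * c (fst z)) * (indicator X (snd z) * p (snd z))) \<in> borel_measurable lborel"
    using borel_measurable_times[OF measurable_compose[OF fs(1) mc(1)] measurable_compose[OF fs(2) mc(2)]] by simp
  have eq: "indicator (T \<times> X) z * (c (fst z) * p (snd z))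
      = (indicator T (fst z) * c (fst z)) * (indicator X (snd z) * p (snd z))" for z
    by (cases z) (auto simp: indicator_def)
  note t = lborel_integrable_tensor[OF L2on_ext(2)[OF c] L2on_ext(2)[OF p]]
  show "L2on (T \<times> X) (\<lambda>z. c (fst z) * p (snd z))"
    by (rule L2onI) (unfold eq, use m t(1) in \<open>auto simp: power_mult_distrib\<close>)
  show "L2norm (T \<times> X) (\<lambda>z. c (fst z) * p (snd z)) = L2norm T c * L2norm X p"
    unfolding L2norm_eq eq using t(2) by (simp add: power_mult_distrib real_sqrt_mult)
qed

lemma pair_eq:
  assumes "t \<in> T"
  shows "pair X v t w = (LBINT x. (indicator (T \<times> X) (t, x) * v (t, x)) * w x)"
  unfolding pair_def set_lebesgue_integral_def
  by (intro Bochner_Integration.integral_cong) (use assms in \<open>auto simp: indicator_def\<close>)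

text \<open>Cauchy-Schwarz in x on almost every slice, followed by Fubini in t.\<close>

lemma pair_L2:
  fixes v :: "real \<times> 'a::euclidean_space \<Rightarrow> real"
  assumes v: "L2on (T \<times> X) v" and w: "w \<in> borel_measurable borel" "integrable lborel (\<lambda>x. (w x)\<^sup>2)"
  shows "L2on T (\<lambda>t. pair X v t w)"
    "L2norm T (\<lambda>t. pair X v t w) \<le> sqrt (LBINT x. (w x)\<^sup>2) * L2norm (T \<times> X) v"
proof -
  define v0 where "v0 z = indicator (T \<times> X) z * v z" for z
  have v0: "v0 \<in> borel_measurable borel" "integrable lborel (\<lambda>z. (v0 z)\<^sup>2)"
    using L2on_ext[OF v] by (auto simp: v0_def[abs_def])
  have "(snd :: real \<times> 'a \<Rightarrow> 'a) \<in> borel \<rightarrow>\<^sub>M borel"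
    by (intro borel_measurable_continuous_onI continuous_intros)
  from measurable_compose[OF this w(1)] have mm: "(\<lambda>z. v0 z * w (snd z)) \<in> borel_measurable borel" using v0 by simp
  define P where "P t = (LBINT x. v0 (t, x) * w x)" for t
  have P: "indicator T t * pair X v t w = P t" for t
    by (cases "t \<in> T") (auto simp: P_def v0_def pair_eq)
  have mP: "P \<in> borel_measurable lborel"
    using borel_measurable_slice_integral(1)[OF mm] by (simp add: P_def[abs_def])
  define W where "W = (LBINT x. (w x)\<^sup>2)"
  have le: "AE t in lborel. (P t)\<^sup>2 \<le> W * (LBINT x. (v0 (t, x))\<^sup>2)"
    using lborel_Fubini(3)[OF v0(2)]
  proof eventually_elim
    case (elim t)
    have "\<bar>P t\<bar> \<le> sqrt (LBINT x. (v0 (t, x))\<^sup>2) * sqrt W"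
      unfolding P_def W_def
      by (rule Cauchy_Schwarz_integral(2)) (use elim w borel_measurable_slice_integral(2)[OF v0(1)] in auto)
    then have "\<bar>P t\<bar>\<^sup>2 \<le> (sqrt (LBINT x. (v0 (t, x))\<^sup>2) * sqrt W)\<^sup>2" by (intro power_mono) auto
    then show ?case by (simp add: power_mult_distrib W_def mult.commute)
  qed
  have i2: "integrable lborel (\<lambda>t. W * (LBINT x. (v0 (t, x))\<^sup>2))"
    using lborel_Fubini(1)[OF v0(2)] by simp
  have i: "integrable lborel (\<lambda>t. (P t)\<^sup>2)"
    by (rule Bochner_Integration.integrable_bound[OF i2]) (use mP le in \<open>auto elim!: AE_mp\<close>)
  show "L2on T (\<lambda>t. pair X v t w)"
    by (rule L2onI) (unfold P, use mP i in auto)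
  have "(LBINT t. (P t)\<^sup>2) \<le> (LBINT t. W * (LBINT x. (v0 (t, x))\<^sup>2))"
    by (rule integral_mono_AE[OF i i2 le])
  also have "\<dots> = W * (LBINT z. (v0 z)\<^sup>2)" using lborel_Fubini(2)[OF v0(2)] by simp
  finally have "sqrt (LBINT t. (P t)\<^sup>2) \<le> sqrt (W * (LBINT z. (v0 z)\<^sup>2))" by (rule real_sqrt_le_mono)
  then show "L2norm T (\<lambda>t. pair X v t w) \<le> sqrt (LBINT x. (w x)\<^sup>2) * L2norm (T \<times> X) v"
    unfolding L2norm_eq P by (simp add: real_sqrt_mult W_def v0_def)
qed

section \<open>Weighted Poincare inequality on convex sets\<close>


text \<open>If \<open>f\<close> is not integrable its integral is 0 by convention and the bound is
  trivial. Parameter integrals such as those in \<open>weighted_poincare\<close> can thus be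
  estimated pointwise, with integrability shown only for the majorant.\<close>

lemma abs_integral_le:
  fixes f g :: "'b \<Rightarrow> real"
  assumes "integrable M g" "\<And>x. \<bar>f x\<bar> \<le> g x"
  shows "\<bar>\<integral>x. f x \<partial>M\<bar> \<le> (\<integral>x. g x \<partial>M)"
proof (cases "integrable M f")
  case True
  have "\<bar>\<integral>x. f x \<partial>M\<bar> \<le> (\<integral>x. \<bar>f x\<bar> \<partial>M)" by (rule integral_abs_bound)
  also have "\<dots> \<le> (\<integral>x. g x \<partial>M)" using assms True by (intro integral_mono) auto
  finally show ?thesis .
next
  case False
  have "g x \<ge> 0" for x using assms(2)[of x] by linarith
  then show ?thesis using False by (simp add: not_integrable_integral_eq)
qed

text \<open>The tensor product of |F| and B times the indicator of X dominates. It serves the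
  integrands over a space-time point and a second spatial point that arise from averaging.\<close>

lemma integrable_kernel:
  fixes F :: "'b::euclidean_space \<Rightarrow> real" and q :: "'b \<times> 'a::euclidean_space \<Rightarrow> real"
  assumes F: "integrable lborel F" and q: "continuous_on UNIV q" and X: "X \<in> sets borel" "bounded X"
    and B: "\<And>v. \<bar>q v\<bar> \<le> B * indicator X (snd v)"
  shows "integrable lborel (\<lambda>v. F (fst v) * q v)"
proof (rule Bochner_Integration.integrable_bound)
  have "integrable lborel (indicator X :: 'a \<Rightarrow> real)"
    using X emeasure_bounded_finite[of X] by (intro integrable_real_indicator) auto
  then show "integrable lborel (\<lambda>v::'b \<times> 'a. \<bar>F (fst v)\<bar> * (B * indicator X (snd v)))"
    using F by (intro lborel_integrable_tensor) auto
  have "(fst :: 'b \<times> 'a \<Rightarrow> 'b) \<in> borel \<rightarrow>\<^sub>M borel" by (intro borel_measurable_continuous_onI continuous_intros)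
  from measurable_compose[OF this, of F] F borel_measurable_continuous_onI[OF q]
  show "(\<lambda>v. F (fst v) * q v) \<in> borel_measurable lborel" by (auto intro!: borel_measurable_times)
  show "AE v in lborel. norm (F (fst v) * q v) \<le> norm (\<bar>F (fst v)\<bar> * (B * indicator X (snd v)))"
  proof (rule AE_I2)
    fix v
    have "\<bar>q v\<bar> \<le> \<bar>B * indicator X (snd v)\<bar>" using B[of v] by linarith
    then show "norm (F (fst v) * q v) \<le> norm (\<bar>F (fst v)\<bar> * (B * indicator X (snd v)))"
      unfolding real_norm_def abs_mult abs_idempotent[of "F _"] by (intro mult_left_mono) (auto simp: abs_mult)
  qed
qed

text \<open>The difference $f(t,x) - f(t,y)$, averaged against $\varphi(t,x) w(y)$, is split at the midpoint
  $(x+y)/2$; each half is a dilation about one of the two points.\<close>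

lemma weighted_poincare:
  fixes f :: "real \<times> 'a::euclidean_space \<Rightarrow> real" and H :: "real \<times> 'a \<Rightarrow> 'a"
  assumes T: "T \<in> sets borel" "bounded T" and X: "X \<in> sets borel" "bounded X" "convex X"
    and nul: "T \<times> X - interior (T \<times> X) \<in> null_sets lborel"
    and w: "test_fun (interior X) w" "\<And>x. 0 \<le> w x" "\<And>x. w x \<le> W" "(LBINT x. w x) = 1"
    and f: "L2on (T \<times> X) f" and H: "L2on (T \<times> X) H" and fH: "xgrad (T \<times> X) f H"
  shows "L2on (T \<times> X) (\<lambda>z. f z - pair X f (fst z) w)" (is ?L2)
    "L2norm (T \<times> X) (\<lambda>z. f z - pair X f (fst z) w)
      \<le> 2 ^ DIM('a) * diameter X * (1 + W * measure lborel X) * L2norm (T \<times> X) H" (is ?le)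
proof -
  define K where "K = T \<times> X"
  \<comment> \<open>2^n is the Jacobian of the dilation by 2 and also bounds u^(n-1) for 1 \<le> u
    \<le> 2.\<close>
  define n2 :: real where "n2 = 2 ^ DIM('a)"
  define d where "d = diameter X"
  define L where "L = L2norm K H"
  have d0: "d \<ge> 0" unfolding d_def using X(2) by (rule diameter_ge_0)
  have n20: "n2 > 0" by (simp add: n2_def)
  have W0: "W \<ge> 0" using w(2,3)[of undefined] by linarith
  have Km: "K \<in> sets borel" unfolding K_def using T X by (simp add: borel_Times)
  have bK: "bounded K" unfolding K_def using T X by (simp add: bounded_Times)
  have intK: "interior (T \<times> X) = interior T \<times> interior X" by (rule interior_Times)
  have indX: "integrable lborel (indicator X :: 'a \<Rightarrow> real)" "(LBINT x. indicator X x) = measure lborel X"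
    using X emeasure_bounded_finite[of X] by (auto intro!: integrable_real_indicator)
  have indK: "integrable lborel (indicator K :: _ \<Rightarrow> real)"
    using Km emeasure_bounded_finite[OF bK] by (intro integrable_real_indicator) auto
  have L0: "L \<ge> 0" by (simp add: L_def L2norm_nonneg)
  define f0 where "f0 z = indicator K z * f z" for z
  have f0: "integrable lborel f0" "\<And>z. z \<notin> K \<Longrightarrow> f0 z = 0"
    using L2on_integrable[OF f] Km bK by (auto simp: f0_def[abs_def] K_def)
  define H0 where "H0 z = indicator K z *\<^sub>R H z" for z
  define nH where "nH z = norm (H0 z)" for z
  have H0m: "H0 \<in> borel_measurable lborel"
    using H unfolding L2on_def set_borel_measurable_def H0_def K_def by auto
  have H0z: "H0 z = 0" if "z \<notin> K" for z using that by (simp add: H0_def)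
  have nHz: "nH z = 0" if "z \<notin> K" for z using that by (simp add: nH_def H0_def)
  have nHm: "nH \<in> borel_measurable lborel" unfolding nH_def[abs_def] using H0m by simp
  have eqH: "indicator K z *\<^sub>R (norm (H z))\<^sup>2 = (nH z)\<^sup>2" for z
    by (auto simp: nH_def H0_def indicator_def)
  have nH2: "integrable lborel (\<lambda>z. (nH z)\<^sup>2)" "L = sqrt (LBINT z. (nH z)\<^sup>2)"
    using H unfolding L2on_def set_integrable_def L_def L2norm_def set_lebesgue_integral_def K_def[symmetric] eqH
    by auto
  have nHi: "integrable lborel nH"
  proof -
    have e: "indicator K z * nH z = nH z" for z using nHz[of z] by (auto simp: indicator_def)
    have "L2on K nH" by (rule L2onI) (unfold e, use nHm nH2 in auto)
    from L2on_integrable[OF this Km bK] show ?thesis unfolding e .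
  qed
  have Hi: "integrable lborel (\<lambda>z. H0 z \<bullet> i)" if "i \<in> Basis" for i
    by (rule Bochner_Integration.integrable_bound[OF nHi])
      (use H0m that in \<open>auto simp: nH_def Basis_le_norm\<close>)
  have rel: "(LBINT z. f0 z * frechet_derivative \<phi> (at z) (0, i)) = - (LBINT z. (H0 z \<bullet> i) * \<phi> z)"
    if "test_fun (interior T \<times> interior X) \<phi>" "i \<in> Basis" for \<phi> i
  proof -
    have "(LINT z:K|lborel. f z * frechet_derivative \<phi> (at z) (0, i)) = - (LINT z:K|lborel. (H z \<bullet> i) * \<phi> z)"
      using fH that unfolding xgrad_def intK K_def by blast
    then show ?thesis unfolding set_lebesgue_integral_def f0_def H0_def by (simp add: mult.assoc)
  qed
  have Hd: "\<bar>H0 z \<bullet> (snd z - y)\<bar> \<le> nH z * d" if "y \<in> X" for z y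
  proof (cases "z \<in> K")
    case True
    have "dist (snd z) y \<le> d" unfolding d_def using True that X(2)
      by (intro diameter_bounded_bound) (auto simp: K_def)
    then have "norm (H0 z) * norm (snd z - y) \<le> nH z * d"
      unfolding nH_def by (intro mult_left_mono) (auto simp: dist_norm)
    then show ?thesis using Cauchy_Schwarz_ineq2[of "H0 z" "snd z - y"] by linarith
  qed (simp add: H0z nHz)
  have un: "u ^ (DIM('a) - 1) \<le> n2" "0 \<le> u ^ (DIM('a) - 1)" if "1 \<le> u" "u \<le> 2" for u :: real
  proof -
    have "u ^ (DIM('a) - 1) \<le> u ^ DIM('a)" using that by (intro power_increasing) auto
    also have "\<dots> \<le> n2" unfolding n2_def using that by (intro power_mono) auto
    finally show "u ^ (DIM('a) - 1) \<le> n2" .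
    show "0 \<le> u ^ (DIM('a) - 1)" using that by simp
  qed
  have w0: "w x = 0" if "x \<notin> X" for x using test_fun_eq_0[OF w(1)] that interior_subset by blast
  have wX: "w x \<le> W * indicator X x" for x using w(3) w0 by (cases "x \<in> X") auto
  have wi: "integrable lborel w" "integrable lborel (\<lambda>x. (w x)\<^sup>2)" using integrable_test_fun[OF w(1)] .
  have wc: "continuous_on UNIV w" using test_fun_continuous[OF w(1)] .
  \<comment> \<open>The factor 1 presents a function of time alone as a tensor product, so that
    \<open>L2on_tensor\<close> applies.\<close>
  have pL: "L2on K (\<lambda>z. pair X f (fst z) w * 1)"
    unfolding K_def
  proof (rule L2on_tensor)
    show "L2on T (\<lambda>t. pair X f t w)" using pair_L2(1)[OF f test_fun_borel[OF w(1)] wi(2)] .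
    show "L2on X (\<lambda>x. 1::real)" by (rule L2on_continuous(1)[OF X(1,2), of _ 1]) auto
  qed
  have L2: "L2on K (\<lambda>z. f z - pair X f (fst z) w)"
    using L2on_diff[OF f[folded K_def] pL] by simp
  then show ?L2 by (simp add: K_def)
  define M where "M = n2 * d * (1 + W * measure lborel X) * L"
  have "L2norm K (\<lambda>z. f z - pair X f (fst z) w) \<le> M"
  proof (rule L2_duality[OF Km bK nul[folded K_def] L2])
    show "M \<ge> 0" unfolding M_def using n20 d0 W0 L0 by simp
    fix \<phi> :: "real \<times> 'a \<Rightarrow> real" assume "test_fun (interior K) \<phi>"
    then have \<phi>: "test_fun (interior T \<times> interior X) \<phi>" by (simp add: K_def intK)
    have \<phi>0: "\<phi> z = 0" if "z \<notin> K" for z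
      by (rule test_fun_eq_0[OF \<phi>]) (use that interior_subset[of T] interior_subset[of X] in \<open>auto simp: K_def\<close>)
    have \<phi>i: "integrable lborel \<phi>" "integrable lborel (\<lambda>z. (\<phi> z)\<^sup>2)" using integrable_test_fun[OF \<phi>] .
    have \<phi>m: "\<phi> \<in> borel_measurable borel" using test_fun_borel[OF \<phi>] .
    have \<phi>c: "continuous_on S \<phi>" for S using test_fun_continuous[OF \<phi>] .
    have C1\<phi>: "C1 \<phi>" using test_fun_C1[OF \<phi>] .
    obtain B where B: "B > 0" "\<And>z. \<bar>\<phi> z\<bar> \<le> B" using test_fun_bounded[OF \<phi>] by metis
    define N where "N = sqrt (LBINT z. (\<phi> z)\<^sup>2)"
    have N0: "N \<ge> 0" by (simp add: N_def)
    have NL: "L2norm K \<phi> = N"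
      unfolding L2norm_eq N_def using \<phi>0
      by (intro arg_cong[of _ _ sqrt] Bochner_Integration.integral_cong) (auto simp: indicator_def)
    define I where "I = (LBINT z. f0 z * \<phi> z)"
    \<comment> \<open>Dilation about y. With x' = 2 x - y the second integral is that of f(t, (x' +
      y)/2) \<phi>(t, x'), so values of f at x' are compared with values at the midpoint of x' and
      y.\<close>
    have bound1: "\<bar>I - (LBINT z. f0 z * (n2 * \<phi> (fst z, 2 *\<^sub>R snd z - y)))\<bar> \<le> n2 * d * L * N" if y: "y \<in> X" for y
      unfolding I_def n2_def
    proof (rule dilation_bound[OF X(3) y bK[unfolded K_def] f0(1) _ Hi _ rel \<phi>])
      fix u :: real assume u: "1 \<le> u" "u \<le> 2"
      define q where "q z = \<phi> (fst z, y + u *\<^sub>R (snd z - y))" for z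
      have qe: "q z = \<phi> (fst z, (y - u *\<^sub>R y) + u *\<^sub>R snd z)" for z by (simp add: q_def algebra_simps)
      have q2: "integrable lborel (\<lambda>z. (q z)\<^sup>2)" "(LBINT z. (q z)\<^sup>2) \<le> (LBINT z. (\<phi> z)\<^sup>2)"
        unfolding qe using lborel_dilate_snd_le[OF \<phi>i(2) _ u(1)] by auto
      have qm: "q \<in> borel_measurable borel" unfolding q_def[abs_def]
        by (intro borel_measurable_continuous_onI continuous_on_compose2[OF \<phi>c[of UNIV]] continuous_intros) auto
      have aq: "(\<lambda>z. \<bar>q z\<bar>) \<in> borel_measurable lborel" "integrable lborel (\<lambda>z. \<bar>q z\<bar>\<^sup>2)" using qm q2 by auto
      note CS = Cauchy_Schwarz_integral[OF nHm aq(1) nH2(1) aq(2)]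
      have "\<bar>LBINT z. (H0 z \<bullet> (snd z - y)) * (u ^ (DIM('a) - 1) * q z)\<bar> \<le> (LBINT z. n2 * d * (nH z * \<bar>q z\<bar>))"
      proof (rule abs_integral_le)
        show "integrable lborel (\<lambda>z. n2 * d * (nH z * \<bar>q z\<bar>))" using CS(1) by simp
        fix z
        have "\<bar>u ^ (DIM('a) - 1) * q z\<bar> \<le> n2 * \<bar>q z\<bar>" using un[OF u] by (simp add: abs_mult mult_right_mono)
        then have "\<bar>(H0 z \<bullet> (snd z - y)) * (u ^ (DIM('a) - 1) * q z)\<bar> \<le> (nH z * d) * (n2 * \<bar>q z\<bar>)"
          unfolding abs_mult[of "H0 z \<bullet> _"] using Hd[OF y, of z] by (intro mult_mono) (auto simp: nH_def d0)
        then show "\<bar>(H0 z \<bullet> (snd z - y)) * (u ^ (DIM('a) - 1) * q z)\<bar> \<le> n2 * d * (nH z * \<bar>q z\<bar>)" by (simp add: mult_ac)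
      qed
      also have "\<dots> = n2 * d * (LBINT z. nH z * \<bar>q z\<bar>)" by simp
      also have "\<dots> \<le> n2 * d * (L * N)"
      proof (rule mult_left_mono)
        have "(LBINT z. nH z * \<bar>q z\<bar>) \<le> L * sqrt (LBINT z. (q z)\<^sup>2)" using CS(2) nH2(2) by simp
        also have "\<dots> \<le> L * N" unfolding N_def using q2(2) L0 by (intro mult_left_mono) auto
        finally show "(LBINT z. nH z * \<bar>q z\<bar>) \<le> L * N" .
      qed (use n20 d0 in simp)
      finally show "\<bar>LBINT z. (H0 z \<bullet> (snd z - y)) * (u ^ (DIM('a) - 1) * \<phi> (fst z, y + u *\<^sub>R (snd z - y)))\<bar>
          \<le> 2 ^ DIM('a) * d * L * N" by (simp add: q_def n2_def mult.assoc)
    qed (use f0 H0z in \<open>auto simp: K_def\<close>)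
    define B2 where "B2 x = n2 * d * W * (LBINT z. nH z * \<bar>\<phi> (fst z, x)\<bar>)" for x
    have c\<phi>x: "continuous_on UNIV (\<lambda>z::real \<times> 'a. \<bar>\<phi> (fst z, x)\<bar>)" for x
      by (intro continuous_intros continuous_on_compose2[OF \<phi>c[of UNIV]]) auto
    \<comment> \<open>Dilation about x, applied to the test function w(z) \<phi>(t, x) with x
      frozen: values of f at y are compared with values at the midpoint. For a single x the L2 norm
      of \<phi> on K does not control \<phi>(., x), so the bound is kept as a function of x and
      integrated later.\<close>
    have bound2: "\<bar>(LBINT z. f0 z * (w (snd z) * \<phi> (fst z, x)))
        - (LBINT z. f0 z * (n2 * (w (2 *\<^sub>R snd z - x) * \<phi> (fst z, x))))\<bar> \<le> B2 x" if x: "x \<in> X" for x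
    proof -
      define \<psi> where "\<psi> z = w (snd z) * \<phi> (fst z, x)" for z :: "real \<times> 'a"
      have "linear (\<lambda>z::real \<times> 'a. (fst z, 0 :: 'a))" by (auto intro!: linearI)
      from C1_affine[OF C1\<phi> this, of "(0, x)"] have c1: "C1 (\<lambda>z::real \<times> 'a. \<phi> (fst z, x))" by simp
      have "linear (snd :: real \<times> 'a \<Rightarrow> 'a)" by (auto intro!: linearI)
      from C1_affine[OF test_fun_C1[OF w(1)] this, of 0] have c2: "C1 (\<lambda>z::real \<times> 'a. w (snd z))" by simp
      obtain C where C: "C1 \<phi>" "compact C" "C \<subseteq> interior T \<times> interior X" "\<forall>z. z \<notin> C \<longrightarrow> \<phi> z = 0"
        by (rule test_funE[OF \<phi>])
      obtain D where D: "C1 w" "compact D" "D \<subseteq> interior X" "\<forall>z. z \<notin> D \<longrightarrow> w z = 0"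
        by (rule test_funE[OF w(1)])
      have t\<psi>: "test_fun (interior T \<times> interior X) \<psi>"
      proof (rule test_funI)
        show "C1 \<psi>" unfolding \<psi>_def[abs_def] by (rule C1_mult[OF c2 c1])
        show "compact (fst ` C \<times> D)" using C(2) D(2) by (intro compact_Times compact_continuous_image continuous_intros)
        show "fst ` C \<times> D \<subseteq> interior T \<times> interior X" using C(3) D(3) by auto
        show "\<psi> z = 0" if "z \<notin> fst ` C \<times> D" for z
        proof -
          have "snd z \<notin> D \<or> (fst z, x) \<notin> C" using that by (cases z) (auto simp: image_iff)
          then show ?thesis using C(4) D(4) by (auto simp: \<psi>_def)
        qed
      qed
      have "\<bar>(LBINT z. f0 z * \<psi> z) - (LBINT z. f0 z * (2 ^ DIM('a) * \<psi> (fst z, 2 *\<^sub>R snd z - x)))\<bar> \<le> B2 x"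
      proof (rule dilation_bound[OF X(3) x bK[unfolded K_def] f0(1) _ Hi _ rel t\<psi>])
        fix u :: real assume u: "1 \<le> u" "u \<le> 2"
        define q where "q z = w (x + u *\<^sub>R (snd z - x))" for z :: "real \<times> 'a"
        have i: "integrable lborel (\<lambda>z. nH z * \<bar>\<phi> (fst z, x)\<bar>)"
          by (rule integrable_mult_continuous[OF nHi bK nHz c\<phi>x])
        have "\<bar>LBINT z. (H0 z \<bullet> (snd z - x)) * (u ^ (DIM('a) - 1) * (q z * \<phi> (fst z, x)))\<bar>
            \<le> (LBINT z. n2 * d * W * (nH z * \<bar>\<phi> (fst z, x)\<bar>))"
        proof (rule abs_integral_le)
          show "integrable lborel (\<lambda>z. n2 * d * W * (nH z * \<bar>\<phi> (fst z, x)\<bar>))" using i by simp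
          fix z
          have "\<bar>q z\<bar> \<le> W" using w(2,3) by (simp add: q_def)
          then have "\<bar>q z * \<phi> (fst z, x)\<bar> \<le> W * \<bar>\<phi> (fst z, x)\<bar>" by (simp add: abs_mult mult_right_mono)
          then have "\<bar>u ^ (DIM('a) - 1) * (q z * \<phi> (fst z, x))\<bar> \<le> n2 * (W * \<bar>\<phi> (fst z, x)\<bar>)"
            unfolding abs_mult[of "u ^ _"] using un[OF u] n20 by (intro mult_mono) auto
          then have "\<bar>(H0 z \<bullet> (snd z - x)) * (u ^ (DIM('a) - 1) * (q z * \<phi> (fst z, x)))\<bar>
              \<le> (nH z * d) * (n2 * (W * \<bar>\<phi> (fst z, x)\<bar>))"
            unfolding abs_mult[of "H0 z \<bullet> _"] using Hd[OF x, of z] by (intro mult_mono) (auto simp: nH_def d0)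
          then show "\<bar>(H0 z \<bullet> (snd z - x)) * (u ^ (DIM('a) - 1) * (q z * \<phi> (fst z, x)))\<bar>
              \<le> n2 * d * W * (nH z * \<bar>\<phi> (fst z, x)\<bar>)" by (simp add: mult_ac)
        qed
        also have "\<dots> = B2 x" unfolding B2_def by simp
        finally show "\<bar>LBINT z. (H0 z \<bullet> (snd z - x)) * (u ^ (DIM('a) - 1) * \<psi> (fst z, x + u *\<^sub>R (snd z - x)))\<bar> \<le> B2 x"
          by (simp add: q_def \<psi>_def)
      qed (use f0 H0z in \<open>auto simp: K_def\<close>)
      then show ?thesis by (simp add: \<psi>_def n2_def)
    qed
    have \<phi>X: "\<bar>\<phi> (t, x)\<bar> \<le> B * indicator X x" for t x
      using B(2)[of "(t, x)"] \<phi>0[of "(t, x)"] by (cases "x \<in> X") (auto simp: K_def)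
    \<comment> \<open>In J1 and J2 the first component of v carries the midpoint and the second one
      of the two outer points, y in J1 and x in J2. In J3 the first component carries y, weighted by
      w. J4 is the integrand in the bound \<open>B2\<close>.\<close>
    define J1 where "J1 v = f0 (fst v) * (n2 * \<phi> (fst (fst v), 2 *\<^sub>R snd (fst v) - snd v) * w (snd v))" for v
    define J2 where "J2 v = f0 (fst v) * (n2 * (w (2 *\<^sub>R snd (fst v) - snd v) * \<phi> (fst (fst v), snd v)))" for v
    define J3 where "J3 v = f0 (fst v) * (w (snd (fst v)) * \<phi> (fst (fst v), snd v))" for v
    define J4 where "J4 v = nH (fst v) * \<bar>\<phi> (fst (fst v), snd v)\<bar>" for v
    have J1i: "integrable lborel J1" unfolding J1_def
    proof (rule integrable_kernel[OF f0(1) _ X(1,2), where B="n2 * B * W"])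
      show "continuous_on UNIV (\<lambda>v::(real \<times> 'a) \<times> 'a. n2 * \<phi> (fst (fst v), 2 *\<^sub>R snd (fst v) - snd v) * w (snd v))"
        by (intro continuous_intros continuous_on_compose2[OF \<phi>c[of UNIV]] continuous_on_compose2[OF wc]) auto
      fix v :: "(real \<times> 'a) \<times> 'a"
      have "\<bar>n2 * \<phi> (fst (fst v), 2 *\<^sub>R snd (fst v) - snd v) * w (snd v)\<bar> \<le> (n2 * B) * (W * indicator X (snd v))"
        unfolding abs_mult using n20 B w(2) wX by (intro mult_mono) auto
      then show "\<bar>n2 * \<phi> (fst (fst v), 2 *\<^sub>R snd (fst v) - snd v) * w (snd v)\<bar> \<le> n2 * B * W * indicator X (snd v)"
        by (simp add: mult_ac)
    qed
    have J2i: "integrable lborel J2" unfolding J2_def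
    proof (rule integrable_kernel[OF f0(1) _ X(1,2), where B="n2 * W * B"])
      show "continuous_on UNIV (\<lambda>v::(real \<times> 'a) \<times> 'a. n2 * (w (2 *\<^sub>R snd (fst v) - snd v) * \<phi> (fst (fst v), snd v)))"
        by (intro continuous_intros continuous_on_compose2[OF \<phi>c[of UNIV]] continuous_on_compose2[OF wc]) auto
      fix v :: "(real \<times> 'a) \<times> 'a"
      have "\<bar>n2 * (w (2 *\<^sub>R snd (fst v) - snd v) * \<phi> (fst (fst v), snd v))\<bar> \<le> n2 * (W * (B * indicator X (snd v)))"
        unfolding abs_mult using n20 \<phi>X w(2,3) W0 by (intro mult_mono) auto
      then show "\<bar>n2 * (w (2 *\<^sub>R snd (fst v) - snd v) * \<phi> (fst (fst v), snd v))\<bar> \<le> n2 * W * B * indicator X (snd v)"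
        by (simp add: mult_ac)
    qed
    have J3i: "integrable lborel J3" unfolding J3_def
    proof (rule integrable_kernel[OF f0(1) _ X(1,2), where B="W * B"])
      show "continuous_on UNIV (\<lambda>v::(real \<times> 'a) \<times> 'a. w (snd (fst v)) * \<phi> (fst (fst v), snd v))"
        by (intro continuous_intros continuous_on_compose2[OF \<phi>c[of UNIV]] continuous_on_compose2[OF wc]) auto
      fix v :: "(real \<times> 'a) \<times> 'a"
      have "\<bar>w (snd (fst v)) * \<phi> (fst (fst v), snd v)\<bar> \<le> W * (B * indicator X (snd v))"
        unfolding abs_mult using \<phi>X w(2,3) W0 by (intro mult_mono) auto
      then show "\<bar>w (snd (fst v)) * \<phi> (fst (fst v), snd v)\<bar> \<le> W * B * indicator X (snd v)"
        by (simp add: mult_ac)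
    qed
    have c4: "continuous_on UNIV (\<lambda>v::(real \<times> 'a) \<times> 'a. \<bar>\<phi> (fst (fst v), snd v)\<bar>)"
      "continuous_on UNIV (\<lambda>v::(real \<times> 'a) \<times> 'a. (\<phi> (fst (fst v), snd v))\<^sup>2)"
      by (intro continuous_intros continuous_on_compose2[OF \<phi>c[of UNIV]]; auto)+
    have J4i: "integrable lborel J4" unfolding J4_def
      by (rule integrable_kernel[OF nHi c4(1) X(1,2), where B=B]) (use \<phi>X in auto)

    define A where "A = (LBINT y. w y * (I - (LBINT z. f0 z * (n2 * \<phi> (fst z, 2 *\<^sub>R snd z - y)))))"
    have Ab: "\<bar>A\<bar> \<le> n2 * d * L * N"
    proof -
      have "\<bar>A\<bar> \<le> (LBINT y. w y * (n2 * d * L * N))" unfolding A_def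
      proof (rule abs_integral_le)
        show "integrable lborel (\<lambda>y. w y * (n2 * d * L * N))" using wi by simp
        fix y show "\<bar>w y * (I - (LBINT z. f0 z * (n2 * \<phi> (fst z, 2 *\<^sub>R snd z - y))))\<bar> \<le> w y * (n2 * d * L * N)"
          using bound1[of y] w(2)[of y] w0[of y] by (cases "y \<in> X") (auto simp: abs_mult intro!: mult_left_mono)
      qed
      then show ?thesis using w(4) by simp
    qed
    have A_eq: "A = I - (LBINT v. J1 v)"
    proof -
      have "w y * (I - (LBINT z. f0 z * (n2 * \<phi> (fst z, 2 *\<^sub>R snd z - y)))) = w y * I - (LBINT z. J1 (z, y))" for y
      proof -
        have "(LBINT z. J1 (z, y)) = (LBINT z. w y * (f0 z * (n2 * \<phi> (fst z, 2 *\<^sub>R snd z - y))))"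
          by (intro Bochner_Integration.integral_cong) (auto simp: J1_def)
        then show ?thesis by (simp add: right_diff_distrib)
      qed
      then have "A = (LBINT y. w y * I - (LBINT z. J1 (z, y)))" unfolding A_def by simp
      also have "\<dots> = I - (LBINT v. J1 v)"
        using wi lborel_Fubini(4,5)[OF J1i] w(4) by simp
      finally show ?thesis .
    qed
    \<comment> \<open>For fixed midpoint z the reflection y \<mapsto> 2 z - y has Jacobian 1 and
      exchanges the two outer points.\<close>
    have J12: "(LBINT v. J1 v) = (LBINT v. J2 v)"
    proof -
      have "(LBINT y. J1 (z, y)) = (LBINT x. J2 (z, x))" for z
      proof -
        define g where "g y = \<phi> (fst z, 2 *\<^sub>R snd z - y) * w y" for y
        have "linear (\<lambda>y::'a. (0::real, - y))" by (auto intro!: linearI)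
        from C1_affine[OF C1\<phi> this, of "(fst z, 2 *\<^sub>R snd z)"]
        have "C1 (\<lambda>y. \<phi> (fst z, 2 *\<^sub>R snd z - y))" by simp
        from integrable_test_fun(1)[OF test_fun_mult_left[OF this w(1)]]
        have gi: "integrable lborel g" by (simp add: g_def[abs_def])
        have "(LBINT y. g y) = (LBINT x. g (2 *\<^sub>R snd z + (-1) *\<^sub>R x))"
          using lborel_affine_integral(2)[OF gi, of "-1" "2 *\<^sub>R snd z"] by simp
        also have "\<dots> = (LBINT x. w (2 *\<^sub>R snd z - x) * \<phi> (fst z, x))"
          by (intro Bochner_Integration.integral_cong) (auto simp: g_def mult.commute)
        finally have e: "(LBINT y. g y) = (LBINT x. w (2 *\<^sub>R snd z - x) * \<phi> (fst z, x))" .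
        have "(LBINT y. J1 (z, y)) = (LBINT y. (f0 z * n2) * g y)"
          by (intro Bochner_Integration.integral_cong) (auto simp: J1_def g_def)
        also have "\<dots> = (f0 z * n2) * (LBINT x. w (2 *\<^sub>R snd z - x) * \<phi> (fst z, x))" using e by simp
        also have "\<dots> = (LBINT x. (f0 z * n2) * (w (2 *\<^sub>R snd z - x) * \<phi> (fst z, x)))" by simp
        also have "\<dots> = (LBINT x. J2 (z, x))"
          by (intro Bochner_Integration.integral_cong) (auto simp: J2_def)
        finally show ?thesis .
      qed
      then show ?thesis using lborel_Fubini(2)[OF J1i] lborel_Fubini(2)[OF J2i] by simp
    qed
    define D where "D = (LBINT x. (LBINT z. J3 (z, x)) - (LBINT z. J2 (z, x)))"
    have D_eq: "D = (LBINT v. J3 v) - (LBINT v. J2 v)"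
      unfolding D_def using lborel_Fubini(4,5)[OF J3i] lborel_Fubini(4,5)[OF J2i] by simp
    have J4x: "(LBINT z. nH z * \<bar>\<phi> (fst z, x)\<bar>) = (LBINT z. J4 (z, x))" for x
      by (simp add: J4_def)
    have "\<bar>D\<bar> \<le> (LBINT x. B2 x)" unfolding D_def
    proof (rule abs_integral_le)
      show "integrable lborel B2" unfolding B2_def[abs_def] J4x using lborel_Fubini(4)[OF J4i] by simp
      fix x show "\<bar>(LBINT z. J3 (z, x)) - (LBINT z. J2 (z, x))\<bar> \<le> B2 x"
      proof (cases "x \<in> X")
        case True then show ?thesis using bound2[OF True] by (simp add: J2_def J3_def)
      next
        case False
        then have "\<phi> (t, x) = 0" for t using \<phi>0[of "(t, x)"] by (simp add: K_def)
        then show ?thesis by (simp add: J2_def J3_def B2_def)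
      qed
    qed
    also have "(LBINT x. B2 x) = n2 * d * W * (LBINT v. J4 v)"
      unfolding B2_def J4x using lborel_Fubini(4,5)[OF J4i] by simp
    also have "\<dots> \<le> n2 * d * W * (L * N * measure lborel X)"
    proof (rule mult_left_mono)
      \<comment> \<open>J4 = a b for Cauchy-Schwarz in all variables. The indicators make each
        factor square integrable: a contributes L times the square root of the volume of X, b
        contributes N times the same root. Hence the term W times the volume of X in the
        constant.\<close>
      define a where "a v = nH (fst v) * indicator X (snd v)" for v :: "(real \<times> 'a) \<times> 'a"
      define b where "b v = indicator K (fst v) * \<bar>\<phi> (fst (fst v), snd v)\<bar>" for v :: "(real \<times> 'a) \<times> 'a"
      have ia: "integrable lborel (indicator X :: 'a \<Rightarrow> real)" by (rule indX)
      have a2: "(a v)\<^sup>2 = (nH (fst v))\<^sup>2 * indicator X (snd v)" for v by (auto simp: a_def indicator_def)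
      have b2: "(b v)\<^sup>2 = indicator K (fst v) * (\<phi> (fst (fst v), snd v))\<^sup>2" for v by (auto simp: b_def indicator_def)
      have am: "a \<in> borel_measurable lborel"
        using lborel_integrable_tensor(1)[OF nHi indX(1)] by (auto simp: a_def[abs_def])
      have bm: "b \<in> borel_measurable lborel" unfolding b_def[abs_def]
        using integrable_kernel[OF indK c4(1) X(1,2), of B] \<phi>X by auto
      have ai: "integrable lborel (\<lambda>v. (a v)\<^sup>2)" "(LBINT v. (a v)\<^sup>2) = L\<^sup>2 * measure lborel X"
        unfolding a2 using lborel_integrable_tensor[OF nH2(1) indX(1)] indX(2) nH2(2) by auto
      have B2': "\<bar>(\<phi> (t, x))\<^sup>2\<bar> \<le> B\<^sup>2 * indicator X x" for t x
        using power_mono[OF \<phi>X[of t x], of 2] by (cases "x \<in> X") auto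
      have bi: "integrable lborel (\<lambda>v. (b v)\<^sup>2)" unfolding b2
        by (rule integrable_kernel[OF indK c4(2) X(1,2), of "B\<^sup>2"]) (use B2' in auto)
      define m where "m t = (LBINT x. (\<phi> (t, x))\<^sup>2)" for t
      have mT: "m t = 0" if "t \<notin> T" for t unfolding m_def using \<phi>0 that by (simp add: K_def)
      have mi: "integrable lborel m" "(LBINT t. m t) = N\<^sup>2"
        using lborel_Fubini(1,2)[OF \<phi>i(2)] by (auto simp: m_def[abs_def] N_def)
      have "(LBINT v. (b v)\<^sup>2) = (LBINT z. LBINT x. (b (z, x))\<^sup>2)"
        using lborel_Fubini(2)[OF bi] by simp
      also have "\<dots> = (LBINT z. m (fst z) * indicator X (snd z))"
      proof (intro Bochner_Integration.integral_cong refl)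
        fix z :: "real \<times> 'a"
        have "(LBINT x. (b (z, x))\<^sup>2) = indicator K z * m (fst z)" unfolding b2 m_def by simp
        also have "\<dots> = m (fst z) * indicator X (snd z)" using mT by (cases z) (auto simp: K_def indicator_def)
        finally show "(LBINT x. (b (z, x))\<^sup>2) = m (fst z) * indicator X (snd z)" .
      qed
      also have "\<dots> = N\<^sup>2 * measure lborel X" using lborel_integrable_tensor(2)[OF mi(1) indX(1)] mi(2) indX(2) by simp
      finally have bI: "(LBINT v. (b v)\<^sup>2) = N\<^sup>2 * measure lborel X" .
      have "J4 v = a v * b v" for v
      proof -
        have "\<phi> (fst (fst v), snd v) = 0 \<or> snd v \<in> X" using \<phi>0[of "(fst (fst v), snd v)"] by (auto simp: K_def)
        then show ?thesis using nHz[of "fst v"] by (auto simp: J4_def a_def b_def indicator_def)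
      qed
      then have "(LBINT v. J4 v) \<le> sqrt (L\<^sup>2 * measure lborel X) * sqrt (N\<^sup>2 * measure lborel X)"
        using Cauchy_Schwarz_integral(2)[OF am bm ai(1) bi] unfolding ai(2) bI by simp
      also have "\<dots> = L * N * measure lborel X" using L0 N0 by (simp add: real_sqrt_mult)
      finally show "(LBINT v. J4 v) \<le> L * N * measure lborel X" .
    qed (use n20 d0 W0 in simp)
    finally have Db: "\<bar>D\<bar> \<le> n2 * d * W * (L * N * measure lborel X)" .

    have \<phi>K: "indicator K z * \<phi> z = \<phi> z" for z using \<phi>0[of z] by (auto simp: indicator_def)
    \<comment> \<open>At fixed t the variables in J3 separate: its integral over y and x is the
      weighted mean P t times the integral of \<phi>(t, .).\<close>
    define P where "P t = (LBINT x. f0 (t, x) * w x)" for t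
    define g where "g z = (indicator K z * (pair X f (fst z) w * 1)) * \<phi> z" for z
    have gi: "integrable lborel g" unfolding g_def
      by (rule Cauchy_Schwarz_integral(1)[OF L2on_ext(1)[OF pL] _ L2on_ext(2)[OF pL] \<phi>i(2)]) (use \<phi>m in simp)
    have gP: "g z = P (fst z) * \<phi> z" for z
    proof (cases "z \<in> K")
      case True
      then have "pair X f (fst z) w = P (fst z)"
        using pair_eq[of "fst z" T X f w] by (auto simp: P_def f0_def K_def)
      then show ?thesis using True by (simp add: g_def)
    qed (simp add: g_def \<phi>0)
    have "(LBINT v. J3 v) = (LBINT z. LBINT x. J3 (z, x))" using lborel_Fubini(2)[OF J3i] by simp
    also have "\<dots> = (LBINT t. LBINT y. LBINT x. J3 ((t, y), x))"
      using lborel_Fubini(2)[OF lborel_Fubini(1)[OF J3i]] by simp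
    also have "\<dots> = (LBINT t. P t * (LBINT x. \<phi> (t, x)))"
    proof (intro Bochner_Integration.integral_cong refl)
      fix t :: real
      have "(LBINT x. J3 ((t, y), x)) = (f0 (t, y) * w y) * (LBINT x. \<phi> (t, x))" for y
      proof -
        have "(LBINT x. J3 ((t, y), x)) = (LBINT x. (f0 (t, y) * w y) * \<phi> (t, x))"
          by (intro Bochner_Integration.integral_cong) (auto simp: J3_def)
        then show ?thesis by simp
      qed
      then show "(LBINT y. LBINT x. J3 ((t, y), x)) = P t * (LBINT x. \<phi> (t, x))"
        unfolding P_def by simp
    qed
    also have "\<dots> = (LBINT t. LBINT x. g (t, x))" unfolding gP by simp
    also have "\<dots> = (LBINT z. g z)" using lborel_Fubini(2)[OF gi] by simp
    finally have J3g: "(LBINT v. J3 v) = (LBINT z. g z)" .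
    have f\<phi>: "integrable lborel (\<lambda>z. f0 z * \<phi> z)" by (rule integrable_mult_continuous[OF f0(1) bK f0(2) \<phi>c])
    have "(LINT z:K|lborel. (f z - pair X f (fst z) w) * \<phi> z) = (LBINT z. f0 z * \<phi> z - g z)"
      unfolding set_lebesgue_integral_def
      by (intro Bochner_Integration.integral_cong) (auto simp: f0_def g_def algebra_simps)
    also have "\<dots> = I - (LBINT v. J3 v)" unfolding J3g I_def using gi f\<phi> by simp
    also have "\<dots> = A - D" unfolding A_eq D_eq J12 by simp
    finally have "\<bar>LINT z:K|lborel. (f z - pair X f (fst z) w) * \<phi> z\<bar> \<le> \<bar>A\<bar> + \<bar>D\<bar>" by simp
    also have "\<dots> \<le> n2 * d * L * N + n2 * d * W * (L * N * measure lborel X)" using Ab Db by simp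
    also have "\<dots> = M * L2norm K \<phi>" by (simp add: M_def NL algebra_simps)
    finally show "\<bar>LINT z:K|lborel. (f z - pair X f (fst z) w) * \<phi> z\<bar> \<le> M * L2norm K \<phi>" .
  qed
  then show ?le by (simp add: M_def n2_def d_def L_def K_def)
qed

section \<open>Polynomials and a reproducing family\<close>


text \<open>Generated by operations instead of coefficients, so that affine substitution,
  differentiability and restriction to lines are short inductions. By \<open>polyd_iff\<close> these
  are the polynomials of total degree at most l, the spatial part of \<open>tpoly\<close> and
  \<open>L2Pl\<close>.\<close>

inductive polyd :: "nat \<Rightarrow> (real^'n::finite \<Rightarrow> real) \<Rightarrow> bool" where
  const: "polyd l (\<lambda>x. c)"
| add: "polyd l p \<Longrightarrow> polyd l q \<Longrightarrow> polyd l (\<lambda>x. p x + q x)"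
| coord: "polyd l p \<Longrightarrow> polyd (Suc l) (\<lambda>x. x $ i * p x)"

lemma polyd_Suc: "polyd l p \<Longrightarrow> polyd (Suc l) p"
  by (induction rule: polyd.induct) (auto intro: polyd.intros)

lemma polyd_cmult: "polyd l p \<Longrightarrow> polyd l (\<lambda>x. c * p x)"
proof (induction rule: polyd.induct)
  case (const l d) show ?case by (rule polyd.const)
next
  case (add l p q) from polyd.add[OF add.IH] show ?case by (simp add: distrib_left)
next
  case (coord l p i) from polyd.coord[OF coord.IH, of i] show ?case by (simp add: mult.left_commute)
qed

lemma polyd_sum: "(\<And>i. i \<in> I \<Longrightarrow> polyd l (p i)) \<Longrightarrow> polyd l (\<lambda>x. \<Sum>i\<in>I. p i x)"
  by (induction I rule: infinite_finite_induct) (auto intro: polyd.intros)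

lemma polyd_affine:
  assumes "polyd l p" shows "polyd l (\<lambda>x. p (r *\<^sub>R x + b))"
  using assms
proof (induction rule: polyd.induct)
  case (const l d) show ?case by (rule polyd.const)
next
  case (add l p q) from polyd.add[OF add.IH] show ?case by simp
next
  case (coord l p i)
  \<comment> \<open>The coordinate x_i turns into r x_i + b_i. The term with b_i keeps the lower
    degree and is lifted by \<open>polyd_Suc\<close>.\<close>
  from polyd.add[OF polyd_cmult[OF polyd.coord[OF coord.IH, of i], of r] polyd_cmult[OF polyd_Suc[OF coord.IH], of "b $ i"]]
  show ?case by (simp add: algebra_simps)
qed

lemma C1_polyd: "polyd l p \<Longrightarrow> C1 p"
proof (induction rule: polyd.induct)
  case (coord l p i)
  show ?case by (rule C1_mult[OF C1_linear[OF bounded_linear_vec_nth] coord.IH])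
qed (rule C1_const, rule C1_add)

lemma real_polynomial_function_polyd_line:
  assumes "polyd l p" shows "real_polynomial_function (\<lambda>s::real. p (s *\<^sub>R x))"
  using assms
proof (induction rule: polyd.induct)
  case (coord l p i)
  have "bounded_linear (\<lambda>s::real. (s *\<^sub>R x) $ i)" by (simp add: bounded_linear_mult_left)
  from real_polynomial_function.intros(4)[OF real_polynomial_function.intros(1)[OF this] coord.IH] show ?case .
qed (auto intro: real_polynomial_function.intros)

text \<open>Along the line through 0 and x the polynomial becomes univariate with infinitely many
  zeros near s = 0, so it also vanishes at s = 1.\<close>

lemma polyd_zero_ball:
  assumes "polyd l p" "\<rho> > 0" "\<And>x. x \<in> ball 0 \<rho> \<Longrightarrow> p x = 0"
  shows "p x = 0"
proof -
  obtain a n where an: "(\<lambda>s::real. p (s *\<^sub>R x)) = (\<lambda>s. \<Sum>i\<le>n. a i * s ^ i)"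
    using real_polynomial_function_polyd_line[OF assms(1), of x] unfolding real_polynomial_function_iff_sum by blast
  \<comment> \<open>For 0 < s < e the point s x lies in the ball of radius \<rho>. The summand 1
    covers x = 0.\<close>
  define e where "e = \<rho> / (1 + norm x)"
  have pos: "1 + norm x > 0" using norm_ge_zero[of x] by linarith
  have e: "e > 0" unfolding e_def using assms(2) pos by simp
  have "{0<..<e} \<subseteq> {s. (\<Sum>i\<le>n. a i * s ^ i) = 0}"
  proof
    fix s assume s: "s \<in> {0<..<e}"
    have "s * norm x \<le> s * (1 + norm x)" using s by (simp add: mult_left_mono)
    also have "\<dots> < \<rho>" using s pos by (simp add: e_def field_simps)
    finally have "s *\<^sub>R x \<in> ball 0 \<rho>" using s by simp
    then have "p (s *\<^sub>R x) = 0" by (rule assms(3))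
    then show "s \<in> {s. (\<Sum>i\<le>n. a i * s ^ i) = 0}" using fun_cong[OF an, of s] by simp
  qed
  moreover have "infinite {0<..<e}" using e by (simp add: infinite_Ioo)
  ultimately have "infinite {s. (\<Sum>i\<le>n. a i * s ^ i) = 0}" using finite_subset by blast
  then have "\<forall>i\<le>n. a i = 0" unfolding polyfun_finite_roots by blast
  then show ?thesis using fun_cong[OF an, of 1] by simp
qed

lemma finite_multi: "finite (multi l :: ('n::finite \<Rightarrow> nat) set)"
proof (rule finite_subset)
  show "multi l \<subseteq> (UNIV :: 'n set) \<rightarrow>\<^sub>E {..l}"
  proof
    fix \<alpha> :: "'n \<Rightarrow> nat" assume "\<alpha> \<in> multi l"
    then have "\<alpha> i \<le> l" for i
      using member_le_sum[of i UNIV \<alpha>] by (auto simp: multi_def)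
    then show "\<alpha> \<in> UNIV \<rightarrow>\<^sub>E {..l}" by auto
  qed
  show "finite ((UNIV :: 'n set) \<rightarrow>\<^sub>E {..l})" by (intro finite_PiE) auto
qed

lemma mono_Suc: "mono (\<beta>(i := Suc (\<beta> i))) x = x $ i * mono \<beta> x"
proof -
  have "mono (\<beta>(i := Suc (\<beta> i))) x = (x $ i) ^ Suc (\<beta> i) * (\<Prod>j\<in>UNIV - {i}. (x $ j) ^ (\<beta>(i := Suc (\<beta> i))) j)"
    unfolding mono_def by (subst prod.remove[of UNIV i]) auto
  also have "(\<Prod>j\<in>UNIV - {i}. (x $ j) ^ (\<beta>(i := Suc (\<beta> i))) j) = (\<Prod>j\<in>UNIV - {i}. (x $ j) ^ \<beta> j)"
    by (intro prod.cong) auto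
  also have "(x $ i) ^ Suc (\<beta> i) * (\<Prod>j\<in>UNIV - {i}. (x $ j) ^ \<beta> j) = x $ i * mono \<beta> x"
    using prod.remove[of UNIV i "\<lambda>j. (x $ j) ^ \<beta> j"] by (simp add: mono_def)
  finally show ?thesis .
qed

lemma sum_upd_Suc: "(\<Sum>j\<in>UNIV. (\<beta>(i := Suc (\<beta> i))) j) = Suc (\<Sum>j\<in>UNIV. \<beta> j)" for \<beta> :: "'n::finite \<Rightarrow> nat"
proof -
  have "(\<Sum>j\<in>UNIV. (\<beta>(i := Suc (\<beta> i))) j) = Suc (\<beta> i) + (\<Sum>j\<in>UNIV - {i}. (\<beta>(i := Suc (\<beta> i))) j)"
    by (subst sum.remove[of UNIV i]) auto
  also have "(\<Sum>j\<in>UNIV - {i}. (\<beta>(i := Suc (\<beta> i))) j) = (\<Sum>j\<in>UNIV - {i}. \<beta> j)"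
    by (intro sum.cong) auto
  also have "Suc (\<beta> i) + (\<Sum>j\<in>UNIV - {i}. \<beta> j) = Suc (\<Sum>j\<in>UNIV. \<beta> j)"
    using sum.remove[of UNIV i \<beta>] by simp
  finally show ?thesis .
qed

lemma polyd_mono: "\<alpha> \<in> multi l \<Longrightarrow> polyd l (mono \<alpha>)"
proof (induction l arbitrary: \<alpha>)
  case 0
  then have "mono \<alpha> = (\<lambda>x. 1)" by (auto simp: multi_def mono_def fun_eq_iff)
  then show ?case using polyd.const by metis
next
  case (Suc l)
  show ?case
  proof (cases "\<forall>i. \<alpha> i = 0")
    case True
    then have "mono \<alpha> = (\<lambda>x. 1)" by (auto simp: mono_def fun_eq_iff)
    then show ?thesis using polyd.const by metis
  next
    case False
    then obtain i where i: "\<alpha> i > 0" by auto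
    define \<beta> where "\<beta> = \<alpha>(i := \<alpha> i - 1)"
    have ab: "\<alpha> = \<beta>(i := Suc (\<beta> i))" using i by (auto simp: \<beta>_def fun_eq_iff)
    have "Suc (\<Sum>j\<in>UNIV. \<beta> j) \<le> Suc l" using Suc.prems ab sum_upd_Suc[of \<beta> i] by (simp add: multi_def)
    then have "polyd l (mono \<beta>)" using Suc.IH by (simp add: multi_def)
    from polyd.coord[OF this, of i] show ?thesis unfolding mono_Suc[symmetric] ab[symmetric] .
  qed
qed

text \<open>Multiplication by a coordinate raises one exponent by one and so maps monomials indexed
  by \<open>multi l\<close> to monomials indexed by \<open>multi (Suc l)\<close>. Collecting
  coefficients is avoided by showing that representability is closed under sums.\<close>

lemma polyd_iff:
  fixes p :: "real^'n::finite \<Rightarrow> real"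
  shows "polyd l p \<longleftrightarrow> (\<exists>c. p = (\<lambda>x. \<Sum>\<alpha>\<in>multi l. c \<alpha> * mono \<alpha> x))"
proof
  assume "\<exists>c. p = (\<lambda>x. \<Sum>\<alpha>\<in>multi l. c \<alpha> * mono \<alpha> x)"
  then show "polyd l p" by (auto intro!: polyd_sum polyd_cmult polyd_mono)
next
  let ?E = "\<lambda>l p. \<exists>c. p = (\<lambda>x. \<Sum>\<alpha>\<in>multi l. c \<alpha> * mono \<alpha> x)"
  have Eadd: "?E l (\<lambda>x. p x + q x)" if pq: "?E l p" "?E l q" for l and p q :: "real^'n \<Rightarrow> real"
  proof -
    obtain c d where cd: "p = (\<lambda>x. \<Sum>\<alpha>\<in>multi l. c \<alpha> * mono \<alpha> x)" "q = (\<lambda>x. \<Sum>\<alpha>\<in>multi l. d \<alpha> * mono \<alpha> x)"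
      using pq by blast
    show ?thesis by (rule exI[of _ "\<lambda>\<alpha>. c \<alpha> + d \<alpha>"]) (simp add: cd sum.distrib distrib_right)
  qed
  have single: "?E l (\<lambda>x. c * mono \<alpha> x)" if "\<alpha> \<in> multi l" for l c and \<alpha> :: "'n \<Rightarrow> nat"
  proof (rule exI[of _ "\<lambda>\<beta>. if \<beta> = \<alpha> then c else 0"], rule ext)
    fix x show "c * mono \<alpha> x = (\<Sum>\<beta>\<in>multi l. (if \<beta> = \<alpha> then c else 0) * mono \<beta> x)"
      using that sum.delta[OF finite_multi[of l], of \<alpha> "\<lambda>\<beta>. c * mono \<beta> x"]
      by (simp add: if_distrib[of "\<lambda>u. u * _"] cong: if_cong)
  qed
  have sum: "?E l (\<lambda>x. \<Sum>i\<in>I. f i x)" if "finite I" "\<And>i. i \<in> I \<Longrightarrow> ?E l (f i)" for l I and f :: "('n \<Rightarrow> nat) \<Rightarrow> real^'n \<Rightarrow> real"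
    using that
  proof (induction I)
    case empty
    have "?E l (\<lambda>x. 0)" by (rule exI[of _ "\<lambda>_. 0"]) simp
    then show ?case by simp
  next
    case (insert i I)
    have "?E l (\<lambda>x. f i x + (\<Sum>i\<in>I. f i x))" by (rule Eadd) (use insert in auto)
    then show ?case using insert by simp
  qed
  assume "polyd l p" then show "?E l p"
  proof (induction rule: polyd.induct)
    case (const l c)
    have "(\<lambda>_. 0) \<in> multi l" by (simp add: multi_def)
    from single[OF this, of c] show ?case by (simp add: mono_def)
  next
    case (add l p q) show ?case by (rule Eadd[OF add.IH])
  next
    case (coord l p i)
    then obtain c where c: "p = (\<lambda>x. \<Sum>\<alpha>\<in>multi l. c \<alpha> * mono \<alpha> x)" by blast
    have "?E (Suc l) (\<lambda>x. \<Sum>\<alpha>\<in>multi l. c \<alpha> * mono (\<alpha>(i := Suc (\<alpha> i))) x)"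
    proof (rule sum[OF finite_multi])
      fix \<alpha> :: "'n \<Rightarrow> nat" assume "\<alpha> \<in> multi l"
      then have "\<alpha>(i := Suc (\<alpha> i)) \<in> multi (Suc l)" unfolding multi_def mem_Collect_eq sum_upd_Suc by simp
      then show "?E (Suc l) (\<lambda>x. c \<alpha> * mono (\<alpha>(i := Suc (\<alpha> i))) x)" by (rule single)
    qed
    then show ?case unfolding c mono_Suc by (simp add: sum_distrib_left mult.left_commute)
  qed
qed

text \<open>A nonzero value would make h nonzero on a nonempty open set, and such a set is not
  negligible.\<close>

lemma continuous_integral_zero:
  fixes h :: "'a::euclidean_space \<Rightarrow> real"
  assumes "continuous_on UNIV h" "\<And>x. h x \<ge> 0" "integrable lborel h" "(LBINT x. h x) = 0"
  shows "h x = 0"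
proof (rule ccontr)
  assume "h x \<noteq> 0"
  have op: "open {x. h x \<noteq> 0}" using assms(1) by (intro open_Collect_neq continuous_intros)
  have "AE x in lborel. h x = 0" using integral_nonneg_eq_0_iff_AE[OF assms(3)] assms by simp
  then have "AE x in lborel. x \<notin> {x. h x \<noteq> 0}" by simp
  then have "emeasure lborel {x. h x \<noteq> 0} = 0"
    by (subst (asm) AE_iff_measurable[of "{x. h x \<noteq> 0}"]) (use op in auto)
  then have "{x. h x \<noteq> 0} \<in> null_sets lebesgue" using op by (intro null_sets_completionI) auto
  then show False using open_not_negligible[OF op] \<open>h x \<noteq> 0\<close> by (auto simp: negligible_iff_null_sets)
qed

text \<open>Gram--Schmidt with respect to $\langle p, q\rangle = \int p q \eta$ for a bump $\eta$.\<close>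

lemma reproducing_family:
  "\<exists>m q w. (\<forall>i<m. polyd l (q i) \<and> test_fun (ball 0 1) (w i)) \<and>
     (\<forall>p::real^'n::finite \<Rightarrow> real. polyd l p \<longrightarrow> (\<forall>x. p x = (\<Sum>i<m::nat. (LBINT y. p y * w i y) * q i x)))"
proof -
  obtain \<eta> :: "real^'n \<Rightarrow> real" where \<eta>: "test_fun (ball 0 1) \<eta>" "\<forall>x. \<eta> x \<ge> 0" "\<forall>x\<in>ball 0 (1/2). \<eta> x > 0"
    using bump_exists[of 1 "0::real^'n"] by auto
  define B where "B p q = (LBINT x. p x * (q x * \<eta> x))" for p q :: "real^'n \<Rightarrow> real"
  have i: "integrable lborel (\<lambda>x. p x * (q x * \<eta> x))" if "polyd l p" "polyd l q" for p q
    using integrable_test_fun(1)[OF test_fun_mult_left[OF C1_polyd[OF that(1)] test_fun_mult_left[OF C1_polyd[OF that(2)] \<eta>(1)]]] .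
  have Bc: "B p q = B q p" for p q unfolding B_def by (simp add: mult.left_commute)
  have Badd: "B (\<lambda>x. p x + q x) r = B p r + B q r" if "polyd l p" "polyd l q" "polyd l r" for p q r
    unfolding B_def using i[OF that(1,3)] i[OF that(2,3)] by (simp add: distrib_right)
  have Bcm: "B (\<lambda>x. c * p x) r = c * B p r" for c p r
    unfolding B_def by (simp add: mult.assoc)
  have Bsum: "B (\<lambda>x. \<Sum>j\<in>J. c j * q j x) r = (\<Sum>j\<in>J. c j * B (q j) r)"
    if "finite J" "\<And>j. j \<in> J \<Longrightarrow> polyd l (q j)" "polyd l r" for J and c :: "nat \<Rightarrow> real" and q r
    using that
  proof (induction J)
    case empty show ?case by (simp add: B_def)
  next
    case (insert j J)
    have "B (\<lambda>x. c j * q j x + (\<Sum>j\<in>J. c j * q j x)) r = B (\<lambda>x. c j * q j x) r + B (\<lambda>x. \<Sum>j\<in>J. c j * q j x) r"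
      by (rule Badd) (use insert in \<open>auto intro!: polyd_sum polyd_cmult\<close>)
    then show ?case using insert by (simp add: Bcm)
  qed
  \<comment> \<open>Definiteness of the form: r^2 \<eta> vanishes everywhere, so r vanishes on the
    ball where \<eta> > 0, and a polynomial vanishing on a ball is zero.\<close>
  have B0: "r x = 0" if r: "polyd l r" "B r r = 0" for r x
  proof -
    have z: "r y * (r y * \<eta> y) = 0" for y
    proof (rule continuous_integral_zero[of "\<lambda>y. r y * (r y * \<eta> y)"])
      show "continuous_on UNIV (\<lambda>y. r y * (r y * \<eta> y))"
        using C1_continuous[OF C1_polyd[OF r(1)]] test_fun_continuous[OF \<eta>(1)] by (intro continuous_intros)
      show "0 \<le> r y * (r y * \<eta> y)" for y using \<eta>(2) by (simp add: mult.assoc[symmetric])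
      show "integrable lborel (\<lambda>y. r y * (r y * \<eta> y))" by (rule i[OF r(1) r(1)])
      show "(LBINT y. r y * (r y * \<eta> y)) = 0" using r(2) by (simp add: B_def)
    qed
    have zb: "r y = 0" if "y \<in> ball 0 (1/2)" for y
      using z[of y] \<eta>(3)[rule_format, OF that] by auto
    show ?thesis by (rule polyd_zero_ball[where \<rho>="1/2", OF r(1) _ zb]) simp_all
  qed
  have Bnn: "B r r \<ge> 0" for r unfolding B_def using \<eta>(2) by (simp add: mult.assoc[symmetric])
  \<comment> \<open>Orthonormality and expansion are carried through one induction over S. A new p
    whose remainder r has B r r = 0 already lies in the span and leaves m unchanged; otherwise r is
    normalised and appended as \<open>Q m\<close>.\<close>
  have GS: "\<exists>m q. (\<forall>i<m. polyd l (q i)) \<and> (\<forall>i<m. \<forall>j<m. B (q i) (q j) = (if i = j then 1 else 0)) \<and>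
      (\<forall>p\<in>S. \<forall>x. p x = (\<Sum>i<m::nat. B p (q i) * q i x))" if "finite S" "\<forall>p\<in>S. polyd l p" for S
    using that
  proof (induction S)
    case empty show ?case by (rule exI[of _ 0]) auto
  next
    case (insert p S)
    then obtain m :: nat and q where q: "\<forall>i<m. polyd l (q i)" "\<forall>i<m. \<forall>j<m. B (q i) (q j) = (if i = j then 1 else 0)"
      "\<forall>p\<in>S. \<forall>x. p x = (\<Sum>i<m. B p (q i) * q i x)" by auto
    have p: "polyd l p" using insert by simp
    define s where "s x = (\<Sum>i<m. B p (q i) * q i x)" for x
    define r where "r x = p x + (- 1) * s x" for x
    have s: "polyd l s" unfolding s_def[abs_def] using q(1) by (auto intro!: polyd_sum polyd_cmult)
    have r: "polyd l r" unfolding r_def[abs_def] by (intro polyd.add p polyd_cmult s)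
    have ps: "p x = r x + s x" for x by (simp add: r_def)
    have sq: "B s (q j) = B p (q j)" if "j < m" for j
    proof -
      have "B s (q j) = (\<Sum>i<m. B p (q i) * B (q i) (q j))"
        unfolding s_def[abs_def] by (rule Bsum) (use q(1) that in auto)
      also have "\<dots> = (\<Sum>i<m. if i = j then B p (q j) else 0)"
        by (intro sum.cong) (use q(2) that in auto)
      finally show ?thesis using that by simp
    qed
    have rq: "B r (q j) = 0" if "j < m" for j
    proof -
      have "B r (q j) = B p (q j) + B (\<lambda>x. (-1) * s x) (q j)"
        unfolding r_def[abs_def] by (rule Badd[OF p polyd_cmult[OF s]]) (use q(1) that in auto)
      then show ?thesis unfolding Bcm sq[OF that] by simp
    qed
    show ?case
    proof (cases "B r r = 0")
      case True
      then have "p x = s x" for x using B0[OF r] ps by simp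
      then show ?thesis using q by (intro exI[of _ m] exI[of _ q]) (auto simp: s_def)
    next
      case False
      define \<nu> where "\<nu> = sqrt (B r r)"
      have \<nu>: "\<nu> > 0" "\<nu> * \<nu> = B r r" unfolding \<nu>_def using False Bnn[of r] by auto
      define Q where "Q i = (if i = m then (\<lambda>x. (1 / \<nu>) * r x) else q i)" for i
      have Qi: "Q i = q i" if "i < m" for i using that by (simp add: Q_def)
      have Qm: "Q m = (\<lambda>x. (1 / \<nu>) * r x)" by (simp add: Q_def)
      have Qp: "polyd l (Q i)" if "i < Suc m" for i
        using that q(1) polyd_cmult[OF r, of "1 / \<nu>", folded Qm] by (cases "i = m") (simp_all add: Qi)
      have Brr: "B (Q m) (Q m) = 1"
      proof -
        have "B (Q m) (Q m) = (1 / \<nu>) * B r (Q m)" unfolding Qm by (rule Bcm)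
        also have "B r (Q m) = B (Q m) r" by (rule Bc)
        also have "\<dots> = (1 / \<nu>) * B r r" unfolding Qm by (rule Bcm)
        finally show ?thesis using \<nu>(1) unfolding \<nu>(2)[symmetric] by simp
      qed
      have Bmi: "B (Q m) (q i) = 0" if "i < m" for i using rq[OF that] unfolding Qm Bcm by simp
      have orth: "\<forall>i<Suc m. \<forall>j<Suc m. B (Q i) (Q j) = (if i = j then 1 else 0)"
      proof (intro allI impI)
        fix i j assume "i < Suc m" "j < Suc m"
        then consider "i < m" "j < m" | "i = m" "j < m" | "i < m" "j = m" | "i = m" "j = m" by linarith
        then show "B (Q i) (Q j) = (if i = j then 1 else 0)"
          by cases (use q(2) Bmi Brr Bc[of "q i" "Q m"] in \<open>auto simp: Qi\<close>)
      qed
      have step: "(\<Sum>i<Suc m. B f (Q i) * Q i x) = (\<Sum>i<m. B f (q i) * q i x) + B f (Q m) * Q m x" for f x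
        using Qi by simp
      have old: "\<forall>x. f x = (\<Sum>i<Suc m. B f (Q i) * Q i x)" if f: "f \<in> S" for f
      proof -
        have fe: "f = (\<lambda>x. \<Sum>i<m. B f (q i) * q i x)" using q(3) f by blast
        have "B f (Q m) = B (\<lambda>x. \<Sum>i<m. B f (q i) * q i x) (Q m)" using fe by simp
        also have "\<dots> = (\<Sum>i<m. B f (q i) * B (q i) (Q m))" by (rule Bsum) (use q(1) Qp in auto)
        also have "\<dots> = 0" using Bmi Bc[of _ "Q m"] by simp
        finally have "B f (Q m) = 0" .
        then show ?thesis unfolding step using q(3) f by simp
      qed
      have new: "p x = (\<Sum>i<Suc m. B p (Q i) * Q i x)" for x
      proof -
        have "p = (\<lambda>x. r x + s x)" using ps by auto
        then have "B p (Q m) = B (\<lambda>x. r x + s x) (Q m)" by simp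
        also have "\<dots> = B r (Q m) + B s (Q m)"
          by (rule Badd) (use r s Qp in auto)
        finally have "B p (Q m) = B r (Q m) + B s (Q m)" .
        moreover have "B s (Q m) = (\<Sum>i<m. B p (q i) * B (q i) (Q m))"
          unfolding s_def[abs_def] by (rule Bsum) (use q(1) Qp in auto)
        moreover have "\<dots> = 0" using Bmi Bc[of _ "Q m"] by simp
        moreover have "B r (Q m) = \<nu>"
        proof -
          have "B r (Q m) = B (Q m) r" by (rule Bc)
          also have "\<dots> = (1 / \<nu>) * B r r" unfolding Qm by (rule Bcm)
          finally show ?thesis using \<nu>(1) unfolding \<nu>(2)[symmetric] by simp
        qed
        ultimately have "B p (Q m) * Q m x = r x" using \<nu> by (simp add: Qm)
        then show ?thesis unfolding step using ps[of x] by (simp add: s_def)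
      qed
      show ?thesis using Qp orth old new by (intro exI[of _ "Suc m"] exI[of _ Q]) auto
    qed
  qed
  have "finite (mono ` (multi l :: ('n \<Rightarrow> nat) set))" "\<forall>p\<in>mono ` (multi l :: ('n \<Rightarrow> nat) set). polyd l p"
    using finite_multi[of l] polyd_mono by auto
  from GS[OF this] obtain m :: nat and q where q: "\<forall>i<m. polyd l (q i)"
    "\<forall>p\<in>mono ` (multi l :: ('n \<Rightarrow> nat) set). \<forall>x. p x = (\<Sum>i<m. B p (q i) * q i x)" by blast
  have rep: "p x = (\<Sum>i<m. B p (q i) * q i x)" if p: "polyd l p" for p x
  proof -
    obtain c where c: "p = (\<lambda>x. \<Sum>\<alpha>\<in>multi l. c \<alpha> * mono \<alpha> x)" using p unfolding polyd_iff by blast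
    have Bp: "B p (q i) = (\<Sum>\<alpha>\<in>multi l. c \<alpha> * B (mono \<alpha>) (q i))" if "i < m" for i
    proof -
      have "B p (q i) = (LBINT x. (\<Sum>\<alpha>\<in>multi l. c \<alpha> * (mono \<alpha> x * (q i x * \<eta> x))))"
        unfolding B_def c by (simp add: sum_distrib_right mult.assoc)
      also have "\<dots> = (\<Sum>\<alpha>\<in>multi l. c \<alpha> * B (mono \<alpha>) (q i))"
        unfolding B_def using i[OF polyd_mono] q(1) that by (subst Bochner_Integration.integral_sum) auto
      finally show ?thesis .
    qed
    have "p x = (\<Sum>\<alpha>\<in>multi l. c \<alpha> * (\<Sum>i<m. B (mono \<alpha>) (q i) * q i x))"
      unfolding c using q(2) by (intro sum.cong) auto
    also have "\<dots> = (\<Sum>i<m. (\<Sum>\<alpha>\<in>multi l. c \<alpha> * B (mono \<alpha>) (q i)) * q i x)"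
      unfolding sum_distrib_left sum_distrib_right by (subst sum.swap) (simp add: mult.assoc)
    also have "\<dots> = (\<Sum>i<m. B p (q i) * q i x)" using Bp by (intro sum.cong) auto
    finally show ?thesis .
  qed
  \<comment> \<open>The dual functions are q_i \<eta>. The factor \<eta> gives them compact support
    in the open unit ball, so that elements of H^{-1} can be evaluated on them after
    transport.\<close>
  show ?thesis
    by (rule exI[of _ m], rule exI[of _ q], rule exI[of _ "\<lambda>i x. q i x * \<eta> x"])
      (use q(1) rep test_fun_mult_left[OF C1_polyd \<eta>(1)] in \<open>auto simp: B_def\<close>)
qed

section \<open>Rescaling and negative norms\<close>


text \<open>On the open complement of C the function is identically zero, so the gradient vanishes
  there as well and only a compact set contributes.\<close>

lemma test_fun_grad_L2:
  assumes "test_fun U w"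
  shows "integrable lborel (\<lambda>x. (norm (grad w x))\<^sup>2)"
proof -
  obtain C where C: "C1 w" "compact C" "C \<subseteq> U" "\<forall>x. x \<notin> C \<longrightarrow> w x = 0" by (rule test_funE[OF assms])
  have z: "grad w x = 0" if "x \<notin> C" for x
  proof -
    have "((\<lambda>x. 0) has_derivative (\<lambda>h. 0)) (at x)" by simp
    then have "(w has_derivative (\<lambda>h. 0)) (at x)"
      by (rule has_derivative_transform_within_open[where s="- C"])
        (use that C compact_imp_closed[OF C(2)] in auto)
    then have "(w has_derivative (\<lambda>h. 0 \<bullet> h)) (at x)" by simp
    then show ?thesis by (rule frechet_derivative_eq_inner(2))
  qed
  have "continuous_on C (\<lambda>x. (norm (grad w x))\<^sup>2)"
    by (intro continuous_intros continuous_on_subset[OF C1_grad(2)[OF C(1)]]) auto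
  from borel_integrable_compact[OF C(2) this]
  have "integrable lborel (\<lambda>x. indicator C x *\<^sub>R (norm (grad w x))\<^sup>2)" .
  moreover have "indicator C x *\<^sub>R (norm (grad w x))\<^sup>2 = (norm (grad w x))\<^sup>2" for x
    using z[of x] by (auto simp: indicator_def)
  ultimately show ?thesis by (simp only:)
qed

text \<open>Normalised in L1, so that pairing with p gives the pairing of p(c + r x) with the
  original w, as in \<open>integral_rescale\<close>. The argument is written in the form
  \<open>A x + b\<close> of \<open>C1_affine\<close>.\<close>

definition rescale :: "'a::euclidean_space \<Rightarrow> real \<Rightarrow> ('a \<Rightarrow> real) \<Rightarrow> 'a \<Rightarrow> real" where
  "rescale c r w x = (1 / r ^ DIM('a)) * w ((1 / r) *\<^sub>R x + - ((1 / r) *\<^sub>R c))"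

lemma rescale_at: "r > 0 \<Longrightarrow> rescale c r w (c + r *\<^sub>R x) = w x / r ^ DIM('a)" for c :: "'a::euclidean_space"
  by (simp add: rescale_def scaleR_add_right)

lemma test_fun_rescale:
  fixes c :: "'a::euclidean_space"
  assumes w: "test_fun (ball 0 1) w" and r: "r > 0"
  shows "test_fun (ball c r) (rescale c r w)"
    "grad (rescale c r w) (c + r *\<^sub>R x) = (1 / r ^ (DIM('a) + 1)) *\<^sub>R grad w x"
proof -
  let ?S = "\<lambda>x. (1 / r) *\<^sub>R x + - ((1 / r) *\<^sub>R c)"
  obtain C where C: "C1 w" "compact C" "C \<subseteq> ball 0 1" "\<forall>x. x \<notin> C \<longrightarrow> w x = 0" by (rule test_funE[OF w])
  show "test_fun (ball c r) (rescale c r w)"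
  proof (rule test_funI)
    have "linear (\<lambda>x::'a. (1 / r) *\<^sub>R x)" by (auto intro!: linearI simp: scaleR_add_right)
    from C1_cmult[OF C1_affine[OF C(1) this]] show "C1 (rescale c r w)" unfolding rescale_def[abs_def] .
    show "compact ((\<lambda>x. c + r *\<^sub>R x) ` C)" by (intro compact_continuous_image continuous_intros C(2))
    show "(\<lambda>x. c + r *\<^sub>R x) ` C \<subseteq> ball c r"
    proof
      fix y assume "y \<in> (\<lambda>x. c + r *\<^sub>R x) ` C"
      then obtain x where "x \<in> C" "y = c + r *\<^sub>R x" by auto
      then show "y \<in> ball c r" using C(3) r by (auto simp: dist_norm)
    qed
    show "rescale c r w x = 0" if "x \<notin> (\<lambda>x. c + r *\<^sub>R x) ` C" for x
    proof -
      have "c + r *\<^sub>R ?S x = x" using r by (simp add: scaleR_add_right scaleR_diff_right)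
      then have "?S x \<notin> C" using that imageI[of "?S x" C "\<lambda>x. c + r *\<^sub>R x"] by auto
      then show ?thesis using C(4) by (simp add: rescale_def)
    qed
  qed
  have S: "?S (c + r *\<^sub>R x) = x" using r by (simp add: scaleR_add_right)
  have "(?S has_derivative (\<lambda>h. (1 / r) *\<^sub>R h)) (at (c + r *\<^sub>R x))" by (auto intro!: derivative_eq_intros)
  from has_derivative_compose[OF this C1_grad(1)[OF C(1)]]
  have "((\<lambda>y. w (?S y)) has_derivative (\<lambda>h. grad w x \<bullet> ((1 / r) *\<^sub>R h))) (at (c + r *\<^sub>R x))" unfolding S .
  then have "((\<lambda>y. (1 / r ^ DIM('a)) * w (?S y)) has_derivative (\<lambda>h. (1 / r ^ DIM('a)) * (grad w x \<bullet> ((1 / r) *\<^sub>R h)))) (at (c + r *\<^sub>R x))"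
    by (rule has_derivative_mult_right)
  then have "(rescale c r w has_derivative (\<lambda>h. ((1 / r ^ (DIM('a) + 1)) *\<^sub>R grad w x) \<bullet> h)) (at (c + r *\<^sub>R x))"
    unfolding rescale_def[abs_def] by (rule has_derivative_eq_rhs) (simp add: fun_eq_iff)
  then show "grad (rescale c r w) (c + r *\<^sub>R x) = (1 / r ^ (DIM('a) + 1)) *\<^sub>R grad w x"
    by (rule frechet_derivative_eq_inner(2))
qed

text \<open>The substitution contributes r^n, with n the dimension. Squaring the normalising factor
  gives r^(-2n), leaving r^(-n); a squared gradient costs a further r^(-2). The square root of this
  last power is the origin of the factor 1/h_x in the final estimate.\<close>

lemma integral_rescale:
  fixes c :: "'a::euclidean_space"
  assumes w: "test_fun (ball 0 1) w" and r: "r > 0"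
  shows "C1 p \<Longrightarrow> (LBINT x. p x * rescale c r w x) = (LBINT x. p (c + r *\<^sub>R x) * w x)"
    "(LBINT x. (rescale c r w x)\<^sup>2) = (LBINT x. (w x)\<^sup>2) / r ^ DIM('a)"
    "(LBINT x. (norm (grad (rescale c r w) x))\<^sup>2) = (LBINT x. (norm (grad w x))\<^sup>2) / r ^ (DIM('a) + 2)"
proof -
  note t = test_fun_rescale[OF w r]
  have sub: "(LBINT x. g x) = r ^ DIM('a) * (LBINT x. g (c + r *\<^sub>R x))" if "integrable lborel g" for g :: "'a \<Rightarrow> real"
    using lborel_affine_integral(2)[OF that, of r c] r by simp
  show "(LBINT x. p x * rescale c r w x) = (LBINT x. p (c + r *\<^sub>R x) * w x)" if "C1 p"
    by (subst sub[OF integrable_test_fun(1)[OF test_fun_mult_left[OF that t(1)[of c]]]])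
      (use r in \<open>simp add: rescale_at\<close>)
  show "(LBINT x. (rescale c r w x)\<^sup>2) = (LBINT x. (w x)\<^sup>2) / r ^ DIM('a)"
    by (subst sub[OF integrable_test_fun(2)[OF t(1)[of c]]])
      (use r in \<open>simp add: rescale_at power_divide power2_eq_square\<close>)
  have rr: "r ^ DIM('a) * (1 / r ^ (DIM('a) + 1))\<^sup>2 = 1 / r ^ (DIM('a) + 2)"
    using r by (simp add: power2_eq_square field_simps)
  have "(LBINT x. (norm (grad (rescale c r w) x))\<^sup>2)
      = r ^ DIM('a) * (LBINT x. (1 / r ^ (DIM('a) + 1))\<^sup>2 * (norm (grad w x))\<^sup>2)"
    by (subst sub[OF test_fun_grad_L2[OF t(1)[of c]]]) (simp add: t(2) power_mult_distrib power_divide)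
  also have "\<dots> = (r ^ DIM('a) * (1 / r ^ (DIM('a) + 1))\<^sup>2) * (LBINT x. (norm (grad w x))\<^sup>2)" by simp
  finally show "(LBINT x. (norm (grad (rescale c r w) x))\<^sup>2) = (LBINT x. (norm (grad w x))\<^sup>2) / r ^ (DIM('a) + 2)"
    unfolding rr by simp
qed

section \<open>Evaluating elements of H^{-1} on test functions\<close>

lemma L2norm_grad_le:
  assumes "test_fun U w" "K \<in> sets borel"
  shows "L2norm K (grad w) \<le> sqrt (LBINT x. (norm (grad w x))\<^sup>2)"
  unfolding L2norm_def set_lebesgue_integral_def
  by (intro real_sqrt_le_mono integral_mono test_fun_grad_L2[OF assms(1)] integrable_mult_indicator)
    (use assms(2) in \<open>auto simp: indicator_def\<close>)

text \<open>\<open>Hm1norm\<close> is a real \<open>Sup\<close> of quotients without absolute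
  values. The constant from \<open>Hm1\<close> bounds the set above, -w provides the other sign, and
  a test function with vanishing gradient norm, excluded from the set, is sent to 0 by that same
  constant.\<close>

lemma Hm1norm_bound:
  assumes \<xi>: "Hm1 X \<xi>" and w: "test_fun (interior X) w"
  shows "\<bar>\<xi> w\<bar> \<le> Hm1norm X \<xi> * L2norm X (grad w)"
proof -
  obtain M where M: "\<forall>w. test_fun (interior X) w \<longrightarrow> \<bar>\<xi> w\<bar> \<le> M * L2norm X (grad w)"
    using \<xi> unfolding Hm1_def by blast
  show ?thesis
  proof (cases "L2norm X (grad w) = 0")
    case True then show ?thesis using M[rule_format, OF w] by simp
  next
    case False
    then have N: "L2norm X (grad w) > 0" using L2norm_nonneg[of X "grad w"] by linarith
    let ?S = "{\<xi> w / L2norm X (grad w) | w. test_fun (interior X) w \<and> L2norm X (grad w) \<noteq> 0}"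
    have bdd: "bdd_above ?S"
    proof (rule bdd_aboveI[of _ M])
      fix s assume "s \<in> ?S"
      then obtain u where u: "s = \<xi> u / L2norm X (grad u)" "test_fun (interior X) u" "L2norm X (grad u) \<noteq> 0" by blast
      have "L2norm X (grad u) > 0" using u(3) L2norm_nonneg[of X "grad u"] by linarith
      moreover have "\<xi> u \<le> M * L2norm X (grad u)" using M[rule_format, OF u(2)] by linarith
      ultimately show "s \<le> M" unfolding u(1) by (simp add: divide_le_eq)
    qed
    define w' where "w' x = (-1) * w x + 0 * w x" for x
    have w': "test_fun (interior X) w'" unfolding w'_def[abs_def] by (rule test_fun_lincomb[OF w w])
    have \<xi>w': "\<xi> w' = - \<xi> w"
    proof -
      have "\<forall>w1 w2 a b. test_fun (interior X) w1 \<and> test_fun (interior X) w2 \<longrightarrow>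
          \<xi> (\<lambda>x. a * w1 x + b * w2 x) = a * \<xi> w1 + b * \<xi> w2" using \<xi> unfolding Hm1_def by blast
      from this[rule_format, of w w "-1" 0] w show ?thesis unfolding w'_def[abs_def] by simp
    qed
    have "grad w' x = - grad w x" for x
    proof (rule frechet_derivative_eq_inner(2))
      have "((\<lambda>x. - w x) has_derivative (\<lambda>h. - (grad w x \<bullet> h))) (at x)"
        by (rule has_derivative_minus[OF C1_grad(1)[OF test_fun_C1[OF w]]])
      then show "(w' has_derivative (\<lambda>h. (- grad w x) \<bullet> h)) (at x)" by (simp add: w'_def[abs_def])
    qed
    then have Nw': "L2norm X (grad w') = L2norm X (grad w)" by (simp add: L2norm_def)
    have "\<xi> u / L2norm X (grad u) \<le> Hm1norm X \<xi>" if "test_fun (interior X) u" "L2norm X (grad u) \<noteq> 0" for u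
      unfolding Hm1norm_def by (rule cSup_upper[OF _ bdd]) (use that in blast)
    from this[OF w False] this[OF w'] have "\<xi> w / L2norm X (grad w) \<le> Hm1norm X \<xi>"
      "- \<xi> w / L2norm X (grad w) \<le> Hm1norm X \<xi>" using \<xi>w' Nw' False by simp_all
    then have "\<xi> w \<le> Hm1norm X \<xi> * L2norm X (grad w)" "- \<xi> w \<le> Hm1norm X \<xi> * L2norm X (grad w)"
      unfolding pos_divide_le_eq[OF N] by simp_all
    then show ?thesis by (simp add: abs_le_iff)
  qed
qed

lemma L2Hm1_pairing:
  assumes g: "L2Hm1 T X g" and w: "test_fun (interior X) w"
  shows "L2on T (\<lambda>t. g t w)" "L2norm T (\<lambda>t. g t w) \<le> L2norm X (grad w) * L2Hm1norm T X g"
proof -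
  define N where "N = L2norm X (grad w)"
  have b: "\<bar>g t w\<bar> \<le> Hm1norm X (g t) * N" if "t \<in> T" for t
    unfolding N_def by (rule Hm1norm_bound[OF _ w]) (use g that in \<open>auto simp: L2Hm1_def\<close>)
  have m: "(\<lambda>t. indicator T t * g t w) \<in> borel_measurable lborel"
    using g w unfolding L2Hm1_def set_borel_measurable_def by auto
  define I where "I = (\<integral>\<^sup>+ t. indicator T t * ennreal ((Hm1norm X (g t))\<^sup>2) \<partial>lborel)"
  have I: "I < \<infinity>" using g unfolding L2Hm1_def I_def by blast
  have Lg: "L2Hm1norm T X g = sqrt (enn2real I)" by (simp add: L2Hm1norm_def I_def)
  \<comment> \<open>Dividing by N before integrating leaves a pointwise comparison with the square
    of \<open>Hm1norm\<close>, for which monotonicity of the nonnegative integral suffices;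
    measurability of t \<mapsto> \<open>Hm1norm X (g t)\<close> is not at hand. For N = 0 the
    quotient is 0 by convention, and g t w = 0 on T by \<open>b\<close>.\<close>
  define F where "F t = (indicator T t * g t w / N)\<^sup>2" for t
  have N0: "N \<ge> 0" by (simp add: N_def L2norm_nonneg)
  have gF: "(indicator T t * g t w)\<^sup>2 = N\<^sup>2 * F t" for t
    using b[of t] by (cases "N = 0"; cases "t \<in> T") (auto simp: F_def power_divide)
  have "(\<integral>\<^sup>+ t. ennreal (F t) \<partial>lborel) \<le> I"
    unfolding I_def
  proof (rule nn_integral_mono)
    fix t
    have "F t \<le> (Hm1norm X (g t))\<^sup>2" if t: "t \<in> T"
    proof (cases "N = 0")
      case False
      then have "\<bar>g t w / N\<bar> \<le> Hm1norm X (g t)" using b[OF t] N0 by (simp add: divide_le_eq)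
      then have "\<bar>g t w / N\<bar>\<^sup>2 \<le> (Hm1norm X (g t))\<^sup>2" by (intro power_mono) auto
      then show ?thesis using t by (simp add: F_def del: abs_divide)
    qed (simp add: F_def)
    then show "ennreal (F t) \<le> indicator T t * ennreal ((Hm1norm X (g t))\<^sup>2)"
      by (cases "t \<in> T") (auto simp: F_def intro!: ennreal_leI)
  qed
  moreover have Fm: "F \<in> borel_measurable lborel" unfolding F_def[abs_def] using m by simp
  moreover have F0: "F t \<ge> 0" for t by (simp add: F_def)
  ultimately have Fi: "integrable lborel F" "(LBINT t. F t) \<le> enn2real I"
    using I by (auto intro!: integrableI_nonneg enn2real_mono simp: integral_eq_nn_integral less_top)
  show "L2on T (\<lambda>t. g t w)" by (rule L2onI[OF m]) (use Fi in \<open>simp add: gF\<close>)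
  have "L2norm T (\<lambda>t. g t w) = sqrt (N\<^sup>2 * (LBINT t. F t))" unfolding L2norm_eq gF by simp
  also have "\<dots> \<le> sqrt (N\<^sup>2 * enn2real I)" using Fi(2) by (intro real_sqrt_le_mono mult_left_mono) auto
  also have "\<dots> = N * L2Hm1norm T X g" using N0 by (simp add: real_sqrt_mult Lg)
  finally show "L2norm T (\<lambda>t. g t w) \<le> L2norm X (grad w) * L2Hm1norm T X g" by (simp add: N_def)
qed

text \<open>The weak identities see only the interior of K, while the norms are taken over K. The
  frontier of a convex set is negligible, so nothing is lost.\<close>

lemma convex_minus_interior_null:
  fixes K :: "'a::euclidean_space set"
  assumes "convex K" "K \<in> sets borel"
  shows "K - interior K \<in> null_sets lborel"
proof -
  have "K - interior K \<subseteq> frontier K" using closure_subset by (auto simp: frontier_def)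
  then have "negligible (K - interior K)" using negligible_convex_frontier[OF assms(1)] negligible_subset by blast
  then show ?thesis using assms(2) by (simp add: negligible_iff_null_sets null_sets_completion_iff)
qed

lemma L2on_continuous_bounded:
  fixes p :: "'a::euclidean_space \<Rightarrow> real"
  assumes "K \<in> sets borel" "bounded K" "continuous_on UNIV p"
  shows "L2on K p"
proof -
  have "bounded (p ` closure K)"
    using assms by (intro compact_imp_bounded compact_continuous_image continuous_on_subset[OF assms(3)]) (auto simp: compact_closure)
  then obtain B where B: "\<forall>y\<in>p ` closure K. norm y \<le> B" unfolding bounded_iff by blast
  have "\<bar>p x\<bar> \<le> B" if "x \<in> K" for x
    using B[rule_format, OF imageI[of x]] that subsetD[OF closure_subset, of x K] by simp
  then show ?thesis by (rule L2on_continuous(1)[OF assms])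
qed

section \<open>The approximation estimate\<close>


lemma AE_lborel_fst:
  assumes "AE t in lborel. P t" shows "AE z in (lborel :: (real \<times> 'a::euclidean_space) measure). P (fst z)"
proof -
  obtain N where N: "N \<in> null_sets lborel" "{t \<in> space lborel. \<not> P t} \<subseteq> N"
    using assms unfolding eventually_ae_filter by blast
  have "N \<times> (UNIV :: 'a set) \<in> null_sets (lborel \<Otimes>\<^sub>M lborel)"
    using N(1) by (rule lborel.times_in_null_sets1) simp
  then have "N \<times> (UNIV :: 'a set) \<in> null_sets lborel" by (simp add: lborel_prod)
  then show ?thesis by (rule AE_I') (use N(2) in auto)
qed

text \<open>Explicit constants make the independence of K visible: s bounds h_x / r, V r^n bounds
  the volume of K_x, and Q, E, G bound the reference functions. After transport the L2 norms of w_i,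
  grad w_i and q_i are at most sqrt (E / r^n), sqrt (G / r^(n+2)) and Q sqrt (V r^n). Their products
  are free of r, up to one factor 1/r \<le> s / h_x in the time part.\<close>

lemma quasi_optimality_explicit:
  fixes Kx :: "(real^'n::finite) set" and q w :: "nat \<Rightarrow> real^'n \<Rightarrow> real" and m :: nat
    and \<omega> :: "real^'n \<Rightarrow> real"
  assumes q: "\<And>i. i < m \<Longrightarrow> polyd l (q i)" and w: "\<And>i. i < m \<Longrightarrow> test_fun (ball 0 1) (w i)"
    and rep: "\<And>p x. polyd l p \<Longrightarrow> p x = (\<Sum>i<m. (LBINT y. p y * w i y) * q i x)"
    and \<omega>: "test_fun (ball 0 1) \<omega>" "\<And>x. 0 \<le> \<omega> x" "\<And>x. \<omega> x \<le> W" "(LBINT x. \<omega> x) = 1"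
    and Q: "\<And>i x. i < m \<Longrightarrow> norm x \<le> s \<Longrightarrow> \<bar>q i x\<bar> \<le> Q" "Q \<ge> 0"
    and E: "\<And>i. i < m \<Longrightarrow> (LBINT x. (w i x)\<^sup>2) \<le> E"
    and G: "\<And>i. i < m \<Longrightarrow> (LBINT x. (norm (grad (w i) x))\<^sup>2) \<le> G"
    and s: "s \<ge> 1" and V: "V = measure lborel (ball 0 1 :: (real^'n) set) * s ^ DIM(real^'n)"
    and Kt: "is_interval Kt" "bounded Kt" "measure lborel Kt > 0"
    and Kx: "convex Kx" "compact Kx" and r: "r > 0" "ball c r \<subseteq> Kx" "diameter Kx \<le> s * r"
    and v: "L2on (Kt \<times> Kx) v" and vx: "L2Pl Kt l vx" and H: "L2on (Kt \<times> Kx) H"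
    and xg: "xgrad (Kt \<times> Kx) (\<lambda>z. v z - vx z) H"
    and g: "L2Hm1 Kt Kx g"
    and td: "has_tderiv Kt Kx (\<lambda>t w. pair Kx v t w - (\<Sum>j\<le>k. t ^ j * \<xi> j w)) g"
  shows "\<exists>vh. tpoly k l vh \<and> L2norm (Kt \<times> Kx) (\<lambda>z. v z - vh z)
    \<le> (1 + m * (Q * sqrt (E * V))) * (2 ^ DIM(real^'n) * (1 + W * V)) * (diameter Kx * L2norm (Kt \<times> Kx) H)
      + m * (2 * Q * sqrt (G * V) * s) * (measure lborel Kt / diameter Kx * L2Hm1norm Kt Kx g)"
proof -
  define n where "n = DIM(real^'n)"
  define K where "K = Kt \<times> Kx"
  define h where "h = diameter Kx"
  have Ktm: "Kt \<in> sets borel" using interval_endpoints[OF Kt] by blast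
  have Kxm: "Kx \<in> sets borel" using Kx(2) by (simp add: borel_closed compact_imp_closed)
  have bKx: "bounded Kx" using Kx(2) compact_imp_bounded by blast
  have Km: "K \<in> sets borel" unfolding K_def using Ktm Kxm by (simp add: borel_Times)
  have bK: "bounded K" unfolding K_def using Kt bKx by (simp add: bounded_Times)
  have nul: "Kt \<times> Kx - interior (Kt \<times> Kx) \<in> null_sets lborel"
    by (rule convex_minus_interior_null)
      (use Km Kx Kt(1) in \<open>auto simp: K_def is_interval_convex intro!: convex_Times\<close>)
  have "2 * r \<le> h" using diameter_subset[OF r(2) bKx] r(1) by (simp add: h_def)
  then have h: "h > 0" using r(1) by linarith
  have cK: "c \<in> Kx" using r by auto
  have hx: "norm (x - c) \<le> h" if "x \<in> Kx" for x
    using diameter_bounded_bound[OF bKx that cK] by (simp add: h_def dist_norm)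
  have rn: "r ^ n > 0" using r by simp
  have V0: "V \<ge> 0" unfolding V using s by simp
  \<comment> \<open>K_x lies in the closed ball about c of radius h_x \<le> s r.\<close>
  have mKx: "measure lborel Kx \<le> V * r ^ n"
  proof -
    have "measure lborel Kx \<le> measure lborel (cball c h)"
      by (rule measure_mono_fmeasurable)
        (use hx Kxm in \<open>auto simp: dist_norm norm_minus_commute fmeasurable_compact\<close>)
    also have "\<dots> = h ^ n * measure lborel (ball 0 1 :: (real^'n) set)"
      using content_ball_conv_unit_ball[of h c] h by (simp add: n_def content_cball_conv_ball)
    also have "\<dots> \<le> (s * r) ^ n * measure lborel (ball 0 1 :: (real^'n) set)"
      using r(3) h by (intro mult_right_mono power_mono) (auto simp: h_def)
    finally show ?thesis by (simp add: V n_def power_mult_distrib mult_ac)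
  qed
  have intb: "ball c r \<subseteq> interior Kx" using r(2) by (simp add: interior_maximal)
  define ws where "ws i = rescale c r (w i)" for i
  define \<omega>s where "\<omega>s = rescale c r \<omega>"
  have tws: "test_fun (interior Kx) (ws i)" if "i < m" for i
    unfolding ws_def using test_fun_mono[OF test_fun_rescale(1)[OF w[OF that] r(1)] intb] .
  have t\<omega>: "test_fun (interior Kx) \<omega>s"
    unfolding \<omega>s_def using test_fun_mono[OF test_fun_rescale(1)[OF \<omega>(1) r(1)] intb] .
  have \<omega>s: "0 \<le> \<omega>s x" "\<omega>s x \<le> W / r ^ n" "(LBINT x. \<omega>s x) = 1" for x
    using \<omega>(2,3) rn integral_rescale(1)[OF \<omega>(1) r(1) C1_const[of 1], of c] \<omega>(4)
    by (auto simp: \<omega>s_def rescale_def n_def divide_right_mono)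
  \<comment> \<open>Transported without a normalising factor; the dual functions \<open>ws\<close>
    carry it.\<close>
  define qs where "qs i x = q i ((1 / r) *\<^sub>R x + - ((1 / r) *\<^sub>R c))" for i x
  have qsp: "polyd l (qs i)" if "i < m" for i
    unfolding qs_def[abs_def] by (rule polyd_affine[OF q[OF that]])
  have qsc: "continuous_on UNIV (qs i)" if "i < m" for i by (rule C1_continuous[OF C1_polyd[OF qsp[OF that]]])
  have qsQ: "\<bar>qs i x\<bar> \<le> Q" if "i < m" "x \<in> Kx" for i x
    unfolding qs_def
  proof (rule Q(1)[OF that(1)])
    have "norm ((1 / r) *\<^sub>R x + - ((1 / r) *\<^sub>R c)) = norm ((1 / r) *\<^sub>R (x - c))" by (simp add: scaleR_diff_right)
    also have "\<dots> = norm (x - c) / r" using r(1) by simp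
    also have "\<dots> \<le> (s * r) / r" using hx[OF that(2)] r by (intro divide_right_mono) (auto simp: h_def)
    finally show "norm ((1 / r) *\<^sub>R x + - ((1 / r) *\<^sub>R c)) \<le> s" using r(1) by simp
  qed
  have qsL: "L2on Kx (qs i)" "L2norm Kx (qs i) \<le> Q * sqrt (V * r ^ n)" if "i < m" for i
  proof -
    note c = L2on_continuous[OF Kxm bKx qsc[OF that] qsQ[OF that]]
    show "L2on Kx (qs i)" by (rule c(1))
    have "(L2norm Kx (qs i))\<^sup>2 \<le> Q\<^sup>2 * (V * r ^ n)" using c(2) mKx by (meson mult_left_mono order_trans zero_le_power2)
    then have "sqrt ((L2norm Kx (qs i))\<^sup>2) \<le> sqrt (Q\<^sup>2 * (V * r ^ n))" by (rule real_sqrt_le_mono)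
    then show "L2norm Kx (qs i) \<le> Q * sqrt (V * r ^ n)" using Q(2) L2norm_nonneg[of Kx "qs i"] by (simp add: real_sqrt_mult)
  qed
  have reps: "p x = (\<Sum>i<m. (LBINT y. p y * ws i y) * qs i x)" if p: "polyd l p" for p x
  proof -
    have pd: "polyd l (\<lambda>y. p (r *\<^sub>R y + c))" by (rule polyd_affine[OF p])
    have "r *\<^sub>R ((1 / r) *\<^sub>R x + - ((1 / r) *\<^sub>R c)) + c = x" using r(1) by (simp add: scaleR_add_right scaleR_diff_right)
    then have "p x = (\<Sum>i<m. (LBINT y. p (r *\<^sub>R y + c) * w i y) * qs i x)"
      using rep[OF pd, of "(1 / r) *\<^sub>R x + - ((1 / r) *\<^sub>R c)"] by (simp add: qs_def)
    also have "\<dots> = (\<Sum>i<m. (LBINT y. p y * ws i y) * qs i x)"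
      using integral_rescale(1)[OF w r(1) C1_polyd[OF p], of _ c]
      by (intro sum.cong refl) (simp add: ws_def add.commute)
    finally show ?thesis .
  qed
  obtain cx where cx: "\<forall>\<alpha>. L2on Kt (cx \<alpha>)" "vx = (\<lambda>(t, x). \<Sum>\<alpha>\<in>multi l. cx \<alpha> t * mono \<alpha> x)"
    using vx unfolding L2Pl_def by blast
  have vxL: "L2on K vx"
  proof -
    have "L2on K (\<lambda>z. \<Sum>\<alpha>\<in>multi l. cx \<alpha> (fst z) * mono \<alpha> (snd z))"
    proof (rule L2on_sum[OF finite_multi, THEN conjunct1])
      fix \<alpha> :: "'n \<Rightarrow> nat" assume "\<alpha> \<in> multi l"
      then have "continuous_on UNIV (mono \<alpha>)" by (intro C1_continuous C1_polyd polyd_mono)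
      then show "L2on K (\<lambda>z. cx \<alpha> (fst z) * mono \<alpha> (snd z))" unfolding K_def
        by (intro L2on_tensor(1) cx(1)[rule_format] L2on_continuous_bounded[OF Kxm bKx])
    qed
    then show ?thesis unfolding cx(2) case_prod_unfold .
  qed
  define f where "f z = v z - vx z" for z
  have fL: "L2on K f" unfolding f_def[abs_def] by (rule L2on_diff[OF v[folded K_def] vxL])
  \<comment> \<open>\<open>u0\<close> depends on t alone. Thus v = e + (vx + u0), where the bracket
    is at each time a polynomial of degree at most l in x and e is the function estimated by
    \<open>weighted_poincare\<close>.\<close>
  define u0 where "u0 t = pair Kx f t \<omega>s" for t
  define e where "e z = f z - u0 (fst z)" for z
  define c1 where "c1 = 2 ^ DIM(real^'n) * (1 + W * V)"
  have W0: "W \<ge> 0" using \<omega>(2,3)[of undefined] by linarith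
  have c10: "c1 \<ge> 0" unfolding c1_def using W0 V0 by simp
  note wp = weighted_poincare[OF Ktm Kt(2) Kxm bKx Kx(1) nul t\<omega> \<omega>s fL[unfolded K_def] H xg[folded f_def]]
  have eL: "L2on K e" using wp(1) by (simp add: e_def[abs_def] u0_def K_def)
  have en: "L2norm K e \<le> c1 * (h * L2norm K H)"
  proof -
    have "W / r ^ n * measure lborel Kx \<le> W / r ^ n * (V * r ^ n)" using W0 rn mKx by (intro mult_left_mono) auto
    also have "\<dots> = W * V" using r(1) by simp
    finally have a: "1 + W / r ^ n * measure lborel Kx \<le> 1 + W * V" by simp
    have "L2norm K e \<le> 2 ^ DIM(real^'n) * h * (1 + W / r ^ n * measure lborel Kx) * L2norm K H"
      using wp(2) by (simp add: e_def[abs_def] u0_def K_def h_def)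
    also have "\<dots> \<le> 2 ^ DIM(real^'n) * h * (1 + W * V) * L2norm K H"
      using a h by (intro mult_right_mono mult_left_mono L2norm_nonneg) auto
    finally show ?thesis by (simp add: c1_def mult_ac)
  qed
  define a where "a i t = pair Kx v t (ws i)" for i t
  define b where "b i t = pair Kx e t (ws i)" for i t
  have wsb: "ws i \<in> borel_measurable borel" "integrable lborel (\<lambda>x. (ws i x)\<^sup>2)" if "i < m" for i
    using test_fun_borel[OF tws[OF that]] integrable_test_fun(2)[OF tws[OF that]] by auto
  have aL: "L2on Kt (a i)" if "i < m" for i
    unfolding a_def using pair_L2(1)[OF v wsb[OF that]] .
  have bL: "L2on Kt (b i)" "L2norm Kt (b i) \<le> sqrt (E / r ^ n) * L2norm K e" if "i < m" for i
  proof -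
    note p = pair_L2[OF eL[unfolded K_def] wsb[OF that]]
    show "L2on Kt (b i)" unfolding b_def by (rule p(1))
    have "L2norm Kt (b i) \<le> sqrt (LBINT x. (ws i x)\<^sup>2) * L2norm K e" unfolding b_def K_def by (rule p(2))
    also have "\<dots> \<le> sqrt (E / r ^ n) * L2norm K e"
      using integral_rescale(2)[OF w[OF that] r(1), of c] E[OF that] rn
      by (intro mult_right_mono L2norm_nonneg real_sqrt_le_mono) (auto simp: ws_def n_def divide_right_mono)
    finally show "L2norm Kt (b i) \<le> sqrt (E / r ^ n) * L2norm K e" .
  qed

  \<comment> \<open>A is \<Pi> v and B is \<Pi> e, with \<Pi> acting at each time.\<close>
  define A where "A z = (\<Sum>i<m. a i (fst z) * qs i (snd z))" for z
  define B where "B z = (\<Sum>i<m. b i (fst z) * qs i (snd z))" for z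
  have AL: "L2on K A" unfolding A_def[abs_def] K_def
    by (rule L2on_sum[THEN conjunct1]) (auto intro!: L2on_tensor(1) aL qsL)
  have BL: "L2on K B \<and> L2norm K B \<le> (\<Sum>i<m. L2norm K (\<lambda>z. b i (fst z) * qs i (snd z)))"
    unfolding B_def[abs_def] K_def
    by (rule L2on_sum) (auto intro!: L2on_tensor(1) bL qsL)
  have Bn: "L2norm K B \<le> m * (Q * sqrt (E * V)) * L2norm K e"
  proof -
    have "L2norm K (\<lambda>z. b i (fst z) * qs i (snd z)) \<le> Q * sqrt (E * V) * L2norm K e" if i: "i < m" for i
    proof -
      have "L2norm K (\<lambda>z. b i (fst z) * qs i (snd z)) = L2norm Kt (b i) * L2norm Kx (qs i)"
        unfolding K_def by (rule L2on_tensor(2)[OF bL(1)[OF i] qsL(1)[OF i]])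
      also have "\<dots> \<le> (sqrt (E / r ^ n) * L2norm K e) * (Q * sqrt (V * r ^ n))"
        by (rule mult_mono[OF bL(2)[OF i] qsL(2)[OF i] order_trans[OF L2norm_nonneg bL(2)[OF i]] L2norm_nonneg])
      also have "\<dots> = Q * (sqrt (E / r ^ n) * sqrt (V * r ^ n)) * L2norm K e" by (simp only: mult_ac)
      also have "sqrt (E / r ^ n) * sqrt (V * r ^ n) = sqrt (E * V)"
        unfolding real_sqrt_mult[symmetric] using r(1) by simp
      finally show ?thesis .
    qed
    then have "(\<Sum>i<m. L2norm K (\<lambda>z. b i (fst z) * qs i (snd z))) \<le> (\<Sum>i<m. Q * sqrt (E * V) * L2norm K e)"
      by (intro sum_mono) auto
    then show ?thesis using BL by simp
  qed

  \<comment> \<open>The pairing of v = e + P with w_i splits into two integrals once the slice e(t,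
    .) is integrable, which holds for almost every t. As \<Pi> reproduces P, it follows that v -
    \<Pi> v = e - \<Pi> e almost everywhere on K.\<close>
  have "AE t in lborel. integrable lborel (\<lambda>x. indicator K (t, x) * e (t, x))"
    by (rule lborel_Fubini(3)[OF L2on_integrable[OF eL Km bK]])
  from AE_lborel_fst[OF this, where 'a="real^'n"]
  have ae: "AE z in lborel. z \<in> K \<longrightarrow> v z - A z = e z - B z"
  proof eventually_elim
    case (elim z)
    show ?case
    proof
      assume zK: "z \<in> K"
      define t where "t = fst z"
      have t: "t \<in> Kt" using zK by (auto simp: t_def K_def)
      define P where "P x = vx (t, x) + u0 t" for x
      have Pp: "polyd l P"
      proof -
        have "polyd l (\<lambda>x. vx (t, x))" unfolding cx(2) polyd_iff by (rule exI[of _ "\<lambda>\<alpha>. cx \<alpha> t"]) simp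
        from polyd.add[OF this polyd.const[of l "u0 t"]] show ?thesis by (simp add: P_def[abs_def])
      qed
      have vP: "v (t, x) = e (t, x) + P x" for x by (simp add: e_def f_def P_def)
      have ab: "a i t = b i t + (LBINT y. P y * ws i y)" if i: "i < m" for i
      proof -
        have i1: "integrable lborel (\<lambda>x. (indicator K (t, x) * e (t, x)) * ws i x)"
          by (rule integrable_mult_continuous[OF elim[folded t_def] bKx _ test_fun_continuous[OF tws[OF i]]])
            (auto simp: K_def)
        have i2: "integrable lborel (\<lambda>x. P x * ws i x)"
          by (rule integrable_test_fun(1)[OF test_fun_mult_left[OF C1_polyd[OF Pp] tws[OF i]]])
        have z: "ws i x = 0" if "x \<notin> Kx" for x
          using test_fun_eq_0[OF tws[OF i]] that interior_subset by blast
        have "a i t = (LBINT x. (indicator K (t, x) * v (t, x)) * ws i x)"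
          unfolding a_def K_def by (rule pair_eq[OF t])
        also have "\<dots> = (LBINT x. (indicator K (t, x) * e (t, x)) * ws i x + P x * ws i x)"
          using z t by (intro Bochner_Integration.integral_cong) (auto simp: vP indicator_def K_def algebra_simps)
        also have "\<dots> = (LBINT x. (indicator K (t, x) * e (t, x)) * ws i x) + (LBINT x. P x * ws i x)"
          using i1 i2 by simp
        also have "(LBINT x. (indicator K (t, x) * e (t, x)) * ws i x) = b i t"
          unfolding b_def K_def by (rule pair_eq[OF t, symmetric])
        finally show ?thesis .
      qed
      have "A z = (\<Sum>i<m. b i t * qs i (snd z)) + (\<Sum>i<m. (LBINT y. P y * ws i y) * qs i (snd z))"
        unfolding A_def t_def[symmetric] sum.distrib[symmetric] using ab by (intro sum.cong) (auto simp: distrib_right)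
      also have "\<dots> = B z + P (snd z)" unfolding reps[OF Pp, symmetric] by (simp add: B_def t_def)
      finally show "v z - A z = e z - B z" using vP[of "snd z"] by (simp add: t_def)
    qed
  qed
  have vA: "L2norm K (\<lambda>z. v z - A z) \<le> (1 + m * (Q * sqrt (E * V))) * c1 * (h * L2norm K H)"
  proof -
    have "L2norm K (\<lambda>z. v z - A z) = L2norm K (\<lambda>z. e z - B z)"
      using L2on_diff[OF v[folded K_def] AL] L2on_diff[OF eL] BL ae by (intro L2norm_cong_AE) auto
    also have "\<dots> = L2norm K (\<lambda>z. e z + (-1) * B z)" by simp
    also have "\<dots> \<le> L2norm K e + L2norm K (\<lambda>z. (-1) * B z)"
      by (rule L2on_add(2)[OF eL L2on_cmult(1)]) (use BL in blast)
    also have "L2norm K (\<lambda>z. (-1) * B z) = L2norm K B" using L2on_cmult(2)[of K B "-1"] BL by simp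
    also have "L2norm K e + L2norm K B \<le> (1 + m * (Q * sqrt (E * V))) * L2norm K e" using Bn by (simp add: algebra_simps)
    also have "\<dots> \<le> (1 + m * (Q * sqrt (E * V))) * (c1 * (h * L2norm K H))"
    \<comment> \<open>E \<ge> 0 follows from the bound on some w_i, so an index below m has to
      exist.\<close>
    proof (cases "m = 0")
      case False
      have "(LBINT x. (w 0 x)\<^sup>2) \<ge> 0" by simp
      then have "E \<ge> 0" using E[of 0] False by linarith
      then show ?thesis using en Q(2) V0 by (intro mult_left_mono) auto
    qed (use en in simp)
    finally show ?thesis by (simp add: mult.assoc)
  qed

  \<comment> \<open>The approximant v_t paired with w_i: a polynomial of degree at most k in t. By
    \<open>td\<close> the difference a_i - p_i has the scalar weak derivative g paired with
    w_i.\<close>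
  define p where "p i t = (\<Sum>j\<le>k. t ^ j * \<xi> j (ws i))" for i t
  define \<kappa> where "\<kappa> = 2 * measure lborel Kt * L2Hm1norm Kt Kx g"
  have N0: "L2Hm1norm Kt Kx g \<ge> 0" by (simp add: L2Hm1norm_def)
  have "\<exists>cc. L2norm Kt (\<lambda>t. (a i t - p i t) - cc) \<le> \<kappa> * sqrt (G / r ^ (n + 2)) \<and> L2on Kt (\<lambda>t. a i t - p i t)" if i: "i < m" for i
  proof -
    have "continuous_on UNIV (p i)" unfolding p_def by (intro continuous_intros)
    from L2on_diff[OF aL[OF i] L2on_continuous_bounded[OF Ktm Kt(2) this]]
    have yL: "L2on Kt (\<lambda>t. a i t - p i t)" .
    note gw = L2Hm1_pairing[OF g tws[OF i]]
    have "\<exists>cc. L2norm Kt (\<lambda>t. (a i t - p i t) - cc) \<le> 2 * measure lborel Kt * L2norm Kt (\<lambda>t. g t (ws i))"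
    proof (rule poincare_interval[OF Kt yL gw(1)])
      fix \<phi> :: "real \<Rightarrow> real" assume "test_fun (interior Kt) \<phi>"
      then show "- (LINT t:Kt|lborel. (a i t - p i t) * deriv \<phi> t) = (LINT t:Kt|lborel. g t (ws i) * \<phi> t)"
        using td tws[OF i] unfolding has_tderiv_def a_def p_def by blast
    qed
    then obtain cc where cc: "L2norm Kt (\<lambda>t. (a i t - p i t) - cc) \<le> 2 * measure lborel Kt * L2norm Kt (\<lambda>t. g t (ws i))" ..
    have "L2norm Kx (grad (ws i)) \<le> sqrt (LBINT x. (norm (grad (ws i) x))\<^sup>2)"
      by (rule L2norm_grad_le[OF tws[OF i] Kxm])
    also have "\<dots> \<le> sqrt (G / r ^ (n + 2))"
      unfolding ws_def n_def integral_rescale(3)[OF w[OF i] r(1)]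
      using G[OF i] r(1) by (intro real_sqrt_le_mono divide_right_mono) auto
    finally have gr: "L2norm Kx (grad (ws i)) \<le> sqrt (G / r ^ (n + 2))" .
    have "L2norm Kt (\<lambda>t. g t (ws i)) \<le> sqrt (G / r ^ (n + 2)) * L2Hm1norm Kt Kx g"
      using gw(2) mult_right_mono[OF gr N0] by linarith
    then have "2 * measure lborel Kt * L2norm Kt (\<lambda>t. g t (ws i)) \<le> 2 * measure lborel Kt * (sqrt (G / r ^ (n + 2)) * L2Hm1norm Kt Kx g)"
      using Kt(3) by (intro mult_left_mono) auto
    then have "L2norm Kt (\<lambda>t. (a i t - p i t) - cc) \<le> \<kappa> * sqrt (G / r ^ (n + 2))" using cc by (simp add: \<kappa>_def mult_ac)
    then show ?thesis using yL by blast
  qed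
  then have "\<forall>i. \<exists>cc. i < m \<longrightarrow> L2norm Kt (\<lambda>t. (a i t - p i t) - cc) \<le> \<kappa> * sqrt (G / r ^ (n + 2)) \<and> L2on Kt (\<lambda>t. a i t - p i t)"
    by blast
  then obtain cc where "\<forall>i. i < m \<longrightarrow> L2norm Kt (\<lambda>t. (a i t - p i t) - cc i) \<le> \<kappa> * sqrt (G / r ^ (n + 2)) \<and> L2on Kt (\<lambda>t. a i t - p i t)"
    by (rule choice[THEN exE])
  then have cc: "L2norm Kt (\<lambda>t. (a i t - p i t) - cc i) \<le> \<kappa> * sqrt (G / r ^ (n + 2))" "L2on Kt (\<lambda>t. a i t - p i t)" if "i < m" for i
    using that by blast+
  have ccL: "L2on Kt (\<lambda>t. (a i t - p i t) - cc i)" if "i < m" for i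
    using L2on_diff[OF cc(2)[OF that] L2on_continuous_bounded[OF Ktm Kt(2), of "\<lambda>t. cc i"]] by simp
  \<comment> \<open>D is \<Pi> v - vh. The numbers \<open>cc i\<close> are the constants produced by
    the Poincare inequality on the interval.\<close>
  define D where "D z = (\<Sum>i<m. ((a i (fst z) - p i (fst z)) - cc i) * qs i (snd z))" for z
  have DL: "L2on K D \<and> L2norm K D \<le> (\<Sum>i<m. L2norm K (\<lambda>z. ((a i (fst z) - p i (fst z)) - cc i) * qs i (snd z)))"
    unfolding D_def[abs_def] K_def
    by (rule L2on_sum) (auto intro!: L2on_tensor(1)[of _ "\<lambda>t. (a i t - p i t) - cc i" for i] ccL qsL)
  have Dn: "L2norm K D \<le> m * (2 * Q * sqrt (G * V) * s) * (measure lborel Kt / h * L2Hm1norm Kt Kx g)"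
  proof -
    have "L2norm K (\<lambda>z. ((a i (fst z) - p i (fst z)) - cc i) * qs i (snd z))
        \<le> (2 * Q * sqrt (G * V) * s) * (measure lborel Kt / h * L2Hm1norm Kt Kx g)" if i: "i < m" for i
    proof -
      have "(LBINT x. (norm (grad (w i) x))\<^sup>2) \<ge> 0" by simp
      then have G0: "G \<ge> 0" using G[OF i] by linarith
      have "L2norm K (\<lambda>z. ((a i (fst z) - p i (fst z)) - cc i) * qs i (snd z))
          = L2norm Kt (\<lambda>t. (a i t - p i t) - cc i) * L2norm Kx (qs i)"
        unfolding K_def using L2on_tensor(2)[OF ccL[OF i] qsL(1)[OF i]] by simp
      also have "\<dots> \<le> (\<kappa> * sqrt (G / r ^ (n + 2))) * (Q * sqrt (V * r ^ n))"
        by (rule mult_mono[OF cc(1)[OF i] qsL(2)[OF i] order_trans[OF L2norm_nonneg cc(1)[OF i]] L2norm_nonneg])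
      also have "\<dots> = \<kappa> * Q * (sqrt (G / r ^ (n + 2)) * sqrt (V * r ^ n))" by (simp only: mult_ac)
      also have "sqrt (G / r ^ (n + 2)) * sqrt (V * r ^ n) = sqrt (G * V) * (1 / r)"
      proof -
        have "sqrt (G / r ^ (n + 2)) * sqrt (V * r ^ n) = sqrt (G * V * (1 / r)\<^sup>2)"
          unfolding real_sqrt_mult[symmetric] using r(1) by (simp add: power_add field_simps power2_eq_square)
        also have "\<dots> = sqrt (G * V) * (1 / r)" using r(1) by (simp add: real_sqrt_mult)
        finally show ?thesis .
      qed
      also have "\<kappa> * Q * (sqrt (G * V) * (1 / r)) \<le> \<kappa> * Q * (sqrt (G * V) * (s / h))"
      proof (intro mult_left_mono)
        show "1 / r \<le> s / h" using r(1,3) h by (simp add: h_def field_simps)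
        show "0 \<le> sqrt (G * V)" using G0 V0 by simp
        show "0 \<le> \<kappa> * Q" unfolding \<kappa>_def using Kt(3) N0 Q(2) by simp
      qed
      also have "\<dots> = (2 * Q * sqrt (G * V) * s) * (measure lborel Kt / h * L2Hm1norm Kt Kx g)"
        by (simp add: \<kappa>_def)
      finally show ?thesis .
    qed
    then have "(\<Sum>i<m. L2norm K (\<lambda>z. ((a i (fst z) - p i (fst z)) - cc i) * qs i (snd z)))
        \<le> (\<Sum>i<m. (2 * Q * sqrt (G * V) * s) * (measure lborel Kt / h * L2Hm1norm Kt Kx g))"
      by (intro sum_mono) auto
    then show ?thesis using DL by (simp add: mult.assoc)
  qed

  define vh where "vh z = (\<Sum>i<m. (cc i + p i (fst z)) * qs i (snd z))" for z
  have dec: "v z - vh z = (v z - A z) + D z" for z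
    by (simp add: vh_def A_def D_def algebra_simps sum.distrib sum_subtractf)
  have "L2norm K (\<lambda>z. v z - vh z) \<le> L2norm K (\<lambda>z. v z - A z) + L2norm K D"
    unfolding dec using DL by (intro L2on_add(2) L2on_diff[OF v[folded K_def] AL]) auto
  also have "\<dots> \<le> (1 + m * (Q * sqrt (E * V))) * c1 * (h * L2norm K H)
      + m * (2 * Q * sqrt (G * V) * s) * (measure lborel Kt / h * L2Hm1norm Kt Kx g)"
    using vA Dn by linarith
  finally have fin: "L2norm K (\<lambda>z. v z - vh z) \<le> \<dots>" .
  have "\<forall>i. \<exists>d. i < m \<longrightarrow> qs i = (\<lambda>x. \<Sum>\<alpha>\<in>multi l. d \<alpha> * mono \<alpha> x)" using qsp unfolding polyd_iff by blast
  then obtain d where "\<forall>i. i < m \<longrightarrow> qs i = (\<lambda>x. \<Sum>\<alpha>\<in>multi l. d i \<alpha> * mono \<alpha> x)" by (rule choice[THEN exE])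
  then have d: "qs i x = (\<Sum>\<alpha>\<in>multi l. d i \<alpha> * mono \<alpha> x)" if "i < m" for i x using that by simp
  have "tpoly k l vh" unfolding tpoly_def
  \<comment> \<open>The constant \<open>cc i\<close> joins the coefficient of t^0, so the degree in
    time stays at most k, also for k = 0.\<close>
  proof (rule exI[of _ "\<lambda>j \<alpha>. \<Sum>i<m. ((if j = 0 then cc i else 0) + \<xi> j (ws i)) * d i \<alpha>"], rule ext)
    fix z :: "real \<times> (real^'n)"
    obtain t x where z: "z = (t, x)" by (cases z)
    have cp: "cc i + p i t = (\<Sum>j\<le>k. ((if j = 0 then cc i else 0) + \<xi> j (ws i)) * t ^ j)" for i
    proof -
      have "(\<Sum>j\<le>k. ((if j = 0 then cc i else 0) + \<xi> j (ws i)) * t ^ j)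
          = (\<Sum>j\<le>k. (if j = 0 then cc i else 0) * t ^ j) + (\<Sum>j\<le>k. t ^ j * \<xi> j (ws i))"
        by (simp only: distrib_right sum.distrib mult.commute[of "\<xi> _ _"])
      also have "(\<Sum>j\<le>k. (if j = 0 then cc i else 0) * t ^ j) = (\<Sum>j\<le>k. if j = 0 then cc i else 0)"
        by (intro sum.cong) auto
      also have "\<dots> = cc i" by simp
      finally show ?thesis by (simp only: p_def)
    qed
    have "vh z = (\<Sum>i<m. \<Sum>j\<le>k. \<Sum>\<alpha>\<in>multi l. ((if j = 0 then cc i else 0) + \<xi> j (ws i)) * t ^ j * (d i \<alpha> * mono \<alpha> x))"
      unfolding vh_def z fst_conv snd_conv cp sum_distrib_right
      by (intro sum.cong refl) (simp add: d sum_distrib_left)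
    also have "\<dots> = (\<Sum>j\<le>k. \<Sum>i<m. \<Sum>\<alpha>\<in>multi l. ((if j = 0 then cc i else 0) + \<xi> j (ws i)) * t ^ j * (d i \<alpha> * mono \<alpha> x))"
      by (rule sum.swap)
    also have "\<dots> = (\<Sum>j\<le>k. \<Sum>\<alpha>\<in>multi l. \<Sum>i<m. ((if j = 0 then cc i else 0) + \<xi> j (ws i)) * t ^ j * (d i \<alpha> * mono \<alpha> x))"
      by (intro sum.cong refl sum.swap)
    also have "\<dots> = (\<Sum>j\<le>k. \<Sum>\<alpha>\<in>multi l. (\<Sum>i<m. ((if j = 0 then cc i else 0) + \<xi> j (ws i)) * d i \<alpha>) * t ^ j * mono \<alpha> x)"
      unfolding sum_distrib_right by (intro sum.cong refl) (simp only: mult_ac)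
    finally show "vh z = (case z of (t, x) \<Rightarrow> \<Sum>j\<le>k. \<Sum>\<alpha>\<in>multi l.
        (\<Sum>i<m. ((if j = 0 then cc i else 0) + \<xi> j (ws i)) * d i \<alpha>) * t ^ j * mono \<alpha> x)" by (simp add: z)
  qed
  then show ?thesis using fin by (intro exI[of _ vh]) (simp add: K_def h_def c1_def)
qed


text \<open>The reference functions are fixed before K is given, and \<sigma> enters only through s
  = max 1 \<sigma>, the radius on which the q_i are bounded. The estimate is for one arbitrary pair
  of vx and \<xi>, so that the infima can be taken afterwards.\<close>

lemma quasi_optimality:
  "\<exists>C>0. \<forall>Kt (Kx :: (real^'n::finite) set) v vx H \<xi> g.
     is_interval Kt \<and> bounded Kt \<and> measure lborel Kt > 0 \<and> convex Kx \<and> compact Kx \<and> shape_bound \<sigma> Kx \<and>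
     L2on (Kt \<times> Kx) v \<and> L2Pl Kt l vx \<and> L2on (Kt \<times> Kx) H \<and> xgrad (Kt \<times> Kx) (\<lambda>z. v z - vx z) H \<and>
     L2Hm1 Kt Kx g \<and> has_tderiv Kt Kx (\<lambda>t w. pair Kx v t w - (\<Sum>j\<le>k. t ^ j * \<xi> j w)) g \<longrightarrow>
     (\<exists>vh. tpoly k l vh \<and> L2norm (Kt \<times> Kx) (\<lambda>z. v z - vh z)
        \<le> C * (diameter Kx * L2norm (Kt \<times> Kx) H + measure lborel Kt / diameter Kx * L2Hm1norm Kt Kx g))"
proof -
  obtain m :: nat and q w :: "nat \<Rightarrow> real^'n \<Rightarrow> real" where
    fam: "\<forall>i<m. polyd l (q i) \<and> test_fun (ball 0 1) (w i)"
      "\<forall>p::real^'n \<Rightarrow> real. polyd l p \<longrightarrow> (\<forall>x. p x = (\<Sum>i<m. (LBINT y. p y * w i y) * q i x))"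
    using reproducing_family[of l, where 'n='n] by blast
  obtain \<omega> :: "real^'n \<Rightarrow> real" where \<omega>: "test_fun (ball 0 1) \<omega>" "\<forall>x. \<omega> x \<ge> 0" "(LBINT x. \<omega> x) = 1"
    using weight_exists[of 1 "0::real^'n"] by auto
  obtain W where W: "W > 0" "\<And>x. \<bar>\<omega> x\<bar> \<le> W" using test_fun_bounded[OF \<omega>(1)] by metis
  define s where "s = max 1 \<sigma>"
  have "\<forall>i. \<exists>B. i < m \<longrightarrow> (\<forall>x\<in>cball 0 s. \<bar>q i x\<bar> \<le> B)"
  proof
    fix i show "\<exists>B. i < m \<longrightarrow> (\<forall>x\<in>cball 0 s. \<bar>q i x\<bar> \<le> B)"
    proof (cases "i < m")
      case True
      then have "bounded (q i ` cball 0 s)"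
        using fam(1) by (intro compact_imp_bounded compact_continuous_image C1_continuous C1_polyd) auto
      then show ?thesis unfolding bounded_iff by auto
    qed simp
  qed
  then obtain Qf where Qf: "\<forall>i. i < m \<longrightarrow> (\<forall>x\<in>cball 0 s. \<bar>q i x\<bar> \<le> Qf i)" by (rule choice[THEN exE])
  define Q where "Q = (\<Sum>i<m. \<bar>Qf i\<bar>)"
  define E where "E = (\<Sum>i<m. LBINT x. (w i x)\<^sup>2)"
  define G where "G = (\<Sum>i<m. LBINT x. (norm (grad (w i) x))\<^sup>2)"
  define V where "V = measure lborel (ball 0 1 :: (real^'n) set) * s ^ DIM(real^'n)"
  have s: "s \<ge> 1" by (simp add: s_def)
  have Q0: "Q \<ge> 0" unfolding Q_def by (simp add: sum_nonneg)
  have E0: "E \<ge> 0" unfolding E_def by (simp add: sum_nonneg)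
  have G0: "G \<ge> 0" unfolding G_def by (simp add: sum_nonneg)
  have V0: "V \<ge> 0" unfolding V_def using s by simp
  have Q: "\<bar>q i x\<bar> \<le> Q" if "i < m" "norm x \<le> s" for i x
  proof -
    have "\<bar>q i x\<bar> \<le> Qf i" using Qf that by simp
    also have "\<dots> \<le> \<bar>Qf i\<bar>" by simp
    also have "\<dots> \<le> Q" unfolding Q_def by (rule member_le_sum) (use that in auto)
    finally show ?thesis .
  qed
  have E: "(LBINT x. (w i x)\<^sup>2) \<le> E" if "i < m" for i
    unfolding E_def by (rule member_le_sum[of i "{..<m}" "\<lambda>i. LBINT x. (w i x)\<^sup>2"]) (use that in auto)
  have G: "(LBINT x. (norm (grad (w i) x))\<^sup>2) \<le> G" if "i < m" for i
    unfolding G_def by (rule member_le_sum[of i "{..<m}" "\<lambda>i. LBINT x. (norm (grad (w i) x))\<^sup>2"]) (use that in auto)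
  define A where "A = (1 + m * (Q * sqrt (E * V))) * (2 ^ DIM(real^'n) * (1 + W * V))"
  define B where "B = m * (2 * Q * sqrt (G * V) * s)"
  have A0: "A \<ge> 0" unfolding A_def using Q0 E0 V0 W(1) by simp
  have B0: "B \<ge> 0" unfolding B_def using Q0 G0 V0 s by simp
  show ?thesis
  \<comment> \<open>A + B + 1 dominates both constants and is positive as soon as A and B are
    nonnegative.\<close>
  proof (rule exI[of _ "A + B + 1"], intro conjI allI impI)
    show "A + B + 1 > 0" using A0 B0 by simp
    fix Kt v vx H \<xi> g and Kx :: "(real^'n) set"
    assume a: "is_interval Kt \<and> bounded Kt \<and> measure lborel Kt > 0 \<and> convex Kx \<and> compact Kx \<and> shape_bound \<sigma> Kx \<and>
      L2on (Kt \<times> Kx) v \<and> L2Pl Kt l vx \<and> L2on (Kt \<times> Kx) H \<and> xgrad (Kt \<times> Kx) (\<lambda>z. v z - vx z) H \<and>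
      L2Hm1 Kt Kx g \<and> has_tderiv Kt Kx (\<lambda>t w. pair Kx v t w - (\<Sum>j\<le>k. t ^ j * \<xi> j w)) g"
    then obtain c r where r: "r > 0" "ball c r \<subseteq> Kx" "diameter Kx \<le> \<sigma> * r" unfolding shape_bound_def by blast
    have "\<sigma> * r \<le> s * r" using r(1) by (simp add: s_def)
    then have sr: "diameter Kx \<le> s * r" using r(3) by linarith
    let ?X = "diameter Kx * L2norm (Kt \<times> Kx) H"
    let ?Y = "measure lborel Kt / diameter Kx * L2Hm1norm Kt Kx g"
    have "\<exists>vh. tpoly k l vh \<and> L2norm (Kt \<times> Kx) (\<lambda>z. v z - vh z) \<le> A * ?X + B * ?Y"
      unfolding A_def B_def
      by (rule quasi_optimality_explicit[where q=q and w=w and \<omega>=\<omega> and W=W and V=V and vx=vx and \<xi>=\<xi> and c=c and r=r])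
        (use fam \<omega> W Q Q0 E G s V_def a r sr in \<open>auto intro: order_trans[OF abs_ge_self]\<close>)
    then obtain vh where vh: "tpoly k l vh" "L2norm (Kt \<times> Kx) (\<lambda>z. v z - vh z) \<le> A * ?X + B * ?Y" by blast
    have bd: "diameter Kx \<ge> 0" using a by (intro diameter_ge_0 compact_imp_bounded) auto
    have X0: "?X \<ge> 0" using bd by (intro mult_nonneg_nonneg L2norm_nonneg)
    have Y0: "?Y \<ge> 0" using bd a by (simp add: L2Hm1norm_def)
    have "A * ?X + B * ?Y \<le> (A + B + 1) * ?X + (A + B + 1) * ?Y"
      using A0 B0 X0 Y0 by (intro add_mono mult_right_mono) auto
    then show "\<exists>vh. tpoly k l vh \<and> L2norm (Kt \<times> Kx) (\<lambda>z. v z - vh z) \<le> (A + B + 1) * (?X + ?Y)"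
      using vh by (intro exI[of _ vh]) (auto simp: distrib_left)
  qed
qed

section \<open>Optimal constants and passage to the infima\<close>

lemma L2norm_minus_mean_le:
  fixes v :: "'a::euclidean_space \<Rightarrow> real"
  assumes v: "L2on K v" and K: "K \<in> sets borel" "bounded K" "measure lborel K > 0"
  shows "L2norm K (\<lambda>z. v z - mean K v) \<le> L2norm K (\<lambda>z. v z - c)"
proof -
  define \<mu> where "\<mu> = mean K v"
  have indK: "integrable lborel (indicator K :: 'a \<Rightarrow> real)" "(LBINT x. indicator K x) = measure lborel K"
    using K emeasure_bounded_finite[of K] by (auto intro!: integrable_real_indicator)
  have "L2on K (\<lambda>z. \<mu>)" by (rule L2on_continuous_bounded[OF K(1,2)]) auto
  note u = L2on_diff[OF v this]
  define u0 where "u0 z = indicator K z * (v z - \<mu>)" for z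
  have u0: "integrable lborel u0" "integrable lborel (\<lambda>z. (u0 z)\<^sup>2)"
    using L2on_integrable[OF u K(1,2)] L2on_ext(2)[OF u] by (auto simp: u0_def[abs_def])
  have vi: "integrable lborel (\<lambda>z. indicator K z * v z)" by (rule L2on_integrable[OF v K(1,2)])
  have "(LBINT z. u0 z) = (LBINT z. indicator K z * v z - \<mu> * indicator K z)"
    by (intro Bochner_Integration.integral_cong) (auto simp: u0_def algebra_simps)
  also have "\<dots> = (LBINT z. indicator K z * v z) - \<mu> * measure lborel K" using vi indK by simp
  also have "\<dots> = 0" using K(3) by (simp add: \<mu>_def mean_def set_lebesgue_integral_def)
  finally have z: "(LBINT z. u0 z) = 0" .
  \<comment> \<open>Since \<open>u0\<close> has integral zero, the cross term integrates to 0 and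
    Pythagoras shows that the mean is the best constant.\<close>
  have eq: "(indicator K z * (v z - c))\<^sup>2 = (u0 z)\<^sup>2 + 2 * (\<mu> - c) * u0 z + (\<mu> - c)\<^sup>2 * indicator K z" for z
    by (auto simp: u0_def indicator_def power2_eq_square algebra_simps)
  have "(LBINT z. (indicator K z * (v z - c))\<^sup>2) = (LBINT z. (u0 z)\<^sup>2) + (\<mu> - c)\<^sup>2 * measure lborel K"
    unfolding eq using u0 indK z by simp
  moreover have "(\<mu> - c)\<^sup>2 * measure lborel K \<ge> 0" by simp
  ultimately have "(LBINT z. (u0 z)\<^sup>2) \<le> (LBINT z. (indicator K z * (v z - c))\<^sup>2)" by linarith
  then show ?thesis unfolding L2norm_eq u0_def \<mu>_def[symmetric] by (rule real_sqrt_le_mono)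
qed

lemma tpoly_0_0:
  fixes f :: "real \<times> (real^'n::finite) \<Rightarrow> real"
  assumes "tpoly 0 0 f" shows "\<exists>c. f = (\<lambda>z. c)"
proof -
  obtain c where c: "f = (\<lambda>(t, x). \<Sum>j\<le>0. \<Sum>\<alpha>\<in>multi 0. c j \<alpha> * t ^ j * mono \<alpha> x)"
    using assms unfolding tpoly_def by blast
  have "multi 0 = {\<lambda>_::'n. 0::nat}" by (auto simp: multi_def fun_eq_iff)
  then have "f = (\<lambda>z. c 0 (\<lambda>_. 0))" unfolding c by (auto simp: mono_def fun_eq_iff)
  then show ?thesis by blast
qed

text \<open>The infima are taken one after the other: the inequality is solved for a with b fixed,
  and the result is then solved for b.\<close>

lemma le_Inf_combination:
  fixes S1 S2 :: "real set"
  assumes "S1 \<noteq> {}" "S2 \<noteq> {}" "C > 0" "\<alpha> > 0" "\<beta> > 0"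
    and le: "\<And>a b. a \<in> S1 \<Longrightarrow> b \<in> S2 \<Longrightarrow> x \<le> C * (\<alpha> * a + \<beta> * b)"
  shows "x \<le> C * (\<alpha> * Inf S1 + \<beta> * Inf S2)"
proof -
  have 1: "(x / C - \<beta> * b) / \<alpha> \<le> Inf S1" if b: "b \<in> S2" for b
    by (rule cInf_greatest[OF assms(1)]) (use le[OF _ b] assms in \<open>simp add: field_simps\<close>)
  have "(x / C - \<alpha> * Inf S1) / \<beta> \<le> Inf S2"
  proof (rule cInf_greatest[OF assms(2)])
    fix b assume "b \<in> S2"
    then have "x / C - \<beta> * b \<le> Inf S1 * \<alpha>" using 1 assms(4) by (simp add: pos_divide_le_eq)
    then show "(x / C - \<alpha> * Inf S1) / \<beta> \<le> b" using assms(5) by (simp add: pos_divide_le_eq mult.commute)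
  qed
  then have "x / C - \<alpha> * Inf S1 \<le> \<beta> * Inf S2" using assms(5) by (simp add: pos_divide_le_eq mult.commute)
  then have "x / C \<le> \<alpha> * Inf S1 + \<beta> * Inf S2" by linarith
  then show ?thesis using assms(3) by (simp add: pos_divide_le_eq mult.commute)
qed

lemma simplex_convex_compact: "n simplex S \<Longrightarrow> convex S \<and> compact S"
  using simplex_imp_polytope polytope_imp_convex polytope_imp_compact by blast

text \<open>The choice vx = 0, \<xi> = 0 specialises the estimate to the first inequality. In the
  second it shows that both infima run over nonempty sets, since a real \<open>Inf {}\<close>
  carries no information.\<close>

lemma trivial_decomposition:
  assumes "xgrad (Kt \<times> Kx) v G" "has_tderiv Kt Kx (pair Kx v) g"
  shows "L2Pl Kt l (\<lambda>z. 0)" "xgrad (Kt \<times> Kx) (\<lambda>z. v z - (\<lambda>z. 0) z) G"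
    "has_tderiv Kt Kx (\<lambda>t w. pair Kx v t w - (\<Sum>j\<le>k. t ^ j * (\<lambda>j w. 0) j w)) g" "Hm1 Kx (\<lambda>w. 0)"
proof -
  show "L2Pl Kt l (\<lambda>z. 0)" unfolding L2Pl_def
    by (rule exI[of _ "\<lambda>_ _. 0"]) (use L2on_zero(1)[of Kt] in auto)
  show "Hm1 Kx (\<lambda>w. 0)" unfolding Hm1_def by (auto intro: exI[of _ 0])
qed (use assms in simp_all)

theorem mainTheorem2:
  fixes dummy :: "real^'n"
  shows
   "(\<forall>\<sigma>. \<exists>C>0. \<forall>Kt (Kx :: (real^'n) set) v G g.
       is_interval Kt \<and> bounded Kt \<and> measure lborel Kt > 0 \<and>
       int CARD('n) simplex Kx \<and> shape_bound \<sigma> Kx \<and>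
       L2on (Kt \<times> Kx) v \<and> L2on (Kt \<times> Kx) G \<and> xgrad (Kt \<times> Kx) v G \<and>
       L2Hm1 Kt Kx g \<and> has_tderiv Kt Kx (pair Kx v) g
     \<longrightarrow> L2norm (Kt \<times> Kx) (\<lambda>z. v z - mean (Kt \<times> Kx) v)
         \<le> C * (diameter Kx * L2norm (Kt \<times> Kx) G
                + measure lborel Kt / diameter Kx * L2Hm1norm Kt Kx g))
  \<and> (\<forall>k l \<sigma>. \<exists>C>0. \<forall>Kt (Kx :: (real^'n) set) v G g.
       is_interval Kt \<and> bounded Kt \<and> measure lborel Kt > 0 \<and>
       int CARD('n) simplex Kx \<and> shape_bound \<sigma> Kx \<and>
       L2on (Kt \<times> Kx) v \<and> L2on (Kt \<times> Kx) G \<and> xgrad (Kt \<times> Kx) v G \<and>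
       L2Hm1 Kt Kx g \<and> has_tderiv Kt Kx (pair Kx v) g
     \<longrightarrow> Inf {L2norm (Kt \<times> Kx) (\<lambda>z. v z - vh z) | vh. tpoly k l vh}
         \<le> C * (diameter Kx *
                  Inf {L2norm (Kt \<times> Kx) H | vx H. L2Pl Kt l vx \<and> L2on (Kt \<times> Kx) H
                        \<and> xgrad (Kt \<times> Kx) (\<lambda>z. v z - vx z) H}
                + measure lborel Kt / diameter Kx *
                  Inf {L2Hm1norm Kt Kx g' | \<xi> g'. (\<forall>j\<le>k. Hm1 Kx (\<xi> j)) \<and> L2Hm1 Kt Kx g'
                        \<and> has_tderiv Kt Kx
                             (\<lambda>t w. pair Kx v t w - (\<Sum>j\<le>k. t ^ j * \<xi> j w)) g'}))"
proof (intro conjI allI)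
  fix \<sigma> :: real
  obtain C where C: "C > 0" "\<forall>Kt (Kx :: (real^'n) set) v vx H \<xi> g.
     is_interval Kt \<and> bounded Kt \<and> measure lborel Kt > 0 \<and> convex Kx \<and> compact Kx \<and> shape_bound \<sigma> Kx \<and>
     L2on (Kt \<times> Kx) v \<and> L2Pl Kt 0 vx \<and> L2on (Kt \<times> Kx) H \<and> xgrad (Kt \<times> Kx) (\<lambda>z. v z - vx z) H \<and>
     L2Hm1 Kt Kx g \<and> has_tderiv Kt Kx (\<lambda>t w. pair Kx v t w - (\<Sum>j\<le>0. t ^ j * \<xi> j w)) g \<longrightarrow>
     (\<exists>vh. tpoly 0 0 vh \<and> L2norm (Kt \<times> Kx) (\<lambda>z. v z - vh z)
        \<le> C * (diameter Kx * L2norm (Kt \<times> Kx) H + measure lborel Kt / diameter Kx * L2Hm1norm Kt Kx g))"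
    using quasi_optimality[of \<sigma> 0 0, where 'n='n] by blast
  show "\<exists>C>0. \<forall>Kt (Kx :: (real^'n) set) v G g.
       is_interval Kt \<and> bounded Kt \<and> measure lborel Kt > 0 \<and>
       int CARD('n) simplex Kx \<and> shape_bound \<sigma> Kx \<and>
       L2on (Kt \<times> Kx) v \<and> L2on (Kt \<times> Kx) G \<and> xgrad (Kt \<times> Kx) v G \<and>
       L2Hm1 Kt Kx g \<and> has_tderiv Kt Kx (pair Kx v) g
     \<longrightarrow> L2norm (Kt \<times> Kx) (\<lambda>z. v z - mean (Kt \<times> Kx) v)
         \<le> C * (diameter Kx * L2norm (Kt \<times> Kx) G
                + measure lborel Kt / diameter Kx * L2Hm1norm Kt Kx g)"
  proof (rule exI[of _ C], intro conjI allI impI)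
    show "C > 0" by (rule C(1))
    fix Kt v G g and Kx :: "(real^'n) set"
    assume a: "is_interval Kt \<and> bounded Kt \<and> measure lborel Kt > 0 \<and>
       int CARD('n) simplex Kx \<and> shape_bound \<sigma> Kx \<and>
       L2on (Kt \<times> Kx) v \<and> L2on (Kt \<times> Kx) G \<and> xgrad (Kt \<times> Kx) v G \<and>
       L2Hm1 Kt Kx g \<and> has_tderiv Kt Kx (pair Kx v) g"
    have cc: "convex Kx" "compact Kx" using a simplex_convex_compact by blast+
    have xt: "xgrad (Kt \<times> Kx) v G" "has_tderiv Kt Kx (pair Kx v) g" using a by blast+
    note tr = trivial_decomposition[OF xt]
    obtain vh where vh: "tpoly 0 0 vh" "L2norm (Kt \<times> Kx) (\<lambda>z. v z - vh z)
        \<le> C * (diameter Kx * L2norm (Kt \<times> Kx) G + measure lborel Kt / diameter Kx * L2Hm1norm Kt Kx g)"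
      using C(2)[rule_format, of Kt Kx v "\<lambda>z. 0" G g "\<lambda>j w. 0"] a cc tr by blast
    \<comment> \<open>Degree 0 in time and space makes vh a constant, and the mean does at least as
      well.\<close>
    obtain c where c: "vh = (\<lambda>z. c)" using tpoly_0_0[OF vh(1)] by blast
    obtain c0 r where r: "r > 0" "ball c0 r \<subseteq> Kx" using a unfolding shape_bound_def by blast
    have Ktm: "Kt \<in> sets borel" using interval_endpoints[of Kt] a by blast
    have Kxm: "Kx \<in> sets borel" using cc by (simp add: borel_closed compact_imp_closed)
    have bKx: "bounded Kx" using cc compact_imp_bounded by blast
    have "measure lborel (ball c0 r) \<le> measure lborel Kx"
      by (rule measure_mono_fmeasurable) (use r cc in \<open>auto simp: fmeasurable_compact\<close>)
    then have mx: "measure lborel Kx > 0" using content_ball_pos[OF r(1), of c0] by linarith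
    have "integrable lborel (indicator Kt :: real \<Rightarrow> real)" "integrable lborel (indicator Kx :: real^'n \<Rightarrow> real)"
      using Ktm Kxm a emeasure_bounded_finite[of Kt] emeasure_bounded_finite[OF bKx]
      by (auto intro!: integrable_real_indicator)
    from lborel_integrable_tensor(2)[OF this]
    have "measure lborel (Kt \<times> Kx) = measure lborel Kt * measure lborel Kx"
      using Ktm Kxm by (simp add: indicator_times[symmetric] borel_Times)
    then have mK: "measure lborel (Kt \<times> Kx) > 0" using mx a by simp
    have "L2norm (Kt \<times> Kx) (\<lambda>z. v z - mean (Kt \<times> Kx) v) \<le> L2norm (Kt \<times> Kx) (\<lambda>z. v z - c)"
      by (rule L2norm_minus_mean_le) (use a Ktm Kxm bKx mK in \<open>auto simp: borel_Times bounded_Times\<close>)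
    then show "L2norm (Kt \<times> Kx) (\<lambda>z. v z - mean (Kt \<times> Kx) v)
        \<le> C * (diameter Kx * L2norm (Kt \<times> Kx) G + measure lborel Kt / diameter Kx * L2Hm1norm Kt Kx g)"
      using vh(2) unfolding c by linarith
  qed
next
  fix k l :: nat and \<sigma> :: real
  obtain C where C: "C > 0" "\<forall>Kt (Kx :: (real^'n) set) v vx H \<xi> g.
     is_interval Kt \<and> bounded Kt \<and> measure lborel Kt > 0 \<and> convex Kx \<and> compact Kx \<and> shape_bound \<sigma> Kx \<and>
     L2on (Kt \<times> Kx) v \<and> L2Pl Kt l vx \<and> L2on (Kt \<times> Kx) H \<and> xgrad (Kt \<times> Kx) (\<lambda>z. v z - vx z) H \<and>
     L2Hm1 Kt Kx g \<and> has_tderiv Kt Kx (\<lambda>t w. pair Kx v t w - (\<Sum>j\<le>k. t ^ j * \<xi> j w)) g \<longrightarrow>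
     (\<exists>vh. tpoly k l vh \<and> L2norm (Kt \<times> Kx) (\<lambda>z. v z - vh z)
        \<le> C * (diameter Kx * L2norm (Kt \<times> Kx) H + measure lborel Kt / diameter Kx * L2Hm1norm Kt Kx g))"
    using quasi_optimality[of \<sigma> l k, where 'n='n] by blast
  show "\<exists>C>0. \<forall>Kt (Kx :: (real^'n) set) v G g.
       is_interval Kt \<and> bounded Kt \<and> measure lborel Kt > 0 \<and>
       int CARD('n) simplex Kx \<and> shape_bound \<sigma> Kx \<and>
       L2on (Kt \<times> Kx) v \<and> L2on (Kt \<times> Kx) G \<and> xgrad (Kt \<times> Kx) v G \<and>
       L2Hm1 Kt Kx g \<and> has_tderiv Kt Kx (pair Kx v) g
     \<longrightarrow> Inf {L2norm (Kt \<times> Kx) (\<lambda>z. v z - vh z) | vh. tpoly k l vh}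
         \<le> C * (diameter Kx *
                  Inf {L2norm (Kt \<times> Kx) H | vx H. L2Pl Kt l vx \<and> L2on (Kt \<times> Kx) H
                        \<and> xgrad (Kt \<times> Kx) (\<lambda>z. v z - vx z) H}
                + measure lborel Kt / diameter Kx *
                  Inf {L2Hm1norm Kt Kx g' | \<xi> g'. (\<forall>j\<le>k. Hm1 Kx (\<xi> j)) \<and> L2Hm1 Kt Kx g'
                        \<and> has_tderiv Kt Kx
                             (\<lambda>t w. pair Kx v t w - (\<Sum>j\<le>k. t ^ j * \<xi> j w)) g'})"
  proof (rule exI[of _ C], intro conjI allI impI)
    show "C > 0" by (rule C(1))
    fix Kt v G g and Kx :: "(real^'n) set"
    assume a: "is_interval Kt \<and> bounded Kt \<and> measure lborel Kt > 0 \<and>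
       int CARD('n) simplex Kx \<and> shape_bound \<sigma> Kx \<and>
       L2on (Kt \<times> Kx) v \<and> L2on (Kt \<times> Kx) G \<and> xgrad (Kt \<times> Kx) v G \<and>
       L2Hm1 Kt Kx g \<and> has_tderiv Kt Kx (pair Kx v) g"
    have cc: "convex Kx" "compact Kx" using a simplex_convex_compact by blast+
    have xt: "xgrad (Kt \<times> Kx) v G" "has_tderiv Kt Kx (pair Kx v) g" using a by blast+
    note tr = trivial_decomposition[OF xt]
    obtain c0 r where r: "r > 0" "ball c0 r \<subseteq> Kx" using a unfolding shape_bound_def by blast
    \<comment> \<open>\<open>le_Inf_combination\<close> asks for positive weights; the inscribed
      ball gives h_x \<ge> 2 r > 0.\<close>
    have "2 * r \<le> diameter Kx" using diameter_subset[OF r(2) compact_imp_bounded[OF cc(2)]] r(1) by simp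
    then have h: "diameter Kx > 0" using r(1) by linarith
    let ?S0 = "{L2norm (Kt \<times> Kx) (\<lambda>z. v z - vh z) | vh. tpoly k l vh}"
    let ?S1 = "{L2norm (Kt \<times> Kx) H | vx H. L2Pl Kt l vx \<and> L2on (Kt \<times> Kx) H
      \<and> xgrad (Kt \<times> Kx) (\<lambda>z. v z - vx z) H}"
    let ?S2 = "{L2Hm1norm Kt Kx g' | \<xi> g'. (\<forall>j\<le>k. Hm1 Kx (\<xi> j)) \<and> L2Hm1 Kt Kx g'
      \<and> has_tderiv Kt Kx (\<lambda>t w. pair Kx v t w - (\<Sum>j\<le>k. t ^ j * \<xi> j w)) g'}"
    have "L2norm (Kt \<times> Kx) G \<in> ?S1"
      by (rule CollectI, rule exI[of _ "\<lambda>z. 0"], rule exI[of _ G]) (use a tr in blast)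
    then have n1: "?S1 \<noteq> {}" by blast
    have "L2Hm1norm Kt Kx g \<in> ?S2"
      by (rule CollectI, rule exI[of _ "\<lambda>j w. 0"], rule exI[of _ g]) (use a tr in blast)
    then have n2: "?S2 \<noteq> {}" by blast
    have bd: "bdd_below ?S0" by (rule bdd_belowI[of _ 0]) (auto simp: L2norm_nonneg)
    show "Inf ?S0 \<le> C * (diameter Kx * Inf ?S1 + measure lborel Kt / diameter Kx * Inf ?S2)"
    proof (rule le_Inf_combination[OF n1 n2 C(1) h])
      show "measure lborel Kt / diameter Kx > 0" using a h by simp
      fix \<alpha> \<beta> assume "\<alpha> \<in> ?S1" "\<beta> \<in> ?S2"
      from \<open>\<alpha> \<in> ?S1\<close> obtain vx H where H: "\<alpha> = L2norm (Kt \<times> Kx) H" "L2Pl Kt l vx" "L2on (Kt \<times> Kx) H"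
        "xgrad (Kt \<times> Kx) (\<lambda>z. v z - vx z) H" by blast
      from \<open>\<beta> \<in> ?S2\<close> obtain \<xi> g' where g': "\<beta> = L2Hm1norm Kt Kx g'" "L2Hm1 Kt Kx g'"
        "has_tderiv Kt Kx (\<lambda>t w. pair Kx v t w - (\<Sum>j\<le>k. t ^ j * \<xi> j w)) g'" by blast
      obtain vh where vh: "tpoly k l vh" "L2norm (Kt \<times> Kx) (\<lambda>z. v z - vh z)
          \<le> C * (diameter Kx * \<alpha> + measure lborel Kt / diameter Kx * \<beta>)"
        using C(2)[rule_format, of Kt Kx v vx H g' \<xi>] a cc H g' by blast
      have "Inf ?S0 \<le> L2norm (Kt \<times> Kx) (\<lambda>z. v z - vh z)" by (rule cInf_lower[OF _ bd]) (use vh(1) in blast)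
      then show "Inf ?S0 \<le> C * (diameter Kx * \<alpha> + measure lborel Kt / diameter Kx * \<beta>)" using vh(2) by linarith
    qed
  qed
qed

end
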